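(* Let $n_0=\max\{1.27\times 10^7,\ 6.5025\times 2^{(t-1)(l-1)+l}\}$. \begin{description} \item[(i)] If $t=1$, $l\ge 4$ and $n\ge \max\{n_0,\ (5.08\lfloor \tfrac{l-2}{2}\rfloor)^2+1\}$, then the extremal graph to $\mathrm{spex}_{\mathcal{OP}}(n,P_{t\cdot l})$ is $K_1\vee H_{\mathcal{OP}}(\lceil \tfrac{l-2}{2}\rceil,\lfloor \tfrac{l-2}{2}\rfloor)$. \item[(ii)] If $t=2$, $l\ge 3$ and $n\ge \max\{n_0,\ (5.08\lfloor \tfrac{2l-3}{2}\rfloor)^2+1\}$, then the extremal graph to $\mathrm{spex}_{\mathcal{OP}}(n,P_{t\cdot l})$ is $K_1\vee H_{\mathcal{OP}}(\lceil \tfrac{2l-3}{2}\rceil,\lfloor \tfrac{2l-3}{2}\rfloor)$. \item[(iii)] If $t\ge 4$, $l\ge 3$ and $n\ge n_0$, then the extremal graph to $\mathrm{spex}_{\mathcal{OP}}(n,P_{t\cdot l})$ is $K_1\vee H_{\mathcal{OP}}(tl-t-1,\,l-2)$. \end{description} Here "the extremal graph to $\mathrm{spex}_{\mathcal{OP}}(n,F)$ is $X$" means that $X$ is an $n$-vertex $F$-free outerplanar graph and every $n$-vertex $F$-free outerplanar graph of maximum spectral radius is isomorphic to $X$.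
   Context: All graphs are finite and simple. The spectral radius $\rho(G)$ of a graph $G$ is the largest eigenvalue of its adjacency matrix. A graph is outerplanar if it can be embedded in the plane with all vertices on the boundary of the outer face. A graph is $F$-free if it contains no subgraph isomorphic to $F$. $\mathrm{spex}_{\mathcal{OP}}(n,F)$ denotes the maximum spectral radius over all $n$-vertex $F$-free outerplanar graphs. $P_l$ denotes the path on $l$ vertices, $K_1$ a single vertex, and $G_1\vee G_2$ the join (disjoint union plus all edges between $G_1$ and $G_2$). $P_{t\cdot l}$ denotes the starlike tree obtained from a central vertex $v$ and $t$ vertex-disjoint copies of $P_{l-1}$ by joining $v$ to one endpoint of each copy (so $P_{t\cdot l}$ has $t(l-1)+1$ vertices, $P_{1\cdot l}=P_l$ and $P_{2\cdot l}=P_{2l-1}$). For positive integers $n,n_1,n_2$ with $n\ge n_1\ge n_2\ge 1$, $H_{\mathcal{OP}}(n_1,n_2)$ (depending on $n$) is the disjoint union of paths on $n-1$ vertices defined by: $H_{\mathcal{OP}}(n_1,n_2)=P_{n_1}\cup \frac{n-1-n_1}{n_2}P_{n_2}$ if $n_2\mid (n-1-n_1)$, and otherwise $H_{\mathcal{OP}}(n_1,n_2)=P_{n_1}\cup \lfloor \frac{n-1-n_1}{n_2}\rfloor P_{n_2}\cup P_{\,n-1-n_1-\lfloor \frac{n-1-n_1}{n_2}\rfloor n_2}$, where $kP_m$ denotes $k$ vertex-disjoint copies of $P_m$. *)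

theory Defs
  imports "HOL-Analysis.Analysis"
begin

definition graph_on :: "nat \<Rightarrow> (nat \<Rightarrow> nat \<Rightarrow> bool) \<Rightarrow> bool" where
  "graph_on n G \<longleftrightarrow> (\<forall>u v. G u v \<longrightarrow> u < n \<and> v < n \<and> u \<noteq> v \<and> G v u)"

definition edges_of :: "nat \<Rightarrow> (nat \<Rightarrow> nat \<Rightarrow> bool) \<Rightarrow> nat set set" where
  "edges_of n G = {{u, v} | u v. u < n \<and> v < n \<and> G u v}"

definition adj_matrix :: "(nat \<Rightarrow> nat \<Rightarrow> bool) \<Rightarrow> nat \<Rightarrow> nat \<Rightarrow> real" where
  "adj_matrix G i j = (if G i j then 1 else 0)"

text \<open>Eigenvalue of an n x n real matrix (the adjacency matrix is real symmetric,
  so all its eigenvalues are real).\<close>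
definition is_eigenvalue :: "nat \<Rightarrow> (nat \<Rightarrow> nat \<Rightarrow> real) \<Rightarrow> real \<Rightarrow> bool" where
  "is_eigenvalue n A \<mu> \<longleftrightarrow>
     (\<exists>x :: nat \<Rightarrow> real. (\<exists>i<n. x i \<noteq> 0) \<and> (\<forall>i<n. (\<Sum>j<n. A i j * x j) = \<mu> * x i))"

definition spectral_radius :: "nat \<Rightarrow> (nat \<Rightarrow> nat \<Rightarrow> bool) \<Rightarrow> real" where
  "spectral_radius n G = Max {\<mu>. is_eigenvalue n (adj_matrix G) \<mu>}"

definition contains_subgraph :: "nat \<Rightarrow> (nat \<Rightarrow> nat \<Rightarrow> bool) \<Rightarrow> nat \<Rightarrow> (nat \<Rightarrow> nat \<Rightarrow> bool) \<Rightarrow> bool" where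
  "contains_subgraph n G k F \<longleftrightarrow>
     (\<exists>f. inj_on f {..<k} \<and> f ` {..<k} \<subseteq> {..<n} \<and>
          (\<forall>i<k. \<forall>j<k. F i j \<longrightarrow> G (f i) (f j)))"

definition F_free :: "nat \<Rightarrow> (nat \<Rightarrow> nat \<Rightarrow> bool) \<Rightarrow> nat \<Rightarrow> (nat \<Rightarrow> nat \<Rightarrow> bool) \<Rightarrow> bool" where
  "F_free n G k F \<longleftrightarrow> \<not> contains_subgraph n G k F"

definition isomorphic :: "nat \<Rightarrow> (nat \<Rightarrow> nat \<Rightarrow> bool) \<Rightarrow> (nat \<Rightarrow> nat \<Rightarrow> bool) \<Rightarrow> bool" where
  "isomorphic n G H \<longleftrightarrow>
     (\<exists>f. bij_betw f {..<n} {..<n} \<and> (\<forall>u<n. \<forall>v<n. G u v \<longleftrightarrow> H (f u) (f v)))"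

definition outerplanar :: "nat \<Rightarrow> (nat \<Rightarrow> nat \<Rightarrow> bool) \<Rightarrow> bool" where
  "outerplanar n G \<longleftrightarrow>
     (\<exists>(pos :: nat \<Rightarrow> real^2) (\<gamma> :: nat set \<Rightarrow> real \<Rightarrow> real^2).
        inj_on pos {..<n} \<and>
        (\<forall>u<n. \<forall>v<n. G u v \<longrightarrow> arc (\<gamma> {u, v}) \<and>
            ((pathstart (\<gamma> {u, v}) = pos u \<and> pathfinish (\<gamma> {u, v}) = pos v) \<or>
             (pathstart (\<gamma> {u, v}) = pos v \<and> pathfinish (\<gamma> {u, v}) = pos u))) \<and>
        (\<forall>e\<in>edges_of n G. \<forall>f\<in>edges_of n G. e \<noteq> f \<longrightarrow>
            path_image (\<gamma> e) \<inter> path_image (\<gamma> f) \<subseteq> pos ` (e \<inter> f)) \<and>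
        (\<forall>e\<in>edges_of n G. path_image (\<gamma> e) \<inter> pos ` {..<n} \<subseteq> pos ` e) \<and>
        (\<forall>v<n. pos v \<in> frontier (outside (pos ` {..<n} \<union> (\<Union>e\<in>edges_of n G. path_image (\<gamma> e))))))"

text \<open>The starlike tree P_{t.l}: centre 0, copy j (j<t) of P_{l-1} on vertices
  1+j(l-1), ..., (j+1)(l-1); the centre is joined to the first vertex of each copy.
  It has t(l-1)+1 vertices.\<close>
definition starlike_arc :: "nat \<Rightarrow> nat \<Rightarrow> nat \<Rightarrow> nat \<Rightarrow> bool" where
  "starlike_arc t l u v \<longleftrightarrow> u < t * (l - 1) + 1 \<and> v < t * (l - 1) + 1 \<and>
     ((u = 0 \<and> 1 \<le> v \<and> (v - 1) mod (l - 1) = 0) \<or>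
      (1 \<le> u \<and> v = u + 1 \<and> (u - 1) div (l - 1) = (v - 1) div (l - 1)))"

definition starlike_tree :: "nat \<Rightarrow> nat \<Rightarrow> nat \<Rightarrow> nat \<Rightarrow> bool" where
  "starlike_tree t l u v \<longleftrightarrow> starlike_arc t l u v \<or> starlike_arc t l v u"

definition paths_union :: "nat list \<Rightarrow> nat \<Rightarrow> nat \<Rightarrow> bool" where
  "paths_union ls x y \<longleftrightarrow>
     (\<exists>k<length ls. sum_list (take k ls) \<le> x \<and> sum_list (take k ls) \<le> y \<and>
        x < sum_list (take k ls) + ls ! k \<and> y < sum_list (take k ls) + ls ! k \<and>
        (y = x + 1 \<or> x = y + 1))"

definition H_OP_list :: "nat \<Rightarrow> nat \<Rightarrow> nat \<Rightarrow> nat list" where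
  "H_OP_list n n1 n2 =
     (if n2 dvd (n - 1 - n1) then n1 # replicate ((n - 1 - n1) div n2) n2
      else n1 # replicate ((n - 1 - n1) div n2) n2 @ [n - 1 - n1 - ((n - 1 - n1) div n2) * n2])"

definition K1_join_H_OP :: "nat \<Rightarrow> nat \<Rightarrow> nat \<Rightarrow> nat \<Rightarrow> nat \<Rightarrow> bool" where
  "K1_join_H_OP n n1 n2 u v \<longleftrightarrow> u < n \<and> v < n \<and>
     ((u = 0 \<and> v \<noteq> 0) \<or> (v = 0 \<and> u \<noteq> 0) \<or>
      (u \<noteq> 0 \<and> v \<noteq> 0 \<and> paths_union (H_OP_list n n1 n2) (u - 1) (v - 1)))"

definition OP_admissible :: "nat \<Rightarrow> nat \<Rightarrow> (nat \<Rightarrow> nat \<Rightarrow> bool) \<Rightarrow> (nat \<Rightarrow> nat \<Rightarrow> bool) \<Rightarrow> bool" where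
  "OP_admissible n k F G \<longleftrightarrow> graph_on n G \<and> outerplanar n G \<and> F_free n G k F"

definition extremal_OP :: "nat \<Rightarrow> nat \<Rightarrow> (nat \<Rightarrow> nat \<Rightarrow> bool) \<Rightarrow> (nat \<Rightarrow> nat \<Rightarrow> bool) \<Rightarrow> bool" where
  "extremal_OP n k F X \<longleftrightarrow> OP_admissible n k F X \<and>
     (\<forall>G. OP_admissible n k F G \<and>
          (\<forall>G'. OP_admissible n k F G' \<longrightarrow> spectral_radius n G' \<le> spectral_radius n G)
          \<longrightarrow> isomorphic n G X)"

definition n0_bound :: "nat \<Rightarrow> nat \<Rightarrow> real" where
  "n0_bound t l = max (1.27 * 10 ^ 7) (6.5025 * 2 ^ ((t - 1) * (l - 1) + l))"

end

theory Submission
  imports Defs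
begin

text \<open>An outerplanar graph contains no subdivision of K_{2,3} and no K_4.  Hence two vertices have at
  most two common neighbours, every vertex set S spans at most 3 |S| edges, and every neighbourhood
  induces a linear forest.

  Let s be the spectral radius of an extremal graph, y its Perron vector scaled to maximum 1, and u a
  vertex with y u = 1.  Since s^2 is at least n - 1, counting 2-walks from u shows that all but about
  12 s vertices are adjacent to u, that the other entries of y are at most 12.1 / s, and that every
  vertex w not adjacent to u has s y(w) < 1.  Replacing all edges at such vertices by edges to u would
  therefore increase the spectral radius, and it would not create a forbidden tree, because the new
  leaves at u can be exchanged for unused neighbours of u.  So u is adjacent to all other vertices and
  the graph is the join of u with paths of a_1, a_2, ... vertices.

  With r + 1/r = s, the eigenvalue equation of such a fan shows that maximising the spectral radius
  means minimising the sum of g(a_i) = (1 - r^a_i) / (1 + r^(a_i + 1)).  The function g is strictly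
  concave, so moving vertices from a shorter to a longer path is always an improvement, as long as the
  tree remains excluded.\<close>

section \<open>Theta curves in the plane\<close>

text \<open>K_4 has too few vertices to contain a subdivision of K_{2,3}, so its exclusion is a
  separate topological argument, which also uses where an edge is drawn. Fans are compared exactly,
  not asymptotically: one explicit vector satisfies the eigenvalue equation at every vertex but the
  hub, whatever the path lengths, so the sign of the error at the hub decides which radius is
  larger. Exchanges alone settle the star case: t >= 4 forces the centre of the tree onto the hub
  (other vertices of a fan have degree at most 3), and the constraint then counts blocks of l - 1
  vertices. For paths the constraint couples the two longest components, and a first component that
  is too long must be shortened, which concavity does not reward. This obstacle needs a global
  comparison, and there n must exceed a multiple of the squared path length.\<close>

lemma inside_image_subset:
  fixes f :: "'a::real_normed_vector \<Rightarrow> 'b::real_normed_vector"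
  assumes f: "bounded_linear f" and g: "bounded_linear g"
    and gf: "\<And>x. g (f x) = x" and fg: "\<And>y. f (g y) = y"
  shows "f ` inside S \<subseteq> inside (f ` S)"
proof
  fix z assume "z \<in> f ` inside S"
  then obtain x where x: "z = f x" "x \<notin> S" "bounded (connected_component_set (- S) x)"
    by (auto simp: inside_def)
  have "connected_component_set (- f ` S) (f x) \<subseteq> f ` connected_component_set (- S) x"
  proof
    fix y assume "y \<in> connected_component_set (- f ` S) (f x)"
    then obtain T where T: "connected T" "T \<subseteq> - f ` S" "f x \<in> T" "y \<in> T"
      by (auto simp: connected_component_def)
    have "connected (g ` T)"
      using T(1) g bounded_linear.continuous_on continuous_on_id
      by (intro connected_continuous_image) blast+
    moreover have "g ` T \<subseteq> - S"
    proof (clarify)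
      fix y assume "y \<in> T" "g y \<in> S"
      then have "f (g y) \<in> f ` S" by blast
      then show False using T(2) fg \<open>y \<in> T\<close> by auto
    qed
    moreover have "x \<in> g ` T" "g y \<in> g ` T" using T(3,4) gf by (metis imageI)+
    ultimately have "g y \<in> connected_component_set (- S) x"
      by (auto simp: connected_component_def)
    then show "y \<in> f ` connected_component_set (- S) x" by (metis fg imageI)
  qed
  then have "bounded (connected_component_set (- f ` S) (f x))"
    using x(3) bounded_linear_image[OF _ f] bounded_subset by blast
  moreover have "f x \<notin> f ` S" using x(2) gf by (metis imageE)
  ultimately show "z \<in> inside (f ` S)" using x(1) by (simp add: inside_def)
qed

text \<open>Janiszewski's theorem for the compact sets A \<union> B and B \<union> C, whose intersection B is connected.\<close>

lemma inside_theta_subset: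
  fixes A B C :: "complex set"
  assumes "compact A" "compact B" "compact C" "connected B" "A \<inter> C \<subseteq> B"
  shows "inside (A \<union> C) \<subseteq> inside (A \<union> B) \<union> inside (B \<union> C) \<union> B"
proof
  fix y assume y: "y \<in> inside (A \<union> C)"
  show "y \<in> inside (A \<union> B) \<union> inside (B \<union> C) \<union> B"
  proof (rule ccontr)
    assume n: "\<not> ?thesis"
    have yAC: "y \<notin> A" "y \<notin> C" using y by (auto simp: inside_def)
    have o: "y \<in> outside (A \<union> B)" "y \<in> outside (B \<union> C)"
      using n yAC by (auto simp: outside_inside)
    have bR: "bounded (A \<union> B \<union> C)" using assms by (simp add: compact_imp_bounded)
    \<comment> \<open>\<open>w\<close> plays the part of infinity: \<open>y\<close> can be joined to
      it off \<open>A \<union> B\<close> and off \<open>B \<union> C\<close>. Janiszewski's theorem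
      turns this into a connection off the whole union, so \<open>y\<close> would not be inside
      \<open>A \<union> C\<close>.\<close>
    then obtain w where w: "w \<in> outside (A \<union> B \<union> C)"
      using outside_bounded_nonempty by blast
    have "outside (A \<union> B \<union> C) \<subseteq> outside (A \<union> B)" "outside (A \<union> B \<union> C) \<subseteq> outside (B \<union> C)"
      "outside (A \<union> B \<union> C) \<subseteq> outside (A \<union> C)"
      by (rule outside_mono; blast)+
    then have w': "w \<in> outside (A \<union> B)" "w \<in> outside (B \<union> C)" "w \<in> outside (A \<union> C)"
      using w by auto
    have cc: "connected_component (- S) y w"
      if "bounded S" "y \<in> outside S" "w \<in> outside S" for S :: "complex set"
      unfolding connected_component_def
      using connected_outside[OF that(1)] that outside_no_overlap[of S]
      by (intro exI[of _ "outside S"]) (auto simp: outside_def)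
    have "(A \<union> B) \<inter> (B \<union> C) = B" using assms(5) by blast
    then have "connected_component (- ((A \<union> B) \<union> (B \<union> C))) y w"
      using Janiszewski[of "A \<union> B" "B \<union> C" y w] cc[OF _ o(1) w'(1)] cc[OF _ o(2) w'(2)] assms
      by (simp add: compact_Un compact_imp_closed compact_imp_bounded)
    then have "connected_component (- (A \<union> C)) y w"
      by (rule connected_component_of_subset) auto
    then have "w \<in> inside (A \<union> C)" using y by (rule inside_same_component)
    then show False using w'(3) inside_Int_outside by blast
  qed
qed

text \<open>Jordan curve theorem for \<open>c1 +++ reversepath c2\<close>, in a form that is
  symmetric in the two arcs.\<close>

lemma arcs_closed_curve:
  fixes c1 c2 :: "real \<Rightarrow> complex"
  assumes "arc c1" "arc c2" "pathstart c1 = a" "pathfinish c1 = b" "pathstart c2 = a" "pathfinish c2 = b"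
    "path_image c1 \<inter> path_image c2 = {a, b}"
  shows "open (inside (path_image c1 \<union> path_image c2))"
    and "connected (inside (path_image c1 \<union> path_image c2))"
    and "inside (path_image c1 \<union> path_image c2) \<noteq> {}"
    and "frontier (inside (path_image c1 \<union> path_image c2)) = path_image c1 \<union> path_image c2"
proof -
  have "simple_path (c1 +++ reversepath c2)"
    using assms by (intro simple_path_join_loop) (auto simp: arc_reversepath)
  then have "inside (path_image (c1 +++ reversepath c2)) \<noteq> {} \<and> open (inside (path_image (c1 +++ reversepath c2)))
     \<and> connected (inside (path_image (c1 +++ reversepath c2)))
     \<and> frontier (inside (path_image (c1 +++ reversepath c2))) = path_image (c1 +++ reversepath c2)"
    using Jordan_inside_outside[of "c1 +++ reversepath c2"] assms by simp
  moreover have "path_image (c1 +++ reversepath c2) = path_image c1 \<union> path_image c2"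
    using assms by (simp add: path_image_join)
  ultimately show "open (inside (path_image c1 \<union> path_image c2))"
    "connected (inside (path_image c1 \<union> path_image c2))"
    "inside (path_image c1 \<union> path_image c2) \<noteq> {}"
    "frontier (inside (path_image c1 \<union> path_image c2)) = path_image c1 \<union> path_image c2" by auto
qed

lemma connected_subset_inside:
  fixes S :: "'a::real_normed_vector set"
  assumes "connected T" "T \<inter> S = {}" "T \<inter> inside S \<noteq> {}"
  shows "T \<subseteq> inside S"
proof
  fix t assume t: "t \<in> T"
  obtain s where s: "s \<in> T" "s \<in> inside S" using assms by blast
  have "connected_component (- S) s t" unfolding connected_component_def
    using assms t s by (intro exI[of _ T]) auto
  then show "t \<in> inside S" using s(2) inside_same_component by blast
qed

text \<open>If no arc met the inside of the other two, \<open>inside_theta_subset\<close> would make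
  the inside of the first and third arc meet one of the other two insides. Connected insides that
  meet and avoid each other's boundary are equal, hence so are their frontiers, which are the closed
  curves themselves; but these curves differ.\<close>

lemma theta_arc_inside:
  fixes c1 c2 c3 :: "real \<Rightarrow> complex"
  assumes arc: "arc c1" "arc c2" "arc c3"
    and ends: "pathstart c1 = a" "pathfinish c1 = b" "pathstart c2 = a" "pathfinish c2 = b"
      "pathstart c3 = a" "pathfinish c3 = b"
    and i: "path_image c1 \<inter> path_image c2 = {a, b}" "path_image c1 \<inter> path_image c3 = {a, b}"
      "path_image c2 \<inter> path_image c3 = {a, b}"
  shows "path_image c1 - {a, b} \<subseteq> inside (path_image c2 \<union> path_image c3) \<or>
         path_image c2 - {a, b} \<subseteq> inside (path_image c1 \<union> path_image c3) \<or>
         path_image c3 - {a, b} \<subseteq> inside (path_image c1 \<union> path_image c2)"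
proof -
  let ?A = "path_image c1" and ?B = "path_image c2" and ?C = "path_image c3"
  have endless: "connected (path_image c - {a, b})" if "arc c" "pathstart c = a" "pathfinish c = b" for c :: "real \<Rightarrow> complex"
    using connected_simple_path_endless[of c] that arc_imp_simple_path by force
  have ab: "a \<noteq> b" using arc(1) ends arc_distinct_ends by force
  have pathne: "path_image c - {a, b} \<noteq> {}" if "arc c" "pathstart c = a" "pathfinish c = b" for c :: "real \<Rightarrow> complex"
    using that nonempty_simple_path_endless[of c] arc_imp_simple_path by force
  have key: "?A \<inter> inside (?B \<union> ?C) \<noteq> {} \<or> ?B \<inter> inside (?A \<union> ?C) \<noteq> {} \<or> ?C \<inter> inside (?A \<union> ?B) \<noteq> {}"
  proof (rule ccontr)
    assume "\<not> ?thesis"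
    then have n: "?A \<inter> inside (?B \<union> ?C) = {}" "?B \<inter> inside (?A \<union> ?C) = {}" "?C \<inter> inside (?A \<union> ?B) = {}" by auto
    have sub: "inside (?A \<union> ?C) \<subseteq> inside (?A \<union> ?B) \<union> inside (?B \<union> ?C) \<union> ?B"
      using arc i ends by (intro inside_theta_subset)
        (auto simp: compact_arc_image connected_arc_image)
    note j13 = arcs_closed_curve[OF arc(1,3) ends(1,2,5,6) i(2)]
    note j12 = arcs_closed_curve[OF arc(1,2) ends(1,2,3,4) i(1)]
    note j23 = arcs_closed_curve[OF arc(2,3) ends(3,4,5,6) i(3)]
    have no: "inside S \<inter> S = {}" for S :: "complex set" by (auto simp: inside_def)
    consider "inside (?A \<union> ?C) \<inter> inside (?A \<union> ?B) \<noteq> {}" | "inside (?A \<union> ?C) \<inter> inside (?B \<union> ?C) \<noteq> {}"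
      using sub n(2) j13(3) by blast
    then show False
    proof cases
      case 1
      have "inside (?A \<union> ?C) \<subseteq> inside (?A \<union> ?B)"
        by (rule connected_subset_inside[OF j13(2)]) (use 1 n(2) no[of "?A \<union> ?C"] in blast)+
      moreover have "inside (?A \<union> ?B) \<subseteq> inside (?A \<union> ?C)"
        by (rule connected_subset_inside[OF j12(2)]) (use 1 n(3) no[of "?A \<union> ?B"] in blast)+
      ultimately have "inside (?A \<union> ?C) = inside (?A \<union> ?B)" by (rule antisym)
      then have "?A \<union> ?C = ?A \<union> ?B" using j13(4) j12(4) by metis
      then show False using i pathne[OF arc(3) ends(5,6)] by blast
    next
      case 2
      have "inside (?A \<union> ?C) \<subseteq> inside (?B \<union> ?C)"
        by (rule connected_subset_inside[OF j13(2)]) (use 2 n(2) no[of "?A \<union> ?C"] in blast)+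
      moreover have "inside (?B \<union> ?C) \<subseteq> inside (?A \<union> ?C)"
        by (rule connected_subset_inside[OF j23(2)]) (use 2 n(1) no[of "?B \<union> ?C"] in blast)+
      ultimately have "inside (?A \<union> ?C) = inside (?B \<union> ?C)" by (rule antisym)
      then have "?A \<union> ?C = ?B \<union> ?C" using j13(4) j23(4) by metis
      then show False using i pathne[OF arc(2) ends(3,4)] by blast
    qed
  qed
  have fin: "X - {a, b} \<subseteq> inside (Y \<union> Z)"
    if "X \<inter> inside (Y \<union> Z) \<noteq> {}" "connected (X - {a, b})" "X \<inter> Y = {a, b}" "X \<inter> Z = {a, b}" for X Y Z :: "complex set"
  proof (rule connected_subset_inside)
    show "(X - {a, b}) \<inter> inside (Y \<union> Z) \<noteq> {}"
      using that(1,3,4) by (auto simp: inside_def)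
    show "(X - {a, b}) \<inter> (Y \<union> Z) = {}" using that(3,4) by blast
  qed (fact that(2))
  from key consider "?A \<inter> inside (?B \<union> ?C) \<noteq> {}" | "?B \<inter> inside (?A \<union> ?C) \<noteq> {}" | "?C \<inter> inside (?A \<union> ?B) \<noteq> {}"
    by blast
  then show ?thesis
  proof cases
    case 1
    then show ?thesis using fin[OF 1 endless[OF arc(1) ends(1,2)] i(1,2)] by simp
  next
    case 2
    have "?B \<inter> ?A = {a, b}" using i(1) by blast
    then show ?thesis using fin[OF 2 endless[OF arc(2) ends(3,4)] _ i(3)] by simp
  next
    case 3
    have "?C \<inter> ?A = {a, b}" "?C \<inter> ?B = {a, b}" using i by blast+
    then show ?thesis using fin[OF 3 endless[OF arc(3) ends(5,6)]] by simp
  qed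
qed

section \<open>Necessary conditions for outerplanarity\<close>

fun path_edges :: "'a list \<Rightarrow> 'a set set" where
  "path_edges (x # y # xs) = insert {x, y} (path_edges (y # xs))"
| "path_edges _ = {}"

lemma Union_path_edges: "length p \<ge> 2 \<Longrightarrow> \<Union> (path_edges p) = set p"
proof (induction p rule: path_edges.induct)
  case (1 x y xs)
  then show ?case by (cases xs) auto
qed auto

lemma path_edges_meets_interior:
  "p \<noteq> [] \<Longrightarrow> e \<in> path_edges (a # p @ [b]) \<Longrightarrow> e \<inter> set p \<noteq> {}"
proof (induction p arbitrary: a)
  case (Cons x p)
  then show ?case by (cases p) auto
qed simp

text \<open>The drawing after transfer to the complex plane. The outer face condition takes the form
  \<open>outer\<close> for arbitrary sets of edges, so that it applies directly to the cycle formed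
  by two paths.\<close>

locale outer_drawing =
  fixes n :: nat and G :: "nat \<Rightarrow> nat \<Rightarrow> bool" and pos :: "nat \<Rightarrow> complex" and \<gamma> :: "nat set \<Rightarrow> real \<Rightarrow> complex"
  assumes graph: "graph_on n G"
    and inj_pos: "inj_on pos {..<n}"
    and arc_edge: "G u v \<Longrightarrow> arc (\<gamma> {u, v})"
    and edge_ends: "G u v \<Longrightarrow> (pathstart (\<gamma> {u, v}) = pos u \<and> pathfinish (\<gamma> {u, v}) = pos v) \<or>
             (pathstart (\<gamma> {u, v}) = pos v \<and> pathfinish (\<gamma> {u, v}) = pos u)"
    and edge_edge: "e \<in> edges_of n G \<Longrightarrow> f \<in> edges_of n G \<Longrightarrow> e \<noteq> f \<Longrightarrow>
       path_image (\<gamma> e) \<inter> path_image (\<gamma> f) \<subseteq> pos ` (e \<inter> f)"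
    and edge_vertex: "e \<in> edges_of n G \<Longrightarrow> path_image (\<gamma> e) \<inter> pos ` {..<n} \<subseteq> pos ` e"
    and outer: "v < n \<Longrightarrow> E \<subseteq> edges_of n G \<Longrightarrow> pos v \<notin> inside (\<Union>e\<in>E. path_image (\<gamma> e))"
begin

definition img :: "nat set set \<Rightarrow> complex set" where
  "img E = (\<Union>e\<in>E. path_image (\<gamma> e))"

lemma img_Un: "img E \<union> img F = img (E \<union> F)" by (auto simp: img_def)

lemma edge_bounds: "G u v \<Longrightarrow> u < n \<and> v < n \<and> u \<noteq> v \<and> G v u"
  using graph by (auto simp: graph_on_def)

lemma edge_in_edges: "G u v \<Longrightarrow> {u, v} \<in> edges_of n G"
  using edge_bounds by (auto simp: edges_of_def)

lemma path_edges_in: "successively G p \<Longrightarrow> path_edges p \<subseteq> edges_of n G"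
  by (induction p rule: path_edges.induct) (auto simp: edge_in_edges)

lemma edges_bounded: "e \<in> edges_of n G \<Longrightarrow> e \<subseteq> {..<n}"
  by (auto simp: edges_of_def)

lemma img_Int:
  assumes "E \<subseteq> edges_of n G" "F \<subseteq> edges_of n G" "E \<inter> F = {}"
  shows "img E \<inter> img F \<subseteq> pos ` (\<Union>E \<inter> \<Union>F)"
proof
  fix z assume "z \<in> img E \<inter> img F"
  then obtain e f where ef: "e \<in> E" "f \<in> F" "z \<in> path_image (\<gamma> e)" "z \<in> path_image (\<gamma> f)"
    by (auto simp: img_def)
  then have "z \<in> pos ` (e \<inter> f)" using edge_edge[of e f] assms by blast
  then show "z \<in> pos ` (\<Union>E \<inter> \<Union>F)" using ef by blast
qed

lemma pos_in_img:
  assumes "v < n" "E \<subseteq> edges_of n G"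
  shows "pos v \<in> img E \<longleftrightarrow> v \<in> \<Union>E"
proof
  assume "pos v \<in> img E"
  then obtain e where e: "e \<in> E" "pos v \<in> path_image (\<gamma> e)" by (auto simp: img_def)
  then have "pos v \<in> pos ` e" using edge_vertex[of e] assms by blast
  then have "v \<in> e"
    using edges_bounded[of e] e(1) assms inj_pos by (auto simp: inj_on_def)
  then show "v \<in> \<Union>E" using e by blast
next
  assume "v \<in> \<Union>E"
  then obtain e where e: "e \<in> E" "v \<in> e" by blast
  then have "e \<in> edges_of n G" using assms by blast
  then obtain u w where uw: "e = {u, w}" "G u w" by (auto simp: edges_of_def)
  have "pos v \<in> path_image (\<gamma> e)"
    using edge_ends[OF uw(2)] e(2) uw(1) pathstart_in_path_image[of "\<gamma> e"] pathfinish_in_path_image[of "\<gamma> e"]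
    by auto
  then show "pos v \<in> img E" using e(1) by (auto simp: img_def)
qed

lemma oriented_edge:
  assumes "G u v"
  obtains c where "arc c" "pathstart c = pos u" "pathfinish c = pos v" "path_image c = path_image (\<gamma> {u, v})"
  using edge_ends[OF assms] arc_edge[OF assms]
  by (metis arc_reversepath path_image_reversepath pathfinish_reversepath pathstart_reversepath)

lemma path_arc:
  assumes "successively G p" "distinct p" "length p \<ge> 2"
  obtains c where "arc c" "pathstart c = pos (hd p)" "pathfinish c = pos (last p)" "path_image c = img (path_edges p)"
  using assms
proof (induction p arbitrary: thesis rule: path_edges.induct)
  case (1 x y xs)
  have G: "G x y" using 1 by simp
  obtain c1 where c1: "arc c1" "pathstart c1 = pos x" "pathfinish c1 = pos y" "path_image c1 = path_image (\<gamma> {x, y})"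
    using oriented_edge[OF G] by blast
  show ?case
  proof (cases xs)
    case Nil
    then show ?thesis using c1 1(2) by (auto simp: img_def)
  next
    case (Cons z zs)
    obtain c2 where c2: "arc c2" "pathstart c2 = pos y" "pathfinish c2 = pos (last (y # xs))"
        "path_image c2 = img (path_edges (y # xs))"
      using 1(1) 1(3-) Cons by auto
    have e: "{{x, y}} \<subseteq> edges_of n G" "path_edges (y # xs) \<subseteq> edges_of n G"
      using edge_in_edges[OF G] path_edges_in[of "y # xs"] 1(3) by auto
    have U: "\<Union> (path_edges (y # xs)) = set (y # xs)"
      by (rule Union_path_edges) (simp add: Cons)
    have "{x, y} \<notin> path_edges (y # xs)" using U 1(4) by auto
    then have "img {{x, y}} \<inter> img (path_edges (y # xs)) \<subseteq> pos ` (\<Union>{{x, y}} \<inter> \<Union>(path_edges (y # xs)))"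
      using img_Int[OF e] by blast
    then have i: "path_image c1 \<inter> path_image c2 \<subseteq> {pos y}"
      using c1 c2 U 1(4) by (auto simp: img_def)
    have "arc (c1 +++ c2)" using c1 c2 i by (intro arc_join) auto
    moreover have "path_image (c1 +++ c2) = img (path_edges (x # y # xs))"
      using c1 c2 by (simp add: path_image_join) (simp add: img_def)
    ultimately show ?thesis using 1(2)[of "c1 +++ c2"] c1 c2 by simp
  qed
qed auto

text \<open>By \<open>theta_arc_inside\<close> one of the three open arcs lies inside the closed
  curve of the other two. An inner vertex on it would contradict \<open>outer\<close>; so it is the
  third path, and that path is a single edge. The second conclusion records the position of this
  edge for \<open>no_K4\<close>.\<close>

lemma theta:
  assumes ab: "a \<noteq> b"
    and d: "distinct (p1 @ p2 @ p3)" "{a, b} \<inter> set (p1 @ p2 @ p3) = {}"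
    and G: "successively G (a # p1 @ [b])" "successively G (a # p2 @ [b])" "successively G (a # p3 @ [b])"
    and ne: "p1 \<noteq> []" "p2 \<noteq> []"
  shows "p3 = []"
    and "img (path_edges (a # p3 @ [b])) - {pos a, pos b} \<subseteq>
      inside (img (path_edges (a # p1 @ [b])) \<union> img (path_edges (a # p2 @ [b])))"
proof -
  let ?E = "\<lambda>p. path_edges (a # p @ [b])"
  have U: "\<Union> (?E p) = {a, b} \<union> set p" for p
    by (subst Union_path_edges) auto
  obtain c1 where c1: "arc c1" "pathstart c1 = pos a" "pathfinish c1 = pos b" "path_image c1 = img (?E p1)"
    using path_arc[OF G(1)] ab d by auto
  obtain c2 where c2: "arc c2" "pathstart c2 = pos a" "pathfinish c2 = pos b" "path_image c2 = img (?E p2)"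
    using path_arc[OF G(2)] ab d by auto
  obtain c3 where c3: "arc c3" "pathstart c3 = pos a" "pathfinish c3 = pos b" "path_image c3 = img (?E p3)"
    using path_arc[OF G(3)] ab d by auto
  note e = path_edges_in[OF G(1)] path_edges_in[OF G(2)] path_edges_in[OF G(3)]
  have disj: "?E p \<inter> ?E q = {}" if "p \<noteq> []" "set p \<inter> set q = {}" "{a, b} \<inter> set p = {}" for p q
    using path_edges_meets_interior[OF that(1)] U[of q] that(2,3) by fastforce
  have E12: "?E p1 \<inter> ?E p2 = {}" using disj[OF ne(1)] d by auto
  have E13: "?E p1 \<inter> ?E p3 = {}" using disj[OF ne(1)] d by auto
  have E23: "?E p2 \<inter> ?E p3 = {}" using disj[OF ne(2)] d by auto
  have ends: "{pos a, pos b} \<subseteq> path_image c" if "pathstart c = pos a" "pathfinish c = pos b" for c :: "real \<Rightarrow> complex"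
    using that pathstart_in_path_image[of c] pathfinish_in_path_image[of c] by auto
  have P12: "path_image c1 \<inter> path_image c2 = {pos a, pos b}"
  proof
    show "path_image c1 \<inter> path_image c2 \<subseteq> {pos a, pos b}"
      using img_Int[OF e(1,2) E12] c1(4) c2(4) U[of p1] U[of p2] d by auto
  qed (use ends[OF c1(2,3)] ends[OF c2(2,3)] in blast)
  have P13: "path_image c1 \<inter> path_image c3 = {pos a, pos b}"
  proof
    show "path_image c1 \<inter> path_image c3 \<subseteq> {pos a, pos b}"
      using img_Int[OF e(1,3) E13] c1(4) c3(4) U[of p1] U[of p3] d by auto
  qed (use ends[OF c1(2,3)] ends[OF c3(2,3)] in blast)
  have P23: "path_image c2 \<inter> path_image c3 = {pos a, pos b}"
  proof
    show "path_image c2 \<inter> path_image c3 \<subseteq> {pos a, pos b}"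
      using img_Int[OF e(2,3) E23] c2(4) c3(4) U[of p2] U[of p3] d by auto
  qed (use ends[OF c2(2,3)] ends[OF c3(2,3)] in blast)
  have abn: "a < n" "b < n" using U[of p1] e(1) edges_bounded by (blast, blast)
  have no: "\<not> img (?E p) - {pos a, pos b} \<subseteq> inside (img (?E q) \<union> img (?E r))"
    if p: "p \<noteq> []" "?E p \<subseteq> edges_of n G" "?E q \<subseteq> edges_of n G" "?E r \<subseteq> edges_of n G" "{a, b} \<inter> set p = {}" for p q r
  proof
    assume sub: "img (?E p) - {pos a, pos b} \<subseteq> inside (img (?E q) \<union> img (?E r))"
    obtain v where v: "v \<in> set p" using p(1) by (cases p) auto
    have vn: "v < n" using U[of p] p(2) v edges_bounded by blast
    have "pos v \<in> img (?E p)" using pos_in_img[OF vn p(2)] U[of p] v by simp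
    moreover have "pos v \<noteq> pos a" "pos v \<noteq> pos b"
      using inj_pos vn abn v p(5) by (auto simp: inj_on_def)
    ultimately have "pos v \<in> inside (img (?E q \<union> ?E r))" using sub by (auto simp: img_Un)
    then show False using outer[OF vn, of "?E q \<union> ?E r"] p(3,4) by (auto simp: img_def)
  qed
  have n1: "\<not> path_image c1 - {pos a, pos b} \<subseteq> inside (path_image c2 \<union> path_image c3)"
    unfolding c1(4) c2(4) c3(4) using d ne by (intro no e) auto
  have n2: "\<not> path_image c2 - {pos a, pos b} \<subseteq> inside (path_image c1 \<union> path_image c3)"
    unfolding c1(4) c2(4) c3(4) using d ne by (intro no e) auto
  have r: "path_image c3 - {pos a, pos b} \<subseteq> inside (path_image c1 \<union> path_image c2)"
    using theta_arc_inside[OF c1(1) c2(1) c3(1) c1(2,3) c2(2,3) c3(2,3) P12 P13 P23] n1 n2 by blast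
  then show "img (?E p3) - {pos a, pos b} \<subseteq> inside (img (?E p1) \<union> img (?E p2))"
    using c1(4) c2(4) c3(4) by simp
  show "p3 = []"
  proof (rule ccontr)
    assume "p3 \<noteq> []"
    then have "\<not> path_image c3 - {pos a, pos b} \<subseteq> inside (path_image c1 \<union> path_image c2)"
      unfolding c1(4) c2(4) c3(4) using d by (intro no e) auto
    then show False using r by simp
  qed
qed

text \<open>By \<open>theta\<close> the edge \<open>cd\<close> runs inside the 4-cycle
  \<open>acbd\<close>. By \<open>inside_theta_subset\<close> the edge \<open>ab\<close> splits this
  region into the insides of the triangles \<open>abc\<close> and \<open>abd\<close>. The open arc
  \<open>cd\<close> avoids all edges involved, so it stays in one triangle, and its end at the
  vertex missing from that triangle contradicts \<open>outer\<close>.\<close>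

lemma no_K4:
  assumes d: "distinct [a, b, c, d]"
    and G: "G a b" "G a c" "G a d" "G b c" "G b d" "G c d"
  shows False
proof -
  have G': "G b a" "G c a" "G d a" "G c b" "G d b" "G d c" using G edge_bounds by auto
  have bd: "a < n" "b < n" "c < n" "d < n" using G edge_bounds by auto
  let ?A = "img {{a, c}, {c, b}}" and ?C = "img {{a, d}, {d, b}}" and ?B = "img {{a, b}}"
  have e: "{{a, c}, {c, b}} \<subseteq> edges_of n G" "{{a, d}, {d, b}} \<subseteq> edges_of n G" "{{a, b}} \<subseteq> edges_of n G"
    "{{c, d}} \<subseteq> edges_of n G"
    using G G' edge_in_edges by auto
  have cd: "img {{c, d}} - {pos c, pos d} \<subseteq> inside (?A \<union> ?C)"
  proof -
    have "img {{c, d}} - {pos c, pos d} \<subseteq> inside (img {{c, a}, {a, d}} \<union> img {{c, b}, {b, d}})"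
      using theta(2)[of c d "[a]" "[b]" "[]"] d G G' by simp
    also have "img {{c, a}, {a, d}} \<union> img {{c, b}, {b, d}} = ?A \<union> ?C"
      by (auto simp: img_def insert_commute)
    finally show ?thesis .
  qed
  obtain g where g: "arc g" "pathstart g = pos c" "pathfinish g = pos d" "path_image g = img {{c, d}}"
    using oriented_edge[OF G(6)] by (auto simp: img_def)
  have comp: "compact (img E)" if "finite E" "E \<subseteq> edges_of n G" for E
  proof -
    have "compact (path_image (\<gamma> e))" if "e \<in> edges_of n G" for e
      using that arc_edge by (auto simp: edges_of_def intro!: compact_arc_image)
    then show ?thesis unfolding img_def using that by (intro compact_UN) auto
  qed
  have "connected ?B" using arc_edge[OF G(1)] by (auto simp: img_def connected_arc_image)
  moreover have "?A \<inter> ?C \<subseteq> ?B"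
  proof -
    have "?A \<inter> ?C \<subseteq> pos ` {a, b}"
      using img_Int[OF e(1,2)] d by (auto simp: doubleton_eq_iff)
    also have "\<dots> \<subseteq> ?B" using pos_in_img[OF bd(1) e(3)] pos_in_img[OF bd(2) e(3)] by auto
    finally show ?thesis .
  qed
  ultimately have sub: "inside (?A \<union> ?C) \<subseteq> inside (?A \<union> ?B) \<union> inside (?B \<union> ?C) \<union> ?B"
    using e comp by (intro inside_theta_subset) auto
  let ?T = "path_image g - {pos c, pos d}"
  have T: "connected ?T" "?T \<noteq> {}"
    using connected_simple_path_endless[of g] nonempty_simple_path_endless[of g] g arc_imp_simple_path by force+
  have cdB: "?T \<inter> ?B = {}"
  proof -
    have "img {{c, d}} \<inter> ?B \<subseteq> pos ` (\<Union>{{c, d}} \<inter> \<Union>{{a, b}})"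
      using d by (intro img_Int e) (auto simp: doubleton_eq_iff)
    also have "\<dots> = {}" using d by auto
    finally show ?thesis using g by auto
  qed
  have cdA: "?T \<inter> ?A = {}"
  proof -
    have "img {{c, d}} \<inter> ?A \<subseteq> pos ` (\<Union>{{c, d}} \<inter> \<Union>{{a, c}, {c, b}})"
      using d by (intro img_Int e) (auto simp: doubleton_eq_iff)
    also have "\<dots> \<subseteq> {pos c}" using d by auto
    finally show ?thesis using g by auto
  qed
  have cdC: "?T \<inter> ?C = {}"
  proof -
    have "img {{c, d}} \<inter> ?C \<subseteq> pos ` (\<Union>{{c, d}} \<inter> \<Union>{{a, d}, {d, b}})"
      using d by (intro img_Int e) (auto simp: doubleton_eq_iff)
    also have "\<dots> \<subseteq> {pos d}" using d by auto
    finally show ?thesis using g by auto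
  qed
  \<comment> \<open>The open arc from \<open>c\<close> to \<open>d\<close> lies in the closed set
    \<open>img E \<union> inside (img E)\<close>, hence so does its end \<open>w\<close>;
    \<open>outer\<close> keeps \<open>w\<close> off the inside and \<open>pos_in_img\<close> keeps
    it off the edges.\<close>
  have main: False
    if w: "w \<in> {c, d}" and E: "E \<subseteq> edges_of n G" "finite E" "w \<notin> \<Union>E" "?T \<inter> img E = {}" "?T \<inter> inside (img E) \<noteq> {}" for w E
  proof -
    have "?T \<subseteq> inside (img E)" using connected_subset_inside[OF T(1)] E by blast
    moreover have "?T = g ` {0<..<1}"
      using simple_path_endless[OF arc_imp_simple_path[OF g(1)]] g by simp
    moreover have cl: "closed (img E \<union> inside (img E))"
      using comp[OF E(2,1)] by (simp add: union_with_inside open_outside compact_imp_closed closed_Compl)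
    ultimately have "g ` closure {0<..<1} \<subseteq> img E \<union> inside (img E)"
      using g by (intro image_closure_subset) (auto simp: arc_def path_def)
    then have "path_image g \<subseteq> img E \<union> inside (img E)" by (simp add: path_image_def)
    moreover have "pos w \<in> path_image g" using w g pathstart_in_path_image[of g] pathfinish_in_path_image[of g] by auto
    moreover have "w < n" using w bd by auto
    ultimately show False using outer[of w E] pos_in_img[of w E] E by (auto simp: img_def)
  qed
  obtain z where z: "z \<in> ?T" using T by blast
  then have "z \<in> inside (?A \<union> ?B) \<union> inside (?B \<union> ?C)" using sub cd g cdB by blast
  then show False
  proof
    assume zi: "z \<in> inside (?A \<union> ?B)"
    have eq: "img ({{a, c}, {c, b}} \<union> {{a, b}}) = ?A \<union> ?B" by (rule img_Un[symmetric])
    show False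
    proof (rule main[of d "{{a, c}, {c, b}} \<union> {{a, b}}"])
      show "?T \<inter> img ({{a, c}, {c, b}} \<union> {{a, b}}) = {}" unfolding eq using cdA cdB by blast
      show "?T \<inter> inside (img ({{a, c}, {c, b}} \<union> {{a, b}})) \<noteq> {}" unfolding eq using z zi by blast
    qed (use e d in auto)
  next
    assume zi: "z \<in> inside (?B \<union> ?C)"
    have eq: "img ({{a, b}} \<union> {{a, d}, {d, b}}) = ?B \<union> ?C" by (rule img_Un[symmetric])
    show False
    proof (rule main[of c "{{a, b}} \<union> {{a, d}, {d, b}}"])
      show "?T \<inter> img ({{a, b}} \<union> {{a, d}, {d, b}}) = {}" unfolding eq using cdB cdC by blast
      show "?T \<inter> inside (img ({{a, b}} \<union> {{a, d}, {d, b}})) \<noteq> {}" unfolding eq using z zi by blast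
    qed (use e d in auto)
  qed
qed

end

lemma outerplanar_outer_drawing:
  assumes "graph_on n G" "outerplanar n G"
  obtains pos \<gamma> where "outer_drawing n G pos \<gamma>"
proof -
  obtain pos :: "nat \<Rightarrow> real^2" and \<gamma> :: "nat set \<Rightarrow> real \<Rightarrow> real^2" where
    drawing: "inj_on pos {..<n} \<and>
        (\<forall>u<n. \<forall>v<n. G u v \<longrightarrow> arc (\<gamma> {u, v}) \<and>
            ((pathstart (\<gamma> {u, v}) = pos u \<and> pathfinish (\<gamma> {u, v}) = pos v) \<or>
             (pathstart (\<gamma> {u, v}) = pos v \<and> pathfinish (\<gamma> {u, v}) = pos u))) \<and>
        (\<forall>e\<in>edges_of n G. \<forall>f\<in>edges_of n G. e \<noteq> f \<longrightarrow>
            path_image (\<gamma> e) \<inter> path_image (\<gamma> f) \<subseteq> pos ` (e \<inter> f)) \<and>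
        (\<forall>e\<in>edges_of n G. path_image (\<gamma> e) \<inter> pos ` {..<n} \<subseteq> pos ` e) \<and>
        (\<forall>v<n. pos v \<in> frontier (outside (pos ` {..<n} \<union> (\<Union>e\<in>edges_of n G. path_image (\<gamma> e)))))"
    using assms(2) unfolding outerplanar_def by (elim exE) (rule that)
  note p1 = drawing[THEN conjunct1] and p23 = drawing[THEN conjunct2, THEN conjunct1, rule_format]
    and p4 = drawing[THEN conjunct2, THEN conjunct2, THEN conjunct1, rule_format]
    and p5 = drawing[THEN conjunct2, THEN conjunct2, THEN conjunct2, THEN conjunct1, rule_format]
    and p6 = drawing[THEN conjunct2, THEN conjunct2, THEN conjunct2, THEN conjunct2, rule_format]
  note p2 = p23[THEN conjunct1] and p3 = p23[THEN conjunct2]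
  define \<phi> where "\<phi> = (\<lambda>v :: real^2. Complex (v $ 1) (v $ 2))"
  define \<psi> where "\<psi> = (\<lambda>z :: complex. (vector [Re z, Im z] :: real^2))"
  have \<psi>\<phi>: "\<psi> (\<phi> v) = v" for v by (simp add: \<phi>_def \<psi>_def vec_eq_iff forall_2)
  have \<phi>\<psi>: "\<phi> (\<psi> z) = z" for z by (simp add: \<phi>_def \<psi>_def complex_eq_iff)
  have lin\<phi>: "linear \<phi>" by (rule linearI) (simp_all add: \<phi>_def complex_eq_iff)
  have lin\<psi>: "linear \<psi>" by (rule linearI) (simp_all add: \<psi>_def vec_eq_iff forall_2)
  have bl: "bounded_linear \<phi>" "bounded_linear \<psi>" using lin\<phi> lin\<psi> linear_conv_bounded_linear by blast+
  have inj: "inj \<phi>" by (metis \<psi>\<phi> injI)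
  have edge: "arc (\<gamma> e)" if "e \<in> edges_of n G" for e
    using that p2 by (auto simp: edges_of_def)
  have fin: "finite (edges_of n G)"
    by (rule finite_subset[of _ "Pow {..<n}"]) (auto simp: edges_of_def)
  have "outer_drawing n G (\<phi> \<circ> pos) (\<lambda>e. \<phi> \<circ> \<gamma> e)"
  proof
    show "graph_on n G" by fact
    show "inj_on (\<phi> \<circ> pos) {..<n}" using p1 inj by (simp add: comp_inj_on inj_on_subset)
    fix u v assume "G u v"
    then have uv: "u < n" "v < n" "G u v" using assms(1) by (auto simp: graph_on_def)
    show "arc (\<phi> \<circ> \<gamma> {u, v})" using p2[OF uv] arc_linear_image_eq[OF lin\<phi> inj] by simp
    show "pathstart (\<phi> \<circ> \<gamma> {u, v}) = (\<phi> \<circ> pos) u \<and> pathfinish (\<phi> \<circ> \<gamma> {u, v}) = (\<phi> \<circ> pos) v \<or>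
          pathstart (\<phi> \<circ> \<gamma> {u, v}) = (\<phi> \<circ> pos) v \<and> pathfinish (\<phi> \<circ> \<gamma> {u, v}) = (\<phi> \<circ> pos) u"
      using p3[OF uv] by (auto simp: pathstart_compose pathfinish_compose)
  next
    fix e f assume "e \<in> edges_of n G" "f \<in> edges_of n G" "e \<noteq> f"
    then have "path_image (\<gamma> e) \<inter> path_image (\<gamma> f) \<subseteq> pos ` (e \<inter> f)" by (rule p4)
    then have "\<phi> ` (path_image (\<gamma> e) \<inter> path_image (\<gamma> f)) \<subseteq> \<phi> ` pos ` (e \<inter> f)" by (rule image_mono)
    then show "path_image (\<phi> \<circ> \<gamma> e) \<inter> path_image (\<phi> \<circ> \<gamma> f) \<subseteq> (\<phi> \<circ> pos) ` (e \<inter> f)"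
      by (simp only: path_image_compose image_comp[symmetric] image_Int[OF inj])
  next
    fix e assume "e \<in> edges_of n G"
    then have "path_image (\<gamma> e) \<inter> pos ` {..<n} \<subseteq> pos ` e" by (rule p5)
    then have "\<phi> ` (path_image (\<gamma> e) \<inter> pos ` {..<n}) \<subseteq> \<phi> ` pos ` e" by (rule image_mono)
    then show "path_image (\<phi> \<circ> \<gamma> e) \<inter> (\<phi> \<circ> pos) ` {..<n} \<subseteq> (\<phi> \<circ> pos) ` e"
      by (simp only: path_image_compose image_comp[symmetric] image_Int[OF inj])
  next
    fix v E assume v: "v < n" and E: "E \<subseteq> edges_of n G"
    let ?S = "\<Union>e\<in>E. path_image (\<gamma> e)"
    have "compact ?S" using E fin edge by (intro compact_UN) (auto simp: finite_subset compact_arc_image)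
    then have cl: "closed ?S" by (rule compact_imp_closed)
    \<comment> \<open>Fewer edges have a larger outside, so \<open>pos v\<close> is a limit of
      points outside the closed set \<open>?S\<close>; such a limit lies on \<open>?S\<close> or
      outside it, never inside.\<close>
    have "outside (pos ` {..<n} \<union> (\<Union>e\<in>edges_of n G. path_image (\<gamma> e))) \<subseteq> outside ?S"
      using E by (intro outside_mono) blast
    then have "closure (outside (pos ` {..<n} \<union> (\<Union>e\<in>edges_of n G. path_image (\<gamma> e)))) \<subseteq> closure (outside ?S)"
      by (rule closure_mono)
    also have "\<dots> \<subseteq> ?S \<union> outside ?S" using closure_outside_subset[OF cl] .
    finally have "pos v \<in> ?S \<union> outside ?S" using p6[OF v] by (auto simp: frontier_def)
    then have 1: "pos v \<notin> inside ?S" by (auto simp: inside_outside)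
    have im: "\<phi> ` ?S = (\<Union>e\<in>E. path_image (\<phi> \<circ> \<gamma> e))"
      by (simp add: image_UN path_image_compose)
    have im2: "\<psi> ` \<phi> ` ?S = ?S" by (simp add: image_image \<psi>\<phi>)
    show "(\<phi> \<circ> pos) v \<notin> inside (\<Union>e\<in>E. path_image (\<phi> \<circ> \<gamma> e))"
    proof
      assume "(\<phi> \<circ> pos) v \<in> inside (\<Union>e\<in>E. path_image (\<phi> \<circ> \<gamma> e))"
      then have "\<psi> ((\<phi> \<circ> pos) v) \<in> \<psi> ` inside (\<phi> ` ?S)" unfolding im by blast
      also have "\<dots> \<subseteq> inside (\<psi> ` \<phi> ` ?S)"
        using bl \<psi>\<phi> \<phi>\<psi> by (intro inside_image_subset[where g = \<phi>]) auto
      finally show False using 1 im2 by (simp add: \<psi>\<phi>)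
    qed
  qed
  then show thesis by (rule that)
qed

text \<open>No subdivision of K_{2,3}; besides the absence of K_4 this is all that is used of outerplanarity.\<close>

definition theta_free :: "(nat \<Rightarrow> nat \<Rightarrow> bool) \<Rightarrow> bool" where
  "theta_free G \<longleftrightarrow> (\<forall>a b p1 p2 p3. a \<noteq> b \<longrightarrow> distinct (p1 @ p2 @ p3) \<longrightarrow> {a, b} \<inter> set (p1 @ p2 @ p3) = {} \<longrightarrow>
     successively G (a # p1 @ [b]) \<longrightarrow> successively G (a # p2 @ [b]) \<longrightarrow> successively G (a # p3 @ [b]) \<longrightarrow>
     p1 = [] \<or> p2 = [] \<or> p3 = [])"

lemma outerplanar_theta_free:
  assumes "graph_on n G" "outerplanar n G"
  shows "theta_free G"
proof -
  obtain pos \<gamma> where "outer_drawing n G pos \<gamma>" using outerplanar_outer_drawing[OF assms] .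
  then interpret outer_drawing n G pos \<gamma> .
  show ?thesis unfolding theta_free_def using theta(1) by blast
qed

lemma outerplanar_no_K4:
  assumes "graph_on n G" "outerplanar n G" "distinct [a, b, c, d]"
    "G a b" "G a c" "G a d" "G b c" "G b d" "G c d"
  shows False
proof -
  obtain pos \<gamma> where "outer_drawing n G pos \<gamma>" using outerplanar_outer_drawing[OF assms(1,2)] .
  then interpret outer_drawing n G pos \<gamma> .
  show ?thesis using no_K4 assms(3-) by blast
qed

section \<open>Sparsity and linear forests\<close>

lemma graph_onD: "graph_on n G \<Longrightarrow> G u v \<Longrightarrow> u < n \<and> v < n \<and> u \<noteq> v \<and> G v u"
  by (auto simp: graph_on_def)

text \<open>\<open>X\<close> sends positions on a fixed path to vertices, so a theta graph can be
  described by lists of positions, and disjointness becomes arithmetic.\<close>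

lemma theta_freeD:
  assumes "theta_free G" "inj_on X A" "a \<noteq> b" "distinct (q1 @ q2 @ q3)" "{a, b} \<inter> set (q1 @ q2 @ q3) = {}"
    "{a, b} \<union> set (q1 @ q2 @ q3) \<subseteq> A"
    "\<And>q. q \<in> {q1, q2, q3} \<Longrightarrow> q \<noteq> [] \<and> successively (\<lambda>i j. G (X i) (X j)) q \<and> G (X a) (X (hd q)) \<and> G (X (last q)) (X b)"
  shows False
proof -
  let ?q = "q1 @ q2 @ q3"
  have inj: "inj_on X ({a, b} \<union> set ?q)" using assms(2,6) inj_on_subset by blast
  have 1: "X a \<noteq> X b" using inj assms(3) by (auto simp: inj_on_def)
  have "distinct (map X ?q)" using assms(4) inj by (simp only: distinct_map) (meson inj_on_subset sup_ge2)
  then have 2: "distinct (map X q1 @ map X q2 @ map X q3)" by simp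
  have "X c \<notin> X ` set ?q" if "c \<in> {a, b}" for c
    using inj_on_image_mem_iff[OF inj, of c "set ?q"] that assms(5) by blast
  then have 3: "{X a, X b} \<inter> set (map X q1 @ map X q2 @ map X q3) = {}" by auto
  have 4: "successively G (X a # map X q @ [X b])" if "q \<in> {q1, q2, q3}" for q
    using assms(7)[OF that]
    by (cases q) (auto simp: successively_append_iff successively_map successively_Cons last_map hd_map hd_append)
  have "map X q1 = [] \<or> map X q2 = [] \<or> map X q3 = []"
    using assms(1) 1 2 3 4[of q1] 4[of q2] 4[of q3] unfolding theta_free_def by blast
  then show False using assms(7) by auto
qed

lemma theta_freeD':
  assumes "theta_free G" "a \<noteq> b" "distinct (p1 @ p2 @ p3)" "{a, b} \<inter> set (p1 @ p2 @ p3) = {}"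
    "successively G (a # p1 @ [b])" "successively G (a # p2 @ [b])" "successively G (a # p3 @ [b])"
    "p1 \<noteq> []" "p2 \<noteq> []" "p3 \<noteq> []"
  shows False
  using assms unfolding theta_free_def by blast

lemma successively_upt: "(\<And>i. u \<le> i \<Longrightarrow> Suc i < v \<Longrightarrow> P i (Suc i)) \<Longrightarrow> successively P [u..<v]"
proof (induction v)
  case (Suc v)
  then show ?case
    by (cases "u < v") (auto simp: successively_append_iff, metis Suc_pred less_Suc_eq_le less_nat_zero_code not_less_eq lessI neq0_conv)
qed simp

lemma card_nbrs_indices:
  assumes "distinct xs" "\<And>w. w \<in> S \<Longrightarrow> G v w \<Longrightarrow> w \<in> set xs"
  shows "card {w \<in> S. G v w} \<le> card {i. i < length xs \<and> G v (xs ! i)}"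
proof -
  have "{w \<in> S. G v w} \<subseteq> (!) xs ` {i. i < length xs \<and> G v (xs ! i)}"
    using assms(2) by (fastforce simp: in_set_conv_nth)
  then have "card {w \<in> S. G v w} \<le> card ((!) xs ` {i. i < length xs \<and> G v (xs ! i)})"
    by (intro card_mono) auto
  also have "\<dots> \<le> card {i. i < length xs \<and> G v (xs ! i)}" by (intro card_image_le) auto
  finally show ?thesis .
qed

lemma two_elements:
  assumes "2 \<le> card (A :: nat set)"
  obtains x y where "x \<in> A" "y \<in> A" "x < y"
proof -
  obtain x y where "x \<in> A" "y \<in> A" "x \<noteq> y"
    using assms by (metis card_2_iff' obtain_subset_with_card_n subsetD)
  then show thesis using that by (cases x y rule: linorder_cases) auto
qed

lemma ex_longest_path:
  assumes "finite S" "S \<noteq> {}"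
  obtains xs where "distinct xs" "successively G xs" "set xs \<subseteq> S" "xs \<noteq> []"
    "\<And>ys. distinct ys \<Longrightarrow> successively G ys \<Longrightarrow> set ys \<subseteq> S \<Longrightarrow> length ys \<le> length xs"
proof -
  let ?P = "\<lambda>xs. distinct xs \<and> successively G xs \<and> set xs \<subseteq> S"
  obtain s where s: "s \<in> S" using assms by blast
  have P: "?P [s]" using s by simp
  have "\<forall>ys. ?P ys \<longrightarrow> length ys < Suc (card S)"
    by (metis assms(1) card_mono distinct_card less_Suc_eq_le)
  then obtain xs where xs: "?P xs" "\<And>ys. ?P ys \<Longrightarrow> length ys \<le> length xs"
    using ex_has_greatest_nat[of ?P "[s]" length "Suc (card S)"] P by blast
  have "xs \<noteq> []" using xs(2)[OF P] by auto
  then show thesis using that xs by blast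
qed

text \<open>Among all longest paths and all chords at their first vertex take one with the shortest
  chord, from position 0 to position i.  Reversing the first i vertices gives another longest
  path, so both ends of that initial segment have all further neighbours beyond position i.\<close>

lemma theta_free_low_degree:
  assumes g: "graph_on n G" and th: "theta_free G" and S: "finite S" "S \<noteq> {}"
  shows "\<exists>v\<in>S. card {w \<in> S. G v w} \<le> 3"
proof (rule ccontr)
  assume "\<not> ?thesis"
  then have deg: "\<And>v. v \<in> S \<Longrightarrow> 4 \<le> card {w \<in> S. G v w}" by force
  note G = graph_onD[OF g]
  obtain xs0 where xs0: "distinct xs0" "successively G xs0" "set xs0 \<subseteq> S" "xs0 \<noteq> []"
    "\<And>ys. distinct ys \<Longrightarrow> successively G ys \<Longrightarrow> set ys \<subseteq> S \<Longrightarrow> length ys \<le> length xs0"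
    using ex_longest_path[OF S, of G] by blast
  define L where "L = length xs0"
  define paths where "paths = {xs. distinct xs \<and> successively G xs \<and> set xs \<subseteq> S \<and> length xs = L}"
  have L0: "0 < L" using xs0(4) by (simp add: L_def)
  have first: "w \<in> set xs" if "xs \<in> paths" "w \<in> S" "G (xs ! 0) w" for xs w
  proof (rule ccontr)
    assume "w \<notin> set xs"
    then have "distinct (w # xs)" "successively G (w # xs)" "set (w # xs) \<subseteq> S"
      using that G[OF that(3)] L0 by (cases xs; auto simp: paths_def)+
    then have "length (w # xs) \<le> L" using xs0(5) L_def by blast
    then show False using that by (simp add: paths_def)
  qed
  have nbrs: "4 \<le> card {i. i < L \<and> G (xs ! 0) (xs ! i)}" if "xs \<in> paths" for xs
  proof -
    have "xs ! 0 \<in> S" using that L0 by (auto simp: paths_def)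
    then have "4 \<le> card {w \<in> S. G (xs ! 0) w}" by (rule deg)
    also have "\<dots> \<le> card {i. i < length xs \<and> G (xs ! 0) (xs ! i)}"
      using that first[OF that] by (intro card_nbrs_indices) (auto simp: paths_def)
    finally show ?thesis using that by (simp add: paths_def)
  qed
  \<comment> \<open>The minimum is taken over all longest paths at once, so that \<open>far'\<close>
    holds for the reversed path \<open>ys\<close> as well as for \<open>xs\<close>.\<close>
  let ?Q = "\<lambda>i. \<exists>xs\<in>paths. 2 \<le> i \<and> i < L \<and> G (xs ! 0) (xs ! i)"
  define i where "i = (LEAST i. ?Q i)"
  \<comment> \<open>Positions 1 and \<open>i\<close> are discarded from the at least four
    neighbours; by minimality the remaining two or more lie beyond \<open>i\<close>.\<close>
  have far: "2 \<le> card ({m. m < L \<and> G (xs ! 0) (xs ! m)} - {1, i})" if "xs \<in> paths" for xs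
  proof -
    have "card {m. m < L \<and> G (xs ! 0) (xs ! m)} - card {1, i} \<le> card ({m. m < L \<and> G (xs ! 0) (xs ! m)} - {1, i})"
      by (rule diff_card_le_card_Diff) simp
    moreover have "card {1, i} \<le> 2" by (simp add: card_insert_if)
    ultimately show ?thesis using nbrs[OF that] by linarith
  qed
  have far': "{m. m < L \<and> G (xs ! 0) (xs ! m)} - {1, i} \<subseteq> {i<..<L}" if "xs \<in> paths" for xs
  proof
    fix m assume m: "m \<in> {m. m < L \<and> G (xs ! 0) (xs ! m)} - {1, i}"
    then have "m \<noteq> 0" using G[of "xs ! 0" "xs ! m"] by (cases "m = 0") auto
    then have "2 \<le> m" using m by auto
    then have "?Q m" using m that by auto
    then have "i \<le> m" unfolding i_def by (rule Least_le)
    then show "m \<in> {i<..<L}" using m by auto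
  qed
  have "xs0 \<in> paths" using xs0 by (auto simp: paths_def L_def)
  then obtain m where "m \<in> {m. m < L \<and> G (xs0 ! 0) (xs0 ! m)} - {1, i}"
    using far by (metis card.empty ex_in_conv not_numeral_le_zero)
  then have "2 \<le> m" "m < L" "G (xs0 ! 0) (xs0 ! m)"
    using G[of "xs0 ! 0" "xs0 ! m"] by (auto simp: Suc_le_eq numeral_2_eq_2 intro!: Suc_lessI gr0I)
  then have "?Q m" using \<open>xs0 \<in> paths\<close> by blast
  then have "?Q i" unfolding i_def by (rule LeastI)
  then obtain xs where xs: "xs \<in> paths" "2 \<le> i" "i < L" "G (xs ! 0) (xs ! i)" by blast
  have xs': "distinct xs" "successively G xs" "set xs \<subseteq> S" "length xs = L" using xs by (auto simp: paths_def)
  define ys where "ys = rev (take i xs) @ drop i xs"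
  have ys: "ys \<in> paths"
  proof -
    have eq: "take i xs @ drop i xs = xs" by simp
    have s: "successively G (take i xs)" "successively G (drop i xs)"
      using xs'(2) successively_append_iff[of G "take i xs" "drop i xs"] by auto
    have "successively G (rev (take i xs))"
      using s(1) G by (auto simp: successively_rev intro: successively_mono)
    moreover have "last (rev (take i xs)) = xs ! 0" "hd (drop i xs) = xs ! i"
      using xs xs' L0 by (auto simp: last_rev hd_conv_nth hd_drop_conv_nth simp flip: length_greater_0_conv)
    ultimately have "successively G ys" unfolding ys_def
      using s(2) xs(4) by (simp add: successively_append_iff)
    moreover have "distinct ys" unfolding ys_def
      using xs'(1) by (metis distinct_append distinct_rev eq set_rev)
    moreover have "set ys \<subseteq> S" unfolding ys_def
      using xs'(3) by (metis eq set_append set_rev)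
    ultimately show ?thesis using xs'(4) by (simp add: paths_def ys_def)
  qed
  have ys0: "ys ! 0 = xs ! (i - 1)" using xs xs' by (simp add: ys_def nth_append rev_nth)
  have ysm: "ys ! m = xs ! m" if "i < m" "m < L" for m using that xs xs' by (simp add: ys_def nth_append)
  \<comment> \<open>Two far neighbours \<open>j < k\<close> of position 0, and below two far
    neighbours \<open>p < q\<close> of position \<open>i - 1\<close>, which is the first vertex of
    \<open>ys\<close>.\<close>
  obtain j k where jk: "i < j" "j < k" "k < L" "G (xs ! 0) (xs ! j)" "G (xs ! 0) (xs ! k)"
    using two_elements[OF far[OF xs(1)]] far'[OF xs(1)] by (smt (verit) DiffE greaterThanLessThan_iff mem_Collect_eq subsetD)
  obtain p q where pq': "i < p" "p < q" "q < L" "G (ys ! 0) (ys ! p)" "G (ys ! 0) (ys ! q)"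
    using two_elements[OF far[OF ys]] far'[OF ys] by (smt (verit) DiffE greaterThanLessThan_iff mem_Collect_eq subsetD)
  have pq: "i < p" "p < q" "q < L" "G (xs ! (i - 1)) (xs ! p)" "G (xs ! (i - 1)) (xs ! q)"
    using pq' ys0 ysm by auto
  let ?X = "\<lambda>m. xs ! m"
  let ?H = "\<lambda>a b. G (?X a) (?X b)"
  have inj: "inj_on ?X {..<L}" using xs' by (auto simp: inj_on_def nth_eq_iff_index_eq)
  have step: "?H m (Suc m)" "?H (Suc m) m" if "Suc m < L" for m
    using successively_nth[OF xs'(2), of m] xs'(4) that G by auto
  have seg: "successively ?H [u..<v]" if "v \<le> L" for u v
    using step that by (intro successively_upt) auto
  have rseg: "successively ?H (rev [u..<v])" if "v \<le> L" for u v
    using seg[OF that, of u] G by (auto simp: successively_rev intro: successively_mono)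
  define btw where "btw = (\<lambda>u v. if u \<le> v then [u..<Suc v] else rev [v..<Suc u])"
  have btw: "btw u v \<noteq> []" "successively ?H (btw u v)" "hd (btw u v) = u" "last (btw u v) = v"
      "distinct (btw u v)" "set (btw u v) = {min u v..max u v}" if "u < L" "v < L" for u v
    unfolding btw_def using that seg[of "Suc v" u] rseg[of "Suc u" v]
    by (auto simp: hd_append last_rev hd_rev simp del: upt_Suc)
  have H0: "?H 0 1" "?H 1 0" using step[of 0] xs by auto
  \<comment> \<open>For \<open>i \<ge> 3\<close> the ends 0 and \<open>i - 1\<close> are joined
    through the initial segment, through \<open>i\<close>, and through the tail between
    \<open>j\<close> and \<open>p\<close>. For \<open>i = 2\<close> the initial segment has no inner
    vertex: if \<open>j = p\<close>, the routes between 0 and 1 are 2, \<open>j\<close> and the tail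
    between \<open>k\<close> and \<open>q\<close>; if \<open>j < p\<close>, the ends are 1 and
    \<open>j\<close>, with routes through 0, through 2 up to \<open>j - 1\<close>, and from
    \<open>p\<close> back to \<open>j + 1\<close>; \<open>p < j\<close> is the mirror image.\<close>
  consider "i \<ge> 3" | "i = 2" "j = p" | "i = 2" "j < p" | "i = 2" "p < j" using xs(2) by linarith
  then show False
  proof cases
    case 1
    show False
    proof (rule theta_freeD[OF th inj, of 0 "i - 1" "[1..<i - 1]" "[i]" "btw j p"])
      fix q assume "q \<in> {[1..<i - 1], [i], btw j p}"
      then show "q \<noteq> [] \<and> successively ?H q \<and> G (?X 0) (?X (hd q)) \<and> G (?X (last q)) (?X (i - 1))"
        using 1 xs jk pq btw[of j p] seg[of "i - 1" 1] H0 step[of "i - 2"] step[of "i - 1"] G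
        by (auto simp: numeral_2_eq_2 Suc_diff_Suc)
    qed (use 1 xs jk pq btw[of j p] in auto)
  next
    case 2
    show False
    proof (rule theta_freeD[OF th inj, of 0 1 "[2]" "[j]" "btw k q"])
      fix r assume "r \<in> {[2], [j], btw k q}"
      then show "r \<noteq> [] \<and> successively ?H r \<and> G (?X 0) (?X (hd r)) \<and> G (?X (last r)) (?X 1)"
        using 2 xs jk pq btw[of k q] H0 step[of 1] G by (auto simp: numeral_2_eq_2)
    qed (use 2 xs jk pq btw[of k q] in auto)
  next
    case 3
    show False
    proof (rule theta_freeD[OF th inj, of 1 j "[0]" "[2..<j]" "rev [Suc j..<Suc p]"])
      fix r assume "r \<in> {[0], [2..<j], rev [Suc j..<Suc p]}"
      then show "r \<noteq> [] \<and> successively ?H r \<and> G (?X 1) (?X (hd r)) \<and> G (?X (last r)) (?X j)"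
        using 3 xs jk pq H0 step[of 1] step[of j] step[of "j - 1"] G seg[of j 2] rseg[of "Suc p" "Suc j"]
        by (auto simp: numeral_2_eq_2 hd_rev last_rev simp del: upt_Suc)
    qed (use 3 xs jk pq in auto)
  next
    case 4
    show False
    proof (rule theta_freeD[OF th inj, of 0 p "[1]" "[2..<p]" "rev [Suc p..<Suc j]"])
      fix r assume "r \<in> {[1], [2..<p], rev [Suc p..<Suc j]}"
      then show "r \<noteq> [] \<and> successively ?H r \<and> G (?X 0) (?X (hd r)) \<and> G (?X (last r)) (?X p)"
        using 4 xs jk pq H0 step[of 1] step[of p] step[of "p - 1"] G seg[of p 2] rseg[of "Suc j" "Suc p"]
        by (auto simp: numeral_2_eq_2 hd_rev last_rev simp del: upt_Suc)
    qed (use 4 xs jk pq in auto)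
  qed
qed

text \<open>Deleting a vertex of degree at most 3 lowers the degree sum by at most 6: its own degree
  and one for each neighbour.\<close>

lemma theta_free_degree_sum:
  assumes g: "graph_on n G" and th: "theta_free G" and "finite S"
  shows "(\<Sum>v\<in>S. card {w \<in> S. G v w}) \<le> 6 * card S"
  using assms(3)
proof (induction "card S" arbitrary: S)
  case 0
  then show ?case by simp
next
  case (Suc c)
  then have "S \<noteq> {}" by auto
  then obtain v where v: "v \<in> S" "card {w \<in> S. G v w} \<le> 3"
    using theta_free_low_degree[OF g th Suc(3)] by blast
  let ?T = "S - {v}"
  have c: "card S = Suc (card ?T)" using v Suc.prems by (metis card_Suc_Diff1)
  have IH: "(\<Sum>u\<in>?T. card {w \<in> ?T. G u w}) \<le> 6 * card ?T"
    using Suc c by (intro Suc(1)) auto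
  have 1: "card {w \<in> S. G u w} \<le> card {w \<in> ?T. G u w} + (if G v u then 1 else 0)" for u
  proof -
    have "{w \<in> S. G u w} \<subseteq> {w \<in> ?T. G u w} \<union> (if G v u then {v} else {})"
      using graph_onD[OF g] by auto
    then have "card {w \<in> S. G u w} \<le> card ({w \<in> ?T. G u w} \<union> (if G v u then {v} else {}))"
      using Suc.prems by (intro card_mono) auto
    also have "\<dots> \<le> card {w \<in> ?T. G u w} + card (if G v u then {v} else {})" by (rule card_Un_le)
    finally show ?thesis by (simp split: if_splits)
  qed
  have "(\<Sum>u\<in>?T. if G v u then 1 else 0) = card {u \<in> ?T. G v u}"
    using Suc.prems by (simp add: sum.If_cases Int_def)
  also have "\<dots> \<le> card {w \<in> S. G v w}" using Suc.prems by (intro card_mono) auto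
  finally have 2: "(\<Sum>u\<in>?T. if G v u then 1 else 0) \<le> card {w \<in> S. G v w}" .
  have "(\<Sum>u\<in>S. card {w \<in> S. G u w}) = card {w \<in> S. G v w} + (\<Sum>u\<in>?T. card {w \<in> S. G u w})"
    using Suc.prems v by (simp add: sum.remove)
  also have "\<dots> \<le> card {w \<in> S. G v w} + (\<Sum>u\<in>?T. card {w \<in> ?T. G u w} + (if G v u then 1 else 0))"
    by (intro add_left_mono sum_mono 1)
  also have "\<dots> \<le> 3 + (6 * card ?T + 3)"
    using IH 2 v by (simp add: sum.distrib)
  finally show ?case using c by simp
qed

section \<open>Neighbourhoods induce linear forests\<close>

lemma theta_free_common_neighbours:
  assumes "graph_on n G" "theta_free G" "a \<noteq> b"
  shows "card {w. G a w \<and> G b w} \<le> 2"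
proof (rule ccontr)
  assume "\<not> ?thesis"
  then obtain T where T: "T \<subseteq> {w. G a w \<and> G b w}" "card T = 3"
    by (metis obtain_subset_with_card_n not_less_eq_eq numeral_2_eq_2 numeral_3_eq_3)
  then obtain x y z where xyz: "T = {x, y, z}" "x \<noteq> y" "y \<noteq> z" "x \<noteq> z" by (metis card_3_iff)
  have G: "G a w \<and> G w b \<and> w \<noteq> a \<and> w \<noteq> b" if "w \<in> T" for w
    using T(1) that graph_onD[OF assms(1)] by blast
  show False
    by (rule theta_freeD'[OF assms(2,3), of "[x]" "[y]" "[z]"]) (use xyz G[of x] G[of y] G[of z] in auto)
qed

text \<open>A triangle in the neighbourhood forms a K_4 with \<open>u\<close>. On a longer cycle
  \<open>a, b, d, ...\<close> the vertices \<open>a\<close> and \<open>d\<close> are joined through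
  \<open>b\<close>, through \<open>u\<close>, and through the rest of the cycle.\<close>

lemma outerplanar_neighbourhood_acyclic:
  assumes g: "graph_on n G" and op: "outerplanar n G"
    and c: "distinct cs" "length cs \<ge> 3" "\<And>v. v \<in> set cs \<Longrightarrow> G u v" "successively G cs" "G (last cs) (hd cs)"
  shows False
proof -
  note G = graph_onD[OF g]
  obtain a b d ds where cs: "cs = a # b # d # ds"
    using c(2) by (metis One_nat_def Suc_1 Suc_le_length_iff numeral_3_eq_3)
  show False
  proof (cases "ds = []")
    case True
    then show False
      using outerplanar_no_K4[OF g op, of u a b d] c cs G[of u a] G[of u b] G[of u d] G[of d a] by auto
  next
    case False
    have "successively G (rev ds)"
      using c(4) cs G False by (auto simp: successively_Cons intro: successively_mono)
    moreover have "last (rev ds) = hd ds" "hd (rev ds) = last ds" using False by (auto simp: last_rev hd_rev)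
    ultimately have 3: "successively G (a # rev ds @ [d])"
      using c(4,5) cs G False by (auto simp: successively_append_iff successively_Cons)
    have 1: "successively G (a # [b] @ [d])" using c(4) cs by simp
    have 2: "successively G (a # [u] @ [d])" using c(3) cs G by auto
    have u: "u \<notin> set cs" using c(3) G by blast
    show False
      by (rule theta_freeD'[OF outerplanar_theta_free[OF g op] _ _ _ 1 2 3]) (use False c(1) cs u in auto)
  qed
qed

text \<open>A longest path is a whole component: a chord would close a cycle, a neighbour of an end
  off the path would extend it, and one of an inner vertex would give degree 3. Remove it and use
  induction.\<close>

lemma linear_forest_decomposition:
  fixes H :: "'a \<Rightarrow> 'a \<Rightarrow> bool"
  assumes "finite V" and sym: "\<And>u v. H u v \<Longrightarrow> H v u" and irr: "\<And>v. \<not> H v v"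
    and "\<And>v. v \<in> V \<Longrightarrow> card {w \<in> V. H v w} \<le> 2"
    and "\<And>cs. distinct cs \<Longrightarrow> length cs \<ge> 3 \<Longrightarrow> set cs \<subseteq> V \<Longrightarrow> successively H cs \<Longrightarrow> \<not> H (last cs) (hd cs)"
  shows "\<exists>pss. distinct (concat pss) \<and> set (concat pss) = V \<and> [] \<notin> set pss \<and>
     (\<forall>ps\<in>set pss. successively H ps) \<and>
     (\<forall>u\<in>V. \<forall>v\<in>V. H u v \<longrightarrow> (\<exists>ps\<in>set pss. \<exists>i. Suc i < length ps \<and>
        (ps ! i = u \<and> ps ! Suc i = v \<or> ps ! i = v \<and> ps ! Suc i = u)))"
  using assms(1,4,5)
proof (induction "card V" arbitrary: V rule: less_induct)
  case less
  show ?case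
  proof (cases "V = {}")
    case True
    then show ?thesis by (intro exI[of _ "[]"]) simp
  next
    case False
    obtain ps where ps: "distinct ps" "successively H ps" "set ps \<subseteq> V" "ps \<noteq> []"
      "\<And>ys. distinct ys \<Longrightarrow> successively H ys \<Longrightarrow> set ys \<subseteq> V \<Longrightarrow> length ys \<le> length ps"
      using ex_longest_path[OF less.prems(1) False, of H] by blast
    have symE: "H = (\<lambda>x y. H y x)" using sym by blast
    have no_chord: "m' = Suc m" if "m < m'" "m' < length ps" "H (ps ! m) (ps ! m')" for m m'
    proof (rule ccontr)
      assume n: "m' \<noteq> Suc m"
      \<comment> \<open>The segment that the chord closes to a cycle; it has at least three vertices
        because \<open>m'\<close> is not the successor of \<open>m\<close>.\<close>
      let ?c = "drop m (take (Suc m') ps)"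
      have "take (Suc m') ps = take m (take (Suc m') ps) @ ?c" by (rule append_take_drop_id[symmetric])
      moreover have "ps = take (Suc m') ps @ drop (Suc m') ps" by simp
      ultimately have "successively H ?c" using ps(2) by (metis successively_append_iff)
      moreover have "hd ?c = ps ! m" using that by (simp add: hd_drop_conv_nth)
      moreover have "last ?c = ps ! m'" using that by (simp add: last_drop last_conv_nth take_Suc_conv_app_nth)
      moreover have "set ?c \<subseteq> V" using ps(3) by (meson order_trans set_drop_subset set_take_subset)
      moreover have "length ?c \<ge> 3" "distinct ?c" using that n ps(1) by auto
      ultimately show False
        using less.prems(3)[of ?c] sym[OF that(3)] by metis
    qed
    have closed: "w \<in> set ps" if m: "m < length ps" "H (ps ! m) w" "w \<in> V" for m w
    proof (rule ccontr)
      assume w: "w \<notin> set ps"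
      consider "m = 0" | "Suc m = length ps" | "0 < m" "Suc m < length ps" using m by linarith
      then show False
      proof cases
        case 1
        then have "successively H (w # ps)" using ps m sym by (cases ps) (auto simp: successively_Cons)
        then show False using ps(5)[of "w # ps"] w m ps by auto
      next
        case 2
        then have "last ps = ps ! m" using ps(4) by (metis diff_Suc_1 last_conv_nth)
        then have "successively H (ps @ [w])" using ps m by (simp add: successively_append_iff)
        then show False using ps(5)[of "ps @ [w]"] w m ps by auto
      next
        case 3
        then have h: "H (ps ! m) (ps ! (m - 1))" "H (ps ! m) (ps ! Suc m)"
          using successively_nth[OF ps(2), of m] successively_nth[OF ps(2), of "m - 1"] sym by auto
        have "{ps ! (m - 1), ps ! Suc m, w} \<subseteq> {x \<in> V. H (ps ! m) x}"
          using h m 3 ps(3) by (auto simp: subset_iff)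
        then have "card {ps ! (m - 1), ps ! Suc m, w} \<le> card {x \<in> V. H (ps ! m) x}"
          using less.prems(1) by (intro card_mono) auto
        also have "\<dots> \<le> 2" using m(1) ps(3) by (intro less.prems(2)) auto
        finally have le: "card {ps ! (m - 1), ps ! Suc m, w} \<le> 2" .
        have "ps ! (m - 1) \<noteq> ps ! Suc m" using ps(1) 3 by (simp add: nth_eq_iff_index_eq)
        moreover have "w \<noteq> ps ! (m - 1)" "w \<noteq> ps ! Suc m" using w 3 by auto
        ultimately have "card {ps ! (m - 1), ps ! Suc m, w} = 3" by simp
        then show False using le by simp
      qed
    qed
    have inner: "\<exists>i. Suc i < length ps \<and> (ps ! i = u \<and> ps ! Suc i = v \<or> ps ! i = v \<and> ps ! Suc i = u)"
      if uv: "u \<in> set ps" "v \<in> V" "H u v" for u v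
    proof -
      obtain m where m: "m < length ps" "u = ps ! m" using uv by (metis in_set_conv_nth)
      have "v \<in> set ps" using closed[of m v] m uv by simp
      then obtain m' where m': "m' < length ps" "v = ps ! m'" by (metis in_set_conv_nth)
      have "m \<noteq> m'" using uv irr m m' by auto
      then show ?thesis
        using no_chord[of m m'] no_chord[of m' m] m m' uv sym by (metis nat_neq_iff)
    qed
    let ?V = "V - set ps"
    have "card ?V < card V" using ps(3,4) less.prems(1) by (intro psubset_card_mono) (cases ps; auto)+
    moreover have "card {w \<in> ?V. H v w} \<le> 2" if "v \<in> ?V" for v
    proof -
      have "card {w \<in> ?V. H v w} \<le> card {w \<in> V. H v w}" using less.prems(1) by (intro card_mono) auto
      then show ?thesis using less.prems(2)[of v] that by force
    qed
    ultimately obtain pss where pss: "distinct (concat pss)" "set (concat pss) = ?V" "[] \<notin> set pss"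
      "\<And>ps. ps \<in> set pss \<Longrightarrow> successively H ps"
      "\<And>u v. u \<in> ?V \<Longrightarrow> v \<in> ?V \<Longrightarrow> H u v \<Longrightarrow> \<exists>ps\<in>set pss. \<exists>i. Suc i < length ps \<and>
        (ps ! i = u \<and> ps ! Suc i = v \<or> ps ! i = v \<and> ps ! Suc i = u)"
      using less.hyps[of ?V] less.prems by (smt (verit, best) DiffE finite_Diff subset_iff)
    show ?thesis
    proof (intro exI[of _ "ps # pss"] conjI ballI impI)
      show "distinct (concat (ps # pss))" "set (concat (ps # pss)) = V" "[] \<notin> set (ps # pss)"
        using pss ps by auto
      show "successively H qs" if "qs \<in> set (ps # pss)" for qs using that ps pss by auto
      fix u v assume uv: "u \<in> V" "v \<in> V" "H u v"
      consider "u \<in> set ps" | "v \<in> set ps" | "u \<in> ?V" "v \<in> ?V" using uv by blast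
      then show "\<exists>ps\<in>set (ps # pss). \<exists>i. Suc i < length ps \<and>
        (ps ! i = u \<and> ps ! Suc i = v \<or> ps ! i = v \<and> ps ! Suc i = u)"
      proof cases
        case 1
        show ?thesis using inner[OF 1 uv(2,3)] by auto
      next
        case 2
        show ?thesis using inner[OF 2 uv(1) sym[OF uv(3)]] by auto
      next
        case 3
        show ?thesis using pss(5)[OF 3 uv(3)] by auto
      qed
    qed
  qed
qed

section \<open>Perron vectors\<close>

definition ip :: "nat \<Rightarrow> (nat \<Rightarrow> real) \<Rightarrow> (nat \<Rightarrow> real) \<Rightarrow> real" where
  "ip n x y = (\<Sum>i<n. x i * y i)"

definition mv :: "nat \<Rightarrow> (nat \<Rightarrow> nat \<Rightarrow> real) \<Rightarrow> (nat \<Rightarrow> real) \<Rightarrow> nat \<Rightarrow> real" where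
  "mv n A x i = (\<Sum>j<n. A i j * x j)"

lemma ip_commute: "ip n x y = ip n y x"
  by (simp add: ip_def mult.commute)

lemma ip_cong: "(\<And>i. i < n \<Longrightarrow> x i = x' i) \<Longrightarrow> (\<And>i. i < n \<Longrightarrow> y i = y' i) \<Longrightarrow> ip n x y = ip n x' y'"
  by (simp add: ip_def)

lemma ip_scale: "ip n x (\<lambda>i. c * y i) = c * ip n x y"
  by (simp add: ip_def sum_distrib_left mult_ac)

lemma ip_perturb:
  "ip n (\<lambda>i. x i + t * e i) (\<lambda>i. y i + t * f i) = ip n x y + t * ip n x f + t * ip n e y + t\<^sup>2 * ip n e f"
  unfolding ip_def sum_distrib_left sum.distrib[symmetric]
  by (intro sum.cong refl) (simp add: power2_eq_square algebra_simps)

lemma mv_add_scale: "mv n A (\<lambda>i. x i + t * y i) = (\<lambda>i. mv n A x i + t * mv n A y i)"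
  by (rule ext) (simp add: mv_def ring_distribs sum.distrib sum_distrib_left mult_ac)

lemma ip_mv_symmetric:
  assumes "\<And>i j. A i j = A j i"
  shows "ip n x (mv n A y) = ip n (mv n A x) y"
proof -
  have "ip n x (mv n A y) = (\<Sum>i<n. \<Sum>j<n. x i * A i j * y j)"
    by (simp add: ip_def mv_def sum_distrib_left mult_ac)
  also have "\<dots> = (\<Sum>j<n. \<Sum>i<n. x i * A i j * y j)" by (rule sum.swap)
  also have "\<dots> = ip n (mv n A x) y"
    unfolding ip_def mv_def sum_distrib_right by (intro sum.cong refl) (simp add: assms mult_ac)
  finally show ?thesis .
qed

lemma ip_nonneg: "0 \<le> ip n x x"
  by (simp add: ip_def sum_nonneg)

lemma ip_eq_0_iff: "ip n x x = 0 \<longleftrightarrow> (\<forall>i<n. x i = 0)"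
  unfolding ip_def by (subst sum_nonneg_eq_0_iff) auto

lemma ip_unit: "i < n \<Longrightarrow> ip n x (\<lambda>j. if j = i then 1 else 0) = x i"
  by (simp add: ip_def if_distrib cong: if_cong)

text \<open>Perturbing \<open>x\<close> by \<open>t\<close> times the i-th unit vector gives a
  quadratic in \<open>t\<close> that is never positive and vanishes at 0, so its linear coefficient
  \<open>2 * D\<close> is 0.\<close>

lemma rayleigh_maximizer_eigenvector:
  assumes sym: "\<And>i j. A i j = A j i"
    and le: "\<And>y. ip n y (mv n A y) \<le> \<mu> * ip n y y"
    and eq: "ip n x (mv n A x) = \<mu> * ip n x x" and i: "i < n"
  shows "mv n A x i = \<mu> * x i"
proof -
  obtain e :: "nat \<Rightarrow> real" where e: "\<And>x. ip n x e = x i" "e i = 1"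
    by (rule that[of "\<lambda>j. if j = i then 1 else 0"]) (simp_all add: ip_unit[OF i])
  define q where "q = ip n e (mv n A e)"
  define D where "D = mv n A x i - \<mu> * x i"
  define C where "C = \<bar>q - \<mu>\<bar> + 1"
  have C: "C > 0" by (simp add: C_def add_pos_pos)
  have bound: "2 * t * D + t\<^sup>2 * (q - \<mu>) \<le> 0" for t
  proof -
    let ?y = "\<lambda>j. x j + t * e j"
    have 1: "ip n ?y ?y = ip n x x + 2 * t * x i + t\<^sup>2"
      using e by (simp add: ip_perturb ip_commute[of n e x])
    have "ip n x (mv n A e) = mv n A x i" using ip_mv_symmetric[of A n x e, OF sym] e by simp
    then have 2: "ip n ?y (mv n A ?y) = ip n x (mv n A x) + 2 * t * mv n A x i + t\<^sup>2 * q"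
      using e by (simp add: mv_add_scale ip_perturb ip_commute[of n e] q_def)
    show ?thesis using le[of ?y] eq 1 2 by (simp add: D_def algebra_simps)
  qed
  \<comment> \<open>\<open>t = D / C\<close> with \<open>C > \<bar>q - \<mu>\<bar>\<close> is small
    enough for the linear term to dominate.\<close>
  have "2 * (D / C) * D + (D / C)\<^sup>2 * (q - \<mu>) \<le> 0" by (rule bound)
  moreover have "(D / C)\<^sup>2 * (q - \<mu>) \<ge> (D / C)\<^sup>2 * (- C)"
    by (intro mult_left_mono) (auto simp: C_def)
  moreover have "(D / C)\<^sup>2 * (- C) = - (D\<^sup>2 / C)" using C by (simp add: power2_eq_square)
  moreover have "2 * (D / C) * D = 2 * (D\<^sup>2 / C)" by (simp add: power2_eq_square)
  ultimately have "D\<^sup>2 / C \<le> 0" by linarith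
  then have "D = 0" using C by (simp add: divide_le_0_iff)
  then show ?thesis by (simp add: D_def)
qed

text \<open>The Rayleigh quotient is maximised over nonnegative unit vectors only. As the entries of
  \<open>A\<close> are nonnegative, replacing \<open>y\<close> by its absolute values does not
  decrease the form, so the maximum is global.\<close>

lemma perron_vector:
  assumes n: "n > 0" and sym: "\<And>i j. A i j = A j i" and pos: "\<And>i j. 0 \<le> A i j"
  obtains x \<mu> where "\<And>i. 0 \<le> x i" "ip n x x = 1" "\<And>i. i < n \<Longrightarrow> mv n A x i = \<mu> * x i"
    "\<And>y. ip n y (mv n A y) \<le> \<mu> * ip n y y"
proof -
  \<comment> \<open>Vectors are functions on all natural numbers; coordinates from \<open>n\<close>
    on are pinned to 0, and the unit ball becomes part of a compact product.\<close>
  let ?S = "\<lambda>i. if i < n then {0..1::real} else {0}"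
  define K where "K = {x. ip n x x = 1} \<inter> Pi\<^sub>E UNIV ?S"
  have cont: "continuous_on UNIV (\<lambda>x :: nat \<Rightarrow> real. x i)" for i by simp
  have c1: "continuous_on UNIV (\<lambda>x. ip n x x)"
    unfolding ip_def by (intro continuous_intros cont)
  have c2: "continuous_on UNIV (\<lambda>x. ip n x (mv n A x))"
    unfolding ip_def mv_def by (intro continuous_intros cont)
  have "closed {x. ip n x x = 1}"
    using continuous_closed_vimage[of "{1}" "\<lambda>x. ip n x x"] c1
    by (auto simp: vimage_def continuous_on_eq_continuous_at)
  moreover have "compact (Pi\<^sub>E UNIV ?S)"
    using compactin_PiE[of "\<lambda>_. euclidean" UNIV ?S] by (simp add: euclidean_product_topology)
  ultimately have K: "compact K" unfolding K_def by (rule closed_Int_compact)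
  have Kmem: "x \<in> K" if "ip n x x = 1" "\<And>i. 0 \<le> x i" "\<And>i. i \<ge> n \<Longrightarrow> x i = 0" for x
  proof -
    have "x i \<le> 1" if "i < n" for i
    proof -
      have "(x i)\<^sup>2 \<le> ip n x x" unfolding ip_def power2_eq_square
        using that by (intro member_le_sum) auto
      then show ?thesis using \<open>ip n x x = 1\<close> by (simp add: power2_le_iff_abs_le abs_le_iff abs_square_le_1)
    qed
    then show ?thesis unfolding K_def using that by (auto simp: PiE_def Pi_def)
  qed
  have "(\<lambda>j. if j = 0 then 1 else 0) \<in> K"
    using n ip_unit[of 0 n "\<lambda>j. if j = 0 then 1 else 0"] by (intro Kmem) auto
  then obtain x where x: "x \<in> K" "\<And>y. y \<in> K \<Longrightarrow> ip n y (mv n A y) \<le> ip n x (mv n A x)"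
    using continuous_attains_sup[OF K _ continuous_on_subset[OF c2]] by blast
  define \<mu> where "\<mu> = ip n x (mv n A x)"
  have x1: "ip n x x = 1" using x by (simp add: K_def)
  have x0: "0 \<le> x i" for i
    using x(1) unfolding K_def PiE_def Pi_def by (cases "i < n") (auto dest: spec[of _ i])
  have le: "ip n y (mv n A y) \<le> \<mu> * ip n y y" for y
  proof (cases "ip n y y = 0")
    case True
    then have "ip n y (mv n A y) = 0" by (simp add: ip_eq_0_iff) (simp add: ip_def)
    then show ?thesis using True by simp
  next
    case False
    define s where "s = sqrt (ip n y y)"
    have s: "s > 0" "s * s = ip n y y" using False ip_nonneg[of n y] by (auto simp: s_def)
    define z where "z = (\<lambda>i. if i < n then \<bar>y i\<bar> / s else 0)"
    have "ip n z z = (\<Sum>i<n. y i * y i / (s * s))" by (simp add: ip_def z_def)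
    also have "\<dots> = ip n y y / (s * s)" by (simp add: ip_def sum_divide_distrib)
    also have "\<dots> = 1" using s False by simp
    finally have "z \<in> K" using s by (intro Kmem) (auto simp: z_def)
    then have "ip n z (mv n A z) \<le> \<mu>" using x(2) by (simp add: \<mu>_def)
    moreover have "ip n z (mv n A z) = (\<Sum>i<n. \<Sum>j<n. A i j * \<bar>y i\<bar> * \<bar>y j\<bar>) / (s * s)"
      by (simp add: ip_def mv_def z_def sum_distrib_left sum_divide_distrib mult_ac)
    ultimately have "(\<Sum>i<n. \<Sum>j<n. A i j * \<bar>y i\<bar> * \<bar>y j\<bar>) / (s * s) \<le> \<mu>" by simp
    then have "(\<Sum>i<n. \<Sum>j<n. A i j * \<bar>y i\<bar> * \<bar>y j\<bar>) \<le> \<mu> * (s * s)"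
      by (subst (asm) pos_divide_le_eq) (simp_all add: s(1))
    then have "(\<Sum>i<n. \<Sum>j<n. A i j * \<bar>y i\<bar> * \<bar>y j\<bar>) \<le> \<mu> * ip n y y" by (simp only: s(2))
    moreover have "ip n y (mv n A y) \<le> (\<Sum>i<n. \<Sum>j<n. A i j * \<bar>y i\<bar> * \<bar>y j\<bar>)"
      unfolding ip_def mv_def sum_distrib_left
    proof (intro sum_mono)
      fix i j
      have "y i * (A i j * y j) = A i j * (y i * y j)" by simp
      also have "\<dots> \<le> A i j * (\<bar>y i\<bar> * \<bar>y j\<bar>)"
        using pos by (intro mult_left_mono) (auto simp flip: abs_mult)
      finally show "y i * (A i j * y j) \<le> A i j * \<bar>y i\<bar> * \<bar>y j\<bar>" by simp
    qed
    ultimately show ?thesis by linarith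
  qed
  have "mv n A x i = \<mu> * x i" if "i < n" for i
    using x1 by (intro rayleigh_maximizer_eigenvector[OF sym le _ that]) (simp add: \<mu>_def)
  then show thesis using that[of x \<mu>] x0 x1 le by blast
qed

text \<open>Bessel's inequality for the unit vectors bounds the number of orthonormal eigenvectors by n.\<close>

lemma finite_eigenvalues:
  assumes sym: "\<And>i j. A i j = A j i"
  shows "finite {\<mu>. is_eigenvalue n A \<mu>}"
proof (rule ccontr)
  assume "infinite {\<mu>. is_eigenvalue n A \<mu>}"
  then obtain T where T: "T \<subseteq> {\<mu>. is_eigenvalue n A \<mu>}" "finite T" "card T = Suc n"
    using infinite_arbitrarily_large by blast
  have "\<exists>x. ip n x x = 1 \<and> (\<forall>i<n. mv n A x i = \<mu> * x i)" if mu: "\<mu> \<in> T" for \<mu>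
  proof -
    obtain x where x: "\<exists>i<n. x i \<noteq> 0" "\<forall>i<n. mv n A x i = \<mu> * x i"
      using subsetD[OF T(1) mu] by (auto simp: is_eigenvalue_def mv_def)
    then have "ip n x x > 0" using ip_nonneg[of n x] ip_eq_0_iff[of n x] by force
    define s where "s = sqrt (ip n x x)"
    have s: "s * s = ip n x x" "s > 0" using \<open>ip n x x > 0\<close> by (auto simp: s_def)
    let ?z = "\<lambda>i. 1 / s * x i"
    have "ip n ?z ?z = 1 / s * (1 / s * ip n x x)"
      by (simp only: ip_scale ip_commute[of n ?z])
    also have "\<dots> = 1" unfolding s(1)[symmetric] using s(2) by simp
    finally have "ip n ?z ?z = 1" .
    moreover have "mv n A ?z i = 1 / s * mv n A x i" for i by (simp add: mv_def sum_divide_distrib)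
    ultimately show ?thesis using x(2) by (intro exI[of _ ?z]) simp
  qed
  then obtain X where X: "\<And>\<mu>. \<mu> \<in> T \<Longrightarrow> ip n (X \<mu>) (X \<mu>) = 1"
      "\<And>\<mu> i. \<mu> \<in> T \<Longrightarrow> i < n \<Longrightarrow> mv n A (X \<mu>) i = \<mu> * X \<mu> i"
    by metis
  have orth: "ip n (X \<mu>) (X \<nu>) = (if \<mu> = \<nu> then 1 else 0)" if "\<mu> \<in> T" "\<nu> \<in> T" for \<mu> \<nu>
  proof -
    have "\<nu> * ip n (X \<mu>) (X \<nu>) = ip n (X \<mu>) (mv n A (X \<nu>))"
      using X(2) that by (simp add: ip_scale[symmetric] cong: ip_cong)
    also have "\<dots> = ip n (mv n A (X \<mu>)) (X \<nu>)" by (rule ip_mv_symmetric[OF sym])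
    also have "\<dots> = ip n (X \<nu>) (\<lambda>i. \<mu> * X \<mu> i)"
      using X(2) that by (simp add: ip_commute[of n "X \<nu>"] cong: ip_cong)
    also have "\<dots> = \<mu> * ip n (X \<mu>) (X \<nu>)" by (simp add: ip_scale ip_commute)
    finally show ?thesis using X(1) that by auto
  qed
  have "(\<Sum>\<mu>\<in>T. (X \<mu> i)\<^sup>2) \<le> 1" if "i < n" for i
  proof -
    \<comment> \<open>Squared distance of the i-th unit vector from its projection to the span of
      the eigenvectors. Summing the resulting bound over \<open>i\<close> would give
      \<open>n + 1 \<le> n\<close>.\<close>
    have "0 \<le> (\<Sum>j<n. ((if j = i then 1 else 0) - (\<Sum>\<mu>\<in>T. X \<mu> i * X \<mu> j))\<^sup>2)" by (intro sum_nonneg) simp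
    also have "\<dots> = (\<Sum>j<n. if j = i then 1 - 2 * (\<Sum>\<mu>\<in>T. X \<mu> i * X \<mu> j) else 0) + (\<Sum>j<n. (\<Sum>\<mu>\<in>T. X \<mu> i * X \<mu> j)\<^sup>2)"
      unfolding sum.distrib[symmetric] by (intro sum.cong refl) (simp add: power2_eq_square algebra_simps)
    also have "(\<Sum>j<n. if j = i then 1 - 2 * (\<Sum>\<mu>\<in>T. X \<mu> i * X \<mu> j) else 0) = 1 - 2 * (\<Sum>\<mu>\<in>T. (X \<mu> i)\<^sup>2)"
      using that by (simp add: power2_eq_square)
    also have "(\<Sum>j<n. (\<Sum>\<mu>\<in>T. X \<mu> i * X \<mu> j)\<^sup>2) = (\<Sum>j<n. \<Sum>\<mu>\<in>T. \<Sum>\<nu>\<in>T. X \<mu> i * X \<nu> i * (X \<mu> j * X \<nu> j))"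
      unfolding power2_eq_square sum_product by (simp add: mult_ac)
    also have "\<dots> = (\<Sum>\<mu>\<in>T. \<Sum>\<nu>\<in>T. \<Sum>j<n. X \<mu> i * X \<nu> i * (X \<mu> j * X \<nu> j))"
      by (subst sum.swap, intro sum.cong refl, subst sum.swap) simp
    also have "\<dots> = (\<Sum>\<mu>\<in>T. \<Sum>\<nu>\<in>T. X \<mu> i * X \<nu> i * (if \<mu> = \<nu> then 1 else 0))"
      by (intro sum.cong refl) (simp add: orth[symmetric] ip_def sum_distrib_left)
    also have "\<dots> = (\<Sum>\<mu>\<in>T. (X \<mu> i)\<^sup>2)"
      using T by (simp add: if_distrib power2_eq_square cong: if_cong)
    finally show ?thesis by simp
  qed
  then have "(\<Sum>i<n. \<Sum>\<mu>\<in>T. (X \<mu> i)\<^sup>2) \<le> (\<Sum>i<n. 1)" by (intro sum_mono) auto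
  moreover have "(\<Sum>i<n. \<Sum>\<mu>\<in>T. (X \<mu> i)\<^sup>2) = (\<Sum>\<mu>\<in>T. ip n (X \<mu>) (X \<mu>))"
    unfolding ip_def power2_eq_square by (rule sum.swap)
  ultimately show False using T X by simp
qed

text \<open>Finiteness of the spectrum gives \<open>Max\<close> its meaning; the Rayleigh bound
  shows that no eigenvalue exceeds the one of the Perron vector.\<close>

lemma spectral_radius_perron:
  assumes n: "n > 0" and g: "graph_on n G"
  obtains x where "\<And>i. 0 \<le> x i" "ip n x x = 1"
    "\<And>i. i < n \<Longrightarrow> mv n (adj_matrix G) x i = spectral_radius n G * x i"
    "\<And>y. ip n y (mv n (adj_matrix G) y) \<le> spectral_radius n G * ip n y y"
proof -
  have sym: "adj_matrix G i j = adj_matrix G j i" for i j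
    using g by (auto simp: adj_matrix_def graph_on_def)
  obtain x \<mu> where x: "\<And>i. 0 \<le> x i" "ip n x x = 1" "\<And>i. i < n \<Longrightarrow> mv n (adj_matrix G) x i = \<mu> * x i"
    "\<And>y. ip n y (mv n (adj_matrix G) y) \<le> \<mu> * ip n y y"
    by (rule perron_vector[OF n sym]) (simp add: adj_matrix_def, rule that)
  have "spectral_radius n G = \<mu>" unfolding spectral_radius_def
  proof (rule Max_eqI)
    show "finite {\<mu>. is_eigenvalue n (adj_matrix G) \<mu>}" using finite_eigenvalues sym by blast
    show "\<mu> \<in> {\<mu>. is_eigenvalue n (adj_matrix G) \<mu>}"
      using x ip_eq_0_iff[of n x] unfolding is_eigenvalue_def mv_def by auto
    fix \<nu> assume "\<nu> \<in> {\<mu>. is_eigenvalue n (adj_matrix G) \<mu>}"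
    then obtain y where y: "\<exists>i<n. y i \<noteq> 0" "\<And>i. i < n \<Longrightarrow> mv n (adj_matrix G) y i = \<nu> * y i"
      unfolding is_eigenvalue_def mv_def by blast
    have "ip n y (mv n (adj_matrix G) y) = \<nu> * ip n y y"
      using y(2) by (simp add: ip_scale[symmetric] cong: ip_cong)
    moreover have "ip n y y > 0" using y(1) ip_nonneg[of n y] ip_eq_0_iff[of n y] by force
    ultimately show "\<nu> \<le> \<mu>" using x(4)[of y] by simp
  qed
  then show thesis using that x by metis
qed

lemma spectral_radius_ge:
  assumes "n > 0" "graph_on n G"
  shows "ip n y (mv n (adj_matrix G) y) \<le> spectral_radius n G * ip n y y"
  using spectral_radius_perron[OF assms] by metis

lemma spectral_radius_attained:
  assumes "n > 0" "graph_on n G" "ip n y (mv n (adj_matrix G) y) = spectral_radius n G * ip n y y" "i < n"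
  shows "mv n (adj_matrix G) y i = spectral_radius n G * y i"
proof (rule rayleigh_maximizer_eigenvector[OF _ spectral_radius_ge[OF assms(1,2)] assms(3,4)])
  show "adj_matrix G i j = adj_matrix G j i" for i j
    using assms(2) by (auto simp: adj_matrix_def graph_on_def)
qed

section \<open>Invariance of the spectral radius under isomorphism\<close>

lemma isomorphic_sym: "isomorphic n G H \<Longrightarrow> isomorphic n H G"
proof -
  assume "isomorphic n G H"
  then obtain f where f: "bij_betw f {..<n} {..<n}" "\<And>u v. u < n \<Longrightarrow> v < n \<Longrightarrow> G u v \<longleftrightarrow> H (f u) (f v)"
    unfolding isomorphic_def by blast
  let ?g = "inv_into {..<n} f"
  have g: "bij_betw ?g {..<n} {..<n}" using f(1) by (rule bij_betw_inv_into)
  have "H u v \<longleftrightarrow> G (?g u) (?g v)" if "u < n" "v < n" for u v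
    using f(2)[of "?g u" "?g v"] that f(1) g bij_betw_inv_into_right[OF f(1)] bij_betwE[OF g] by auto
  then show ?thesis using g unfolding isomorphic_def by blast
qed

lemma is_eigenvalue_isomorphic:
  assumes "isomorphic n G H" "is_eigenvalue n (adj_matrix H) \<mu>"
  shows "is_eigenvalue n (adj_matrix G) \<mu>"
proof -
  obtain f where f: "bij_betw f {..<n} {..<n}" "\<And>u v. u < n \<Longrightarrow> v < n \<Longrightarrow> G u v \<longleftrightarrow> H (f u) (f v)"
    using assms(1) unfolding isomorphic_def by blast
  obtain x where x: "\<exists>i<n. x i \<noteq> 0" "\<And>i. i < n \<Longrightarrow> (\<Sum>j<n. adj_matrix H i j * x j) = \<mu> * x i"
    using assms(2) unfolding is_eigenvalue_def by blast
  have fn: "f i < n" if "i < n" for i using f(1) that bij_betwE by blast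
  have "\<exists>i<n. x (f i) \<noteq> 0" using x(1) f(1) by (metis bij_betw_iff_bijections lessThan_iff)
  moreover have "(\<Sum>j<n. adj_matrix G i j * x (f j)) = \<mu> * x (f i)" if "i < n" for i
  proof -
    have "(\<Sum>j<n. adj_matrix G i j * x (f j)) = (\<Sum>j<n. adj_matrix H (f i) (f j) * x (f j))"
      using f(2) that by (intro sum.cong) (auto simp: adj_matrix_def)
    also have "\<dots> = (\<Sum>j<n. adj_matrix H (f i) j * x j)"
      by (rule sum.reindex_bij_betw[OF f(1)])
    finally show ?thesis using x(2) fn that by simp
  qed
  ultimately show ?thesis unfolding is_eigenvalue_def by (intro exI[of _ "x \<circ> f"]) auto
qed

lemma spectral_radius_isomorphic: "isomorphic n G H \<Longrightarrow> spectral_radius n G = spectral_radius n H"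
  unfolding spectral_radius_def
  by (intro arg_cong[where f = Max] Collect_cong iffI) (auto intro: is_eigenvalue_isomorphic isomorphic_sym)

section \<open>Fans over linear forests\<close>

text \<open>The offset of the k-th path: \<open>psum ls k + j\<close> is the j-th vertex of that
  path, and \<open>index_exists\<close> and \<open>index_unique\<close> make \<open>(k, j)\<close> a
  coordinate system.\<close>

abbreviation psum :: "nat list \<Rightarrow> nat \<Rightarrow> nat" where
  "psum ls k \<equiv> sum_list (take k ls)"

lemma psum_Suc: "k < length ls \<Longrightarrow> psum ls (Suc k) = psum ls k + ls ! k"
  by (simp add: take_Suc_conv_app_nth)

lemma psum_mono: "k \<le> k' \<Longrightarrow> psum ls k \<le> psum ls k'"
  by (metis le_add1 le_add_diff_inverse sum_list_append take_add)

lemma psum_le: "psum ls k \<le> sum_list ls"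
  by (metis append_take_drop_id le_add1 sum_list_append)

lemma psum_add_less: "k < length ls \<Longrightarrow> j < ls ! k \<Longrightarrow> psum ls k + j < sum_list ls"
  using psum_Suc[of k ls] psum_le[of "Suc k" ls] by linarith

lemma index_exists:
  assumes "x < sum_list ls"
  obtains k j where "k < length ls" "j < ls ! k" "x = psum ls k + j"
proof -
  have "x < sum_list ls \<Longrightarrow> \<exists>k j. k < length ls \<and> j < ls ! k \<and> x = psum ls k + j"
  proof (induction ls rule: rev_induct)
    case (snoc a ls)
    show ?case
    proof (cases "x < sum_list ls")
      case True
      then obtain k j where "k < length ls" "j < ls ! k" "x = psum ls k + j" using snoc.IH by blast
      then show ?thesis by (intro exI[of _ k] exI[of _ j]) (auto simp: nth_append)
    next
      case False
      then show ?thesis using snoc.prems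
        by (intro exI[of _ "length ls"] exI[of _ "x - sum_list ls"]) auto
    qed
  qed simp
  then show thesis using assms that by blast
qed

lemma index_unique:
  assumes "k < length ls" "j < ls ! k" "k' < length ls" "j' < ls ! k'" "psum ls k + j = psum ls k' + j'"
  shows "k = k'" "j = j'"
proof -
  have "\<not> a < b" if "a < length ls" "i < ls ! a" "psum ls a + i = psum ls b + i'" for a b i i'
    using psum_mono[of "Suc a" b ls] psum_Suc[of a ls] that by (auto simp: Suc_le_eq)
  from this[OF assms(1,2,5)] this[OF assms(3,4) assms(5)[symmetric]] show "k = k'" by simp
  then show "j = j'" using assms by simp
qed

lemma paths_unionE:
  assumes "paths_union ls x y"
  obtains k i j where "k < length ls" "i < ls ! k" "j < ls ! k" "x = psum ls k + i" "y = psum ls k + j"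
    "j = Suc i \<or> i = Suc j"
proof -
  from assms obtain k where k: "k < length ls" "psum ls k \<le> x" "psum ls k \<le> y" "x < psum ls k + ls ! k"
    "y < psum ls k + ls ! k" "y = x + 1 \<or> x = y + 1" unfolding paths_union_def by blast
  show thesis by (rule that[of k "x - psum ls k" "y - psum ls k"]) (use k in auto)
qed

lemma paths_union_iff:
  assumes "k < length ls" "j < ls ! k" "k' < length ls" "j' < ls ! k'"
  shows "paths_union ls (psum ls k + j) (psum ls k' + j') \<longleftrightarrow> k = k' \<and> (j' = Suc j \<or> j = Suc j')"
proof
  assume "paths_union ls (psum ls k + j) (psum ls k' + j')"
  then obtain m a b where m: "m < length ls" "a < ls ! m" "b < ls ! m" "psum ls k + j = psum ls m + a"
     "psum ls k' + j' = psum ls m + b" "b = Suc a \<or> a = Suc b" by (rule paths_unionE)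
  show "k = k' \<and> (j' = Suc j \<or> j = Suc j')"
    using index_unique[OF assms(1,2) m(1,2,4)] index_unique[OF assms(3,4) m(1,3,5)] m(6) by auto
next
  assume "k = k' \<and> (j' = Suc j \<or> j = Suc j')"
  then show "paths_union ls (psum ls k + j) (psum ls k' + j')"
    unfolding paths_union_def using assms by (intro exI[of _ k]) auto
qed

lemma concat_nth:
  assumes "k < length xss" "j < length (xss ! k)"
  shows "concat xss ! (psum (map length xss) k + j) = xss ! k ! j"
  using assms
proof (induction xss arbitrary: k)
  case (Cons xs xss)
  then show ?case by (cases k) (auto simp: nth_append)
qed simp

text \<open>Allows arbitrary path lengths, so that the claimed extremal graph can be compared with
  its competitors. Vertex 0 is the hub; position \<open>x\<close> on the paths is vertex
  \<open>Suc x\<close>.\<close>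

definition fan :: "nat \<Rightarrow> nat list \<Rightarrow> nat \<Rightarrow> nat \<Rightarrow> bool" where
  "fan n ls u v \<longleftrightarrow> u < n \<and> v < n \<and>
     ((u = 0 \<and> v \<noteq> 0) \<or> (v = 0 \<and> u \<noteq> 0) \<or> (u \<noteq> 0 \<and> v \<noteq> 0 \<and> paths_union ls (u - 1) (v - 1)))"

lemma K1_join_H_OP_eq_fan: "K1_join_H_OP n n1 n2 = fan n (H_OP_list n n1 n2)"
  by (intro ext) (simp add: K1_join_H_OP_def fan_def)

lemma paths_union_sym: "paths_union ls x y \<Longrightarrow> paths_union ls y x"
  unfolding paths_union_def by blast

lemma paths_union_consecutive: "paths_union ls x y \<Longrightarrow> y = Suc x \<or> x = Suc y"
  unfolding paths_union_def by auto

lemma graph_on_fan: "graph_on n (fan n ls)"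
  unfolding graph_on_def fan_def using paths_union_sym paths_union_consecutive by fastforce

text \<open>Straight edges, with the hub at the origin and the other vertices at height 1. The
  drawing lies in the convex strip between heights 0 and 1, so everything above and below the strip
  is outside, and every vertex is on the boundary of the strip.\<close>

lemma outerplanar_fan: "outerplanar n (fan n ls)"
proof -
  define pos :: "nat \<Rightarrow> real^2" where "pos v = vector [real v, if v = 0 then 0 else 1]" for v
  define \<gamma> where "\<gamma> e = linepath (pos (Min e)) (pos (Max e))" for e
  have pos: "pos v $ 1 = real v" "pos v $ 2 = (if v = 0 then 0 else 1)" for v by (simp_all add: pos_def)
  have inj: "pos u = pos v \<longleftrightarrow> u = v" for u v using pos(1) by (metis of_nat_eq_iff)
  have eqI: "p = pos v" if "p $ 1 = real v" "p $ 2 = (if v = 0 then 0 else 1)" for p v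
    using that pos by (simp add: vec_eq_iff forall_2)
  have edge: "(\<exists>i. e = {0, i} \<and> 0 < i) \<or> (\<exists>i. e = {i, Suc i} \<and> 0 < i)" if e: "e \<in> edges_of n (fan n ls)" for e
  proof -
    obtain u v where uv: "e = {u, v}" "fan n ls u v" using e by (auto simp: edges_of_def)
    consider "u = 0" "v \<noteq> 0" | "v = 0" "u \<noteq> 0" | "u \<noteq> 0" "v \<noteq> 0" "v - 1 = Suc (u - 1) \<or> u - 1 = Suc (v - 1)"
      using uv(2) paths_union_consecutive unfolding fan_def by blast
    then show ?thesis
    proof cases
      case 3
      then have "v = Suc u \<or> u = Suc v" by auto
      then show ?thesis using uv 3 by (auto simp: insert_commute)
    qed (use uv in \<open>auto simp: insert_commute\<close>)
  qed
  have spoke: "p $ 1 = real i * p $ 2 \<and> 0 \<le> p $ 2 \<and> p $ 2 \<le> 1" if p: "p \<in> path_image (\<gamma> {0, i})" for p i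
  proof -
    obtain s where "0 \<le> s" "s \<le> 1" "p = (1 - s) *\<^sub>R pos 0 + s *\<^sub>R pos i"
      using p by (auto simp: \<gamma>_def closed_segment_def)
    then show ?thesis by (auto simp: pos)
  qed
  have rim: "p $ 2 = 1 \<and> real i \<le> p $ 1 \<and> p $ 1 \<le> real i + 1" if p: "p \<in> path_image (\<gamma> {i, Suc i})" "0 < i" for p i
  proof -
    obtain s where s: "0 \<le> s" "s \<le> 1" "p = (1 - s) *\<^sub>R pos i + s *\<^sub>R pos (Suc i)"
      using p by (auto simp: \<gamma>_def closed_segment_def)
    have "p $ 1 = (1 - s) * real i + s * real (Suc i)" "p $ 2 = 1"
      unfolding s(3) using p(2) by (simp_all add: pos)
    then show ?thesis using s(1,2) by (simp add: algebra_simps)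
  qed
  have spoke_spoke: "path_image (\<gamma> {0, i}) \<inter> path_image (\<gamma> {0, j}) \<subseteq> pos ` ({0, i} \<inter> {0, j})" if "i \<noteq> j" for i j
  proof
    fix p assume "p \<in> path_image (\<gamma> {0, i}) \<inter> path_image (\<gamma> {0, j})"
    then have "p $ 1 = real i * p $ 2" "p $ 1 = real j * p $ 2" using spoke by auto
    then have "p $ 2 = 0" "p $ 1 = 0" using that by auto
    then have "p = pos 0" by (intro eqI) auto
    then show "p \<in> pos ` ({0, i} \<inter> {0, j})" by blast
  qed
  have spoke_rim: "path_image (\<gamma> {0, i}) \<inter> path_image (\<gamma> {j, Suc j}) \<subseteq> pos ` ({0, i} \<inter> {j, Suc j})"
    if "0 < i" "0 < j" for i j
  proof
    fix p assume "p \<in> path_image (\<gamma> {0, i}) \<inter> path_image (\<gamma> {j, Suc j})"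
    then have p: "p $ 1 = real i" "p $ 2 = 1" "real j \<le> p $ 1" "p $ 1 \<le> real j + 1"
      using spoke[of p i] rim[of p j] that by auto
    then have "i = j \<or> i = Suc j" by linarith
    moreover have "p = pos i" using p that by (intro eqI) auto
    ultimately show "p \<in> pos ` ({0, i} \<inter> {j, Suc j})" by blast
  qed
  have rim_rim: "path_image (\<gamma> {i, Suc i}) \<inter> path_image (\<gamma> {j, Suc j}) \<subseteq> pos ` ({i, Suc i} \<inter> {j, Suc j})"
    if "0 < i" "i < j" for i j
  proof
    fix p assume "p \<in> path_image (\<gamma> {i, Suc i}) \<inter> path_image (\<gamma> {j, Suc j})"
    then have p: "p $ 2 = 1" "p $ 1 \<le> real i + 1" "real j \<le> p $ 1"
      using rim[of p i] rim[of p j] that by auto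
    then have "j = Suc i" "p $ 1 = real j" using that by linarith+
    moreover have "p = pos j" using p calculation by (intro eqI) auto
    ultimately show "p \<in> pos ` ({i, Suc i} \<inter> {j, Suc j})" by blast
  qed
  let ?S = "pos ` {..<n} \<union> (\<Union>e\<in>edges_of n (fan n ls). path_image (\<gamma> e))"
  have strip: "?S \<subseteq> {p. 0 \<le> p $ 2 \<and> p $ 2 \<le> 1}"
  proof
    fix p assume "p \<in> ?S"
    then consider v where "p = pos v" | e where "e \<in> edges_of n (fan n ls)" "p \<in> path_image (\<gamma> e)" by blast
    then show "p \<in> {p. 0 \<le> p $ 2 \<and> p $ 2 \<le> 1}"
    proof cases
      case 1
      then show ?thesis by (simp add: pos)
    next
      case 2
      from edge[OF 2(1)] show ?thesis
        using 2(2) spoke[of p] rim[of p] by (elim disjE exE conjE) auto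
    qed
  qed
  have "convex ((\<lambda>p :: real^2. p $ 2) -` {0..1})"
    by (intro convex_linear_vimage linearI) auto
  then have "convex {p :: real^2. 0 \<le> p $ 2 \<and> p $ 2 \<le> 1}" by (simp add: vimage_def)
  then have out: "p \<in> outside ?S" if "p $ 2 < 0 \<or> p $ 2 > 1" for p
    using convex_in_outside[of _ p] outside_mono[OF strip] that by fastforce
  have front: "pos v \<in> frontier (outside ?S)" if "v < n" for v
  proof -
    have "pos v \<in> ?S" using that by auto
    then have "pos v \<notin> outside ?S" using outside_no_overlap[of ?S] by blast
    moreover have "pos v \<in> closure (outside ?S)"
    proof (unfold closure_approachable, intro allI impI)
      fix e :: real assume e: "0 < e"
      \<comment> \<open>The vertex moved vertically off the strip: downwards for the hub, upwards
        for the others.\<close>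
      let ?y = "pos v + (if v = 0 then - (e / 2) else e / 2) *\<^sub>R axis 2 1"
      have "?y \<in> outside ?S" using e by (intro out) (auto simp: pos)
      moreover have "dist ?y (pos v) < e" using e by (simp add: dist_norm)
      ultimately show "\<exists>y\<in>outside ?S. dist y (pos v) < e" by blast
    qed
    ultimately show ?thesis using interior_subset by (auto simp: frontier_def)
  qed
  show ?thesis unfolding outerplanar_def
  proof (intro exI[of _ pos] exI[of _ \<gamma>] conjI allI impI ballI)
    show "inj_on pos {..<n}" by (auto simp: inj_on_def inj)
    fix u v assume "fan n ls u v"
    then have "u \<noteq> v" using graph_on_fan graph_onD by blast
    then show "arc (\<gamma> {u, v})" by (auto simp: \<gamma>_def inj min_def max_def intro!: arc_linepath)
    show "pathstart (\<gamma> {u, v}) = pos u \<and> pathfinish (\<gamma> {u, v}) = pos v \<or>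
        pathstart (\<gamma> {u, v}) = pos v \<and> pathfinish (\<gamma> {u, v}) = pos u"
      by (auto simp: \<gamma>_def min_def max_def)
  next
    fix e f assume ef: "e \<in> edges_of n (fan n ls)" "f \<in> edges_of n (fan n ls)" "e \<noteq> f"
    from edge[OF ef(1)] edge[OF ef(2)]
    show "path_image (\<gamma> e) \<inter> path_image (\<gamma> f) \<subseteq> pos ` (e \<inter> f)"
    proof (elim disjE exE conjE)
      fix i j assume "e = {0, i}" "f = {0, j}"
      then show ?thesis using spoke_spoke[of i j] ef by auto
    next
      fix i j assume "e = {0, i}" "0 < i" "f = {j, Suc j}" "0 < j"
      then show ?thesis using spoke_rim[of i j] by auto
    next
      fix i j assume "e = {i, Suc i}" "0 < i" "f = {0, j}" "0 < j"
      then show ?thesis using spoke_rim[of j i] by (simp add: Int_commute)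
    next
      fix i j assume "e = {i, Suc i}" "0 < i" "f = {j, Suc j}" "0 < j"
      then show ?thesis using rim_rim[of i j] rim_rim[of j i] ef
        by (cases i j rule: linorder_cases) (simp_all add: Int_commute)
    qed
  next
    fix e assume e: "e \<in> edges_of n (fan n ls)"
    show "path_image (\<gamma> e) \<inter> pos ` {..<n} \<subseteq> pos ` e"
    proof
      fix p assume "p \<in> path_image (\<gamma> e) \<inter> pos ` {..<n}"
      then obtain v where v: "p = pos v" "pos v \<in> path_image (\<gamma> e)" by blast
      from edge[OF e] have "v \<in> e"
      proof (elim disjE exE conjE)
        fix i assume "e = {0, i}"
        then show ?thesis using v(2) spoke[of "pos v" i] by (auto simp: pos split: if_splits)
      next
        fix i assume "e = {i, Suc i}" "0 < i"
        then show ?thesis using v(2) rim[of "pos v" i] by (auto simp: pos split: if_splits)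
      qed
      then show "p \<in> pos ` e" using v by blast
    qed
  next
    fix v assume "v < n"
    then show "pos v \<in> frontier (outside ?S)" by (rule front)
  qed
qed

section \<open>The spectral radius of a fan\<close>

text \<open>For r + 1/r = \<rho>, the solution on a path with a vertices of the eigenvalue equation with value
  \<rho> - 2 at the hub; the positions 0 and a + 1 are virtual.\<close>

definition path_profile :: "real \<Rightarrow> nat \<Rightarrow> nat \<Rightarrow> real" where
  "path_profile r a i = 1 - (r ^ i + r ^ (a + 1 - i)) / (1 + r ^ (a + 1))"

text \<open>The function g of the overview. Up to the factor \<open>2 * r / (1 - r)\<close> it is
  the amount by which the profile of a path sums to less than the number of its vertices
  (\<open>sum_path_profile\<close>).\<close>

definition path_defect :: "real \<Rightarrow> nat \<Rightarrow> real" where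
  "path_defect r a = (1 - r ^ a) / (1 + r ^ (a + 1))"

lemma path_profile_0: "0 < r \<Longrightarrow> path_profile r a 0 = 0"
proof -
  assume "0 < r"
  then have "1 + r ^ (a + 1) \<noteq> 0" by (metis add_pos_pos less_irrefl zero_less_one zero_less_power)
  then show ?thesis by (simp add: path_profile_def)
qed

lemma path_profile_end: "0 < r \<Longrightarrow> path_profile r a (Suc a) = 0"
proof -
  assume "0 < r"
  then have "1 + r ^ (a + 1) \<noteq> 0" by (metis add_pos_pos less_irrefl zero_less_one zero_less_power)
  then show ?thesis by (simp add: path_profile_def add.commute)
qed

text \<open>The constant 1 is a particular solution for hub value \<open>\<rho> - 2\<close>; the
  powers \<open>r ^ i\<close> and \<open>r ^ (a + 1 - i)\<close> solve the homogeneous recurrence,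
  since \<open>r\<close> is a root of \<open>x^2 - \<rho> x + 1\<close>.\<close>

lemma path_profile_recurrence:
  assumes r: "0 < r" "\<rho> * r = 1 + r\<^sup>2" and j: "j < a"
  shows "\<rho> * path_profile r a (Suc j) = (\<rho> - 2) + path_profile r a j + path_profile r a (Suc (Suc j))"
proof -
  define m where "m = a - Suc j"
  have e: "a + 1 - Suc j = Suc m" "a + 1 - j = Suc (Suc m)" "a + 1 - Suc (Suc j) = m" using j by (auto simp: m_def)
  have p: "\<rho> * r ^ Suc i = r ^ i + r ^ Suc (Suc i)" for i
  proof -
    have "\<rho> * r ^ Suc i = (\<rho> * r) * r ^ i" by simp
    also have "\<dots> = r ^ i + r ^ Suc (Suc i)" unfolding r(2) by (simp add: power2_eq_square algebra_simps)
    finally show ?thesis .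
  qed
  have "\<rho> * ((r ^ Suc j + r ^ Suc m) / (1 + r ^ (a + 1))) =
     (r ^ j + r ^ Suc (Suc m)) / (1 + r ^ (a + 1)) + (r ^ Suc (Suc j) + r ^ m) / (1 + r ^ (a + 1))"
    unfolding times_divide_eq_right ring_distribs p by (simp add: add_divide_distrib)
  then show ?thesis unfolding path_profile_def e by (simp only: right_diff_distrib)
qed

lemma sum_path_profile:
  assumes "0 < r" "r < 1"
  shows "(\<Sum>j<a. path_profile r a (Suc j)) = real a - 2 * r / (1 - r) * path_defect r a"
proof -
  have 1: "(\<Sum>j<a. r ^ Suc j) = r * (1 - r ^ a) / (1 - r)"
    using assms sum_gp_strict[of r a] by (simp add: sum_distrib_left[symmetric])
  have "(\<Sum>j<a. r ^ (a + 1 - Suc j)) = (\<Sum>j<a. r ^ Suc (a - Suc j))"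
    by (intro sum.cong) (auto simp: Suc_diff_Suc)
  also have "\<dots> = (\<Sum>j<a. r ^ Suc j)" by (rule sum.nat_diff_reindex)
  finally have 2: "(\<Sum>j<a. r ^ (a + 1 - Suc j)) = (\<Sum>j<a. r ^ Suc j)" .
  have "(\<Sum>j<a. path_profile r a (Suc j)) = real a - (\<Sum>j<a. r ^ Suc j + r ^ (a + 1 - Suc j)) / (1 + r ^ (a + 1))"
    by (simp add: path_profile_def sum_subtractf sum_divide_distrib)
  also have "(\<Sum>j<a. r ^ Suc j + r ^ (a + 1 - Suc j)) = 2 * (r * (1 - r ^ a) / (1 - r))"
    unfolding sum.distrib 2 1 by simp
  finally show ?thesis by (simp add: path_defect_def)
qed

text \<open>The hub value \<open>\<rho> - 2\<close> normalises the vector so that entries far from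
  the ends of a path are close to 1. The equations on the paths hold for every \<open>ls\<close>;
  only the hub equation ties \<open>\<rho>\<close> to the path lengths.\<close>

definition fan_vec :: "real \<Rightarrow> real \<Rightarrow> nat list \<Rightarrow> nat \<Rightarrow> real" where
  "fan_vec \<rho> r ls v = (if v = 0 then \<rho> - 2
     else concat (map (\<lambda>a. map (\<lambda>j. path_profile r a (Suc j)) [0..<a]) ls) ! (v - 1))"

lemma fan_vec_index:
  assumes "k < length ls" "j < ls ! k"
  shows "fan_vec \<rho> r ls (Suc (psum ls k + j)) = path_profile r (ls ! k) (Suc j)"
proof -
  let ?f = "\<lambda>a. map (\<lambda>j. path_profile r a (Suc j)) [0..<a]"
  have "map length (map ?f ls) = ls" by (simp add: comp_def)
  then show ?thesis using concat_nth[of k "map ?f ls" j] assms by (simp add: fan_vec_def del: map_map)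
qed

lemma mv_fan_path:
  assumes r: "0 < r" "\<rho> * r = 1 + r\<^sup>2" and x: "x < sum_list ls"
  shows "mv (Suc (sum_list ls)) (adj_matrix (fan (Suc (sum_list ls)) ls)) (fan_vec \<rho> r ls) (Suc x) = \<rho> * fan_vec \<rho> r ls (Suc x)"
proof -
  let ?N = "sum_list ls" and ?y = "fan_vec \<rho> r ls"
  obtain k j where kj: "k < length ls" "j < ls ! k" "x = psum ls k + j" using index_exists[OF x] .
  let ?a = "ls ! k"
  let ?I = "{i. i < ?a \<and> (i = Suc j \<or> j = Suc i)}"
  have set_eq: "{w. w < ?N \<and> paths_union ls x w} = (\<lambda>i. psum ls k + i) ` ?I" (is "?A = ?B")
  proof
    show "?A \<subseteq> ?B"
    proof
      fix w assume w: "w \<in> ?A"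
      then obtain k' i where i: "k' < length ls" "i < ls ! k'" "w = psum ls k' + i" using index_exists by blast
      then have "k = k' \<and> (i = Suc j \<or> j = Suc i)" using w kj paths_union_iff[OF kj(1,2) i(1,2)] by simp
      then show "w \<in> ?B" using i by blast
    qed
    show "?B \<subseteq> ?A"
      using paths_union_iff[OF kj(1,2) kj(1)] kj psum_add_less[OF kj(1)] by auto
  qed
  have "(\<Sum>w<?N. adj_matrix (fan (Suc ?N) ls) (Suc x) (Suc w) * ?y (Suc w)) = (\<Sum>w\<in>?A. ?y (Suc w))"
    using x by (intro sum.mono_neutral_cong_right) (auto simp: adj_matrix_def fan_def)
  also have "\<dots> = (\<Sum>i\<in>?I. ?y (Suc (psum ls k + i)))"
    unfolding set_eq by (subst sum.reindex) (auto simp: inj_on_def)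
  also have "\<dots> = (\<Sum>i\<in>?I. path_profile r ?a (Suc i))"
    using kj by (intro sum.cong refl fan_vec_index) auto
  also have "\<dots> = path_profile r ?a j + path_profile r ?a (Suc (Suc j))"
  proof -
    \<comment> \<open>A neighbour missing at an end of the path does not disturb the recurrence,
      because the profile vanishes at the virtual positions 0 and \<open>a + 1\<close>.\<close>
    have I: "?I = (if j = 0 then {} else {j - 1}) \<union> (if Suc j < ?a then {Suc j} else {})"
      using kj by (auto split: if_splits)
    have "(\<Sum>i\<in>?I. path_profile r ?a (Suc i)) = (if j = 0 then 0 else path_profile r ?a j)
        + (if Suc j < ?a then path_profile r ?a (Suc (Suc j)) else 0)"
      unfolding I by (subst sum.union_disjoint) auto
    moreover have "Suc j = ?a" if "\<not> Suc j < ?a" using that kj by simp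
    ultimately show ?thesis using path_profile_0[OF r(1), of ?a] path_profile_end[OF r(1), of ?a] by auto
  qed
  finally have "mv (Suc ?N) (adj_matrix (fan (Suc ?N) ls)) ?y (Suc x) = (\<rho> - 2) + path_profile r ?a j + path_profile r ?a (Suc (Suc j))"
    unfolding mv_def sum.lessThan_Suc_shift using x by (simp add: adj_matrix_def fan_def[of _ _ _ 0] fan_vec_def)
  also have "\<dots> = \<rho> * path_profile r ?a (Suc j)" using path_profile_recurrence[OF r kj(2)] by simp
  finally show ?thesis using fan_vec_index[OF kj(1,2)] kj(3) by simp
qed

lemma mv_fan_hub:
  "mv (Suc (sum_list ls)) (adj_matrix (fan (Suc (sum_list ls)) ls)) x 0 = (\<Sum>w<sum_list ls. x (Suc w))"
  unfolding mv_def sum.lessThan_Suc_shift by (simp add: adj_matrix_def fan_def)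

lemma sum_fan_vec:
  assumes "0 < r" "r < 1"
  shows "(\<Sum>w<sum_list ls. fan_vec \<rho> r ls (Suc w)) = real (sum_list ls) - 2 * r / (1 - r) * (\<Sum>a\<leftarrow>ls. path_defect r a)"
proof -
  let ?f = "\<lambda>a. map (\<lambda>j. path_profile r a (Suc j)) [0..<a]"
  have len: "length (concat (map ?f ls)) = sum_list ls" by (simp add: length_concat comp_def)
  have "(\<Sum>w<sum_list ls. fan_vec \<rho> r ls (Suc w)) = sum_list (concat (map ?f ls))"
    unfolding sum_list_sum_nth len by (simp add: fan_vec_def atLeast0LessThan)
  also have "\<dots> = (\<Sum>a\<leftarrow>ls. \<Sum>j<a. path_profile r a (Suc j))"
    by (induction ls) (auto simp: interv_sum_list_conv_sum_set_nat atLeast0LessThan)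
  also have "\<dots> = real (sum_list ls) - 2 * r / (1 - r) * (\<Sum>a\<leftarrow>ls. path_defect r a)"
  proof -
    have "(\<Sum>a\<leftarrow>ls. real a - c * f a) = real (sum_list ls) - c * (\<Sum>a\<leftarrow>ls. f a)" for c f
      by (induction ls) (auto simp: algebra_simps)
    then show ?thesis unfolding sum_path_profile[OF assms] .
  qed
  finally show ?thesis .
qed

text \<open>\<open>fan_vec\<close> fails the eigenvalue equation at the hub at most, so only
  \<open>x 0\<close> multiplies the error.\<close>

lemma ip_fan_vec:
  assumes r: "0 < r" "r < 1" "\<rho> * r = 1 + r\<^sup>2" and n: "n = Suc (sum_list ls)"
  shows "ip n x (mv n (adj_matrix (fan n ls)) (fan_vec \<rho> r ls)) = \<rho> * ip n x (fan_vec \<rho> r ls) +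
     x 0 * (real (sum_list ls) - 2 * r / (1 - r) * (\<Sum>a\<leftarrow>ls. path_defect r a) - \<rho> * (\<rho> - 2))"
proof -
  have 0: "fan_vec \<rho> r ls 0 = \<rho> - 2" by (simp add: fan_vec_def)
  have "(\<Sum>i<sum_list ls. x (Suc i) * mv n (adj_matrix (fan n ls)) (fan_vec \<rho> r ls) (Suc i))
      = (\<Sum>i<sum_list ls. \<rho> * (x (Suc i) * fan_vec \<rho> r ls (Suc i)))"
    unfolding n by (intro sum.cong refl) (simp add: mv_fan_path[OF r(1,3)])
  then show ?thesis unfolding ip_def n sum.lessThan_Suc_shift mv_fan_hub sum_fan_vec[OF r(1,2)] 0
    by (simp add: sum_distrib_left[symmetric] algebra_simps)
qed

text \<open>Pairing \<open>fan_vec\<close> with the Perron vector \<open>x\<close> and using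
  symmetry, \<open>x 0\<close> times the hub error is 0. If \<open>x 0\<close> were 0, the hub
  equation would force all other entries to vanish.\<close>

lemma fan_radius_equation:
  assumes r: "0 < r" "r < 1" "\<rho> * r = 1 + r\<^sup>2" and n: "n = Suc (sum_list ls)"
    and lam: "\<rho> = spectral_radius n (fan n ls)"
  shows "real (sum_list ls) - 2 * r / (1 - r) * (\<Sum>a\<leftarrow>ls. path_defect r a) = \<rho> * (\<rho> - 2)"
proof -
  let ?A = "adj_matrix (fan n ls)"
  have n0: "n > 0" using n by simp
  obtain x where x: "\<And>i. 0 \<le> x i" "ip n x x = 1" "\<And>i. i < n \<Longrightarrow> mv n ?A x i = \<rho> * x i"
    using spectral_radius_perron[OF n0 graph_on_fan[of n ls]] unfolding lam by metis
  have sym: "?A i j = ?A j i" for i j using graph_onD[OF graph_on_fan[of n ls]] by (auto simp: adj_matrix_def)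
  have "x 0 \<noteq> 0"
  proof
    assume x0: "x 0 = 0"
    then have "(\<Sum>w<sum_list ls. x (Suc w)) = 0" using x(3)[OF n0] mv_fan_hub[of ls x] n by simp
    then have "\<forall>w<sum_list ls. x (Suc w) = 0" using x(1) by (subst (asm) sum_nonneg_eq_0_iff) auto
    then have "\<forall>i<n. x i = 0" using x0 n by (metis Suc_less_eq not0_implies_Suc)
    then show False using x(2) ip_eq_0_iff[of n x] by simp
  qed
  moreover have "ip n x (mv n ?A (fan_vec \<rho> r ls)) = \<rho> * ip n x (fan_vec \<rho> r ls)"
  proof -
    have "ip n x (mv n ?A (fan_vec \<rho> r ls)) = ip n (mv n ?A x) (fan_vec \<rho> r ls)" by (rule ip_mv_symmetric[OF sym])
    also have "\<dots> = ip n (fan_vec \<rho> r ls) (\<lambda>i. \<rho> * x i)"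
      using x(3) by (simp add: ip_commute[of n "fan_vec \<rho> r ls"] cong: ip_cong)
    finally show ?thesis by (simp add: ip_scale ip_commute)
  qed
  ultimately show ?thesis using ip_fan_vec[OF r n, of x] by simp
qed

text \<open>The test vector takes its paths from \<open>ls'\<close> but \<open>\<rho>\<close> and
  \<open>r\<close> from \<open>ls\<close>. By the radius equation for \<open>ls\<close>, a smaller
  defect sum means a positive error at the hub, whose entry \<open>\<rho> - 2\<close> is positive;
  so the Rayleigh quotient exceeds \<open>\<rho>\<close>.\<close>

lemma fan_radius_less:
  assumes r: "0 < r" "r < 1" "\<rho> * r = 1 + r\<^sup>2" and n: "n = Suc (sum_list ls)"
    and lam: "\<rho> = spectral_radius n (fan n ls)" "\<rho> > 2"
    and eq: "sum_list ls' = sum_list ls" and less: "(\<Sum>a\<leftarrow>ls'. path_defect r a) < (\<Sum>a\<leftarrow>ls. path_defect r a)"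
  shows "\<rho> < spectral_radius n (fan n ls')"
proof (rule ccontr)
  assume "\<not> ?thesis"
  then have le: "spectral_radius n (fan n ls') \<le> \<rho>" by simp
  let ?y = "fan_vec \<rho> r ls'"
  have n': "n = Suc (sum_list ls')" using n eq by simp
  have "2 * r / (1 - r) * (\<Sum>a\<leftarrow>ls'. path_defect r a) < 2 * r / (1 - r) * (\<Sum>a\<leftarrow>ls. path_defect r a)"
    using r less by (intro mult_strict_left_mono) auto
  then have "0 < real (sum_list ls') - 2 * r / (1 - r) * (\<Sum>a\<leftarrow>ls'. path_defect r a) - \<rho> * (\<rho> - 2)"
    using fan_radius_equation[OF r n lam(1)] eq by simp
  moreover have "?y 0 = \<rho> - 2" by (simp add: fan_vec_def)
  ultimately have "\<rho> * ip n ?y ?y < ip n ?y (mv n (adj_matrix (fan n ls')) ?y)"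
    unfolding ip_fan_vec[OF r n', of ?y] using lam(2) by simp
  also have "\<dots> \<le> spectral_radius n (fan n ls') * ip n ?y ?y"
    by (rule spectral_radius_ge[OF _ graph_on_fan]) (simp add: n)
  also have "\<dots> \<le> \<rho> * ip n ?y ?y" using le ip_nonneg by (intro mult_right_mono)
  finally show False by simp
qed

lemma small_root_exists:
  assumes "(\<rho>::real) > 2"
  obtains r where "0 < r" "r < 1" "\<rho> * r = 1 + r\<^sup>2"
proof -
  let ?s = "sqrt (\<rho>\<^sup>2 - 4)"
  have "4 < \<rho>\<^sup>2" using power_strict_mono[of 2 \<rho> 2] assms by simp
  then have s: "?s\<^sup>2 = \<rho>\<^sup>2 - 4" "?s > 0" by auto
  have "?s < \<rho>" using assms by (intro real_less_lsqrt) (auto simp: power2_eq_square)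
  moreover have "\<rho> - 2 < ?s" using assms by (intro real_less_rsqrt) (auto simp: power2_eq_square algebra_simps)
  moreover have "\<rho> * ((\<rho> - ?s) / 2) = 1 + ((\<rho> - ?s) / 2)\<^sup>2"
  proof -
    have "((\<rho> - t) / 2)\<^sup>2 = (\<rho>\<^sup>2 - 2 * \<rho> * t + t\<^sup>2) / 4" for t
      by (simp add: power2_eq_square field_simps)
    then have "((\<rho> - ?s) / 2)\<^sup>2 = (\<rho>\<^sup>2 - 2 * \<rho> * ?s + (\<rho>\<^sup>2 - 4)) / 4" by (simp only: s(1))
    moreover have "\<rho> * ((\<rho> - t) / 2) = 1 + (\<rho>\<^sup>2 - 2 * \<rho> * t + (\<rho>\<^sup>2 - 4)) / 4" for t
      by (simp add: power2_eq_square field_simps)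
    ultimately show ?thesis by simp
  qed
  ultimately show thesis by (intro that[of "(\<rho> - ?s) / 2"]) auto
qed

section \<open>Strict concavity of the path defect\<close>

text \<open>Closed form of the increment of \<open>path_defect\<close> from \<open>a\<close> to
  \<open>a + 1\<close>; strict concavity is its strict decrease.\<close>

definition defect_step :: "real \<Rightarrow> nat \<Rightarrow> real" where
  "defect_step r a = r ^ a * (1 - r\<^sup>2) / ((1 + r ^ (a + 1)) * (1 + r ^ (a + 2)))"

lemma path_defect_Suc:
  assumes "0 < r"
  shows "path_defect r (Suc a) = path_defect r a + defect_step r a"
proof -
  have p: "1 + r ^ i > 0" for i using assms by (simp add: add_pos_pos)
  have "(1 - r ^ Suc a) * (1 + r ^ (a + 1)) - (1 - r ^ a) * (1 + r ^ (a + 2)) = r ^ a * (1 - r\<^sup>2)"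
    by (simp add: power2_eq_square algebra_simps)
  moreover have "path_defect r (Suc a) - path_defect r a =
     ((1 - r ^ Suc a) * (1 + r ^ (a + 1)) - (1 - r ^ a) * (1 + r ^ (a + 2))) / ((1 + r ^ (a + 1)) * (1 + r ^ (a + 2)))"
    using p[of "a + 1"] p[of "a + 2"] unfolding path_defect_def
    by (subst diff_frac_eq) (auto simp: mult_ac)
  ultimately show ?thesis by (simp add: defect_step_def)
qed

lemma defect_step_pos: "0 < r \<Longrightarrow> r < 1 \<Longrightarrow> 0 < defect_step r a"
  unfolding defect_step_def by (intro divide_pos_pos mult_pos_pos) (auto simp: add_pos_pos power_less_one_iff)

text \<open>After cancelling common factors the claim is
  \<open>r * (1 + r ^ (a + 1)) < 1 + r ^ (a + 3)\<close>, that is,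
  \<open>(1 - r) * (1 - r ^ (a + 2)) > 0\<close>.\<close>

lemma defect_step_Suc_less:
  assumes "0 < r" "r < 1"
  shows "defect_step r (Suc a) < defect_step r a"
proof -
  have p: "1 + r ^ i > 0" for i using assms by (simp add: add_pos_pos)
  have r2: "0 < 1 - r\<^sup>2" using assms by (simp add: power_less_one_iff)
  have "r ^ (a + 2) < 1" using assms power_Suc_less_one[of r "a + 1"] by simp
  then have "r ^ (a + 2) * (1 - r) < 1 * (1 - r)"
    using assms by (intro mult_strict_right_mono) auto
  then have "r * (1 + r ^ (a + 1)) < 1 + r ^ (a + 3)" by (simp add: algebra_simps eval_nat_numeral)
  moreover have "r * U / (Y * W) < U / (X * Y)"
    if "r * X < W" "0 < X" "0 < Y" "0 < W" "0 < U" for X Y W U :: real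
  proof -
    have "r / W < 1 / X" using that by (simp add: field_simps)
    then have "U / Y * (r / W) < U / Y * (1 / X)" using that by (intro mult_strict_left_mono) auto
    then show ?thesis by (simp add: mult_ac)
  qed
  ultimately have "r * (r ^ a * (1 - r\<^sup>2)) / ((1 + r ^ (a + 2)) * (1 + r ^ (a + 3)))
      < r ^ a * (1 - r\<^sup>2) / ((1 + r ^ (a + 1)) * (1 + r ^ (a + 2)))"
    using p assms r2 by (metis mult_pos_pos zero_less_power)
  then show ?thesis by (simp add: defect_step_def numeral_3_eq_3 mult_ac)
qed

lemma defect_step_strict_antimono:
  assumes "0 < r" "r < 1" "a < b"
  shows "defect_step r b < defect_step r a"
  using assms(3)
proof (induction b)
  case (Suc b)
  then show ?case using defect_step_Suc_less[OF assms(1,2), of b] by (cases "a = b") auto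
qed simp

text \<open>Vertices are moved one at a time; each adds an increment at the longer path that is
  smaller than the one it removes at the shorter path.\<close>

lemma path_defect_exchange:
  assumes r: "0 < r" "r < 1" and "b \<le> a" "1 \<le> c" "c \<le> b"
  shows "path_defect r (a + c) + path_defect r (b - c) < path_defect r a + path_defect r b"
  using assms(4,5)
proof (induction c rule: nat_induct_at_least)
  case base
  then have "b = Suc (b - 1)" by simp
  then have "path_defect r b = path_defect r (b - 1) + defect_step r (b - 1)" using path_defect_Suc[OF r(1)] by metis
  then show ?case using path_defect_Suc[OF r(1), of a] defect_step_strict_antimono[OF r, of "b - 1" a] assms(3) base by simp
next
  case (Suc c)
  then have "b - c = Suc (b - Suc c)" by simp
  then have "path_defect r (b - c) = path_defect r (b - Suc c) + defect_step r (b - Suc c)" using path_defect_Suc[OF r(1)] by metis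
  moreover have "b - Suc c < a + c" using assms(3) Suc by linarith
  then have "defect_step r (a + c) < defect_step r (b - Suc c)" by (rule defect_step_strict_antimono[OF r])
  ultimately show ?case using path_defect_Suc[OF r(1), of "a + c"] Suc by simp
qed

lemma path_defect_0: "path_defect r 0 = 0"
  by (simp add: path_defect_def)

lemma path_defect_less_1: "0 < r \<Longrightarrow> path_defect r a < 1"
proof -
  assume "0 < r"
  then have "0 < r ^ a" "0 < r ^ (a + 1)" by simp_all
  then show ?thesis by (simp add: path_defect_def)
qed

lemma path_defect_nonneg: "0 < r \<Longrightarrow> r < 1 \<Longrightarrow> 0 \<le> path_defect r a"
  unfolding path_defect_def by (intro divide_nonneg_pos) (auto simp: power_le_one add_pos_pos)

text \<open>The defect is a sum of \<open>c\<close> decreasing increments, all at least as large as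
  the next one.\<close>

lemma defect_step_le_defect:
  assumes "0 < r" "r < 1"
  shows "real c * defect_step r c \<le> path_defect r c"
proof (induction c)
  case (Suc c)
  have "real (Suc c) * defect_step r (Suc c) \<le> real (Suc c) * defect_step r c"
    using defect_step_Suc_less[OF assms, of c] by (intro mult_left_mono) auto
  also have "\<dots> = real c * defect_step r c + defect_step r c" by (simp add: algebra_simps)
  also have "\<dots> \<le> path_defect r (Suc c)" using Suc path_defect_Suc[OF assms(1), of c] by simp
  finally show ?case .
qed (simp add: path_defect_0)

text \<open>Concavity with value 0 at 0: the defect per vertex does not increase with the length of
  the path.\<close>

lemma path_defect_chord:
  assumes r: "0 < r" "r < 1" and "c \<le> m"
  shows "real c * path_defect r m \<le> real m * path_defect r c"
  using assms(3)
proof (induction m rule: dec_induct)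
  case (step m)
  have "real c * defect_step r m \<le> path_defect r c"
  proof -
    have "defect_step r m \<le> defect_step r c"
      using defect_step_strict_antimono[OF r, of c m] step by (cases "c = m") auto
    then have "real c * defect_step r m \<le> real c * defect_step r c" by (intro mult_left_mono) auto
    then show ?thesis using defect_step_le_defect[OF r, of c] by linarith
  qed
  then show ?case using step path_defect_Suc[OF r(1), of m] by (simp add: algebra_simps)
qed simp

section \<open>Starlike trees in fans\<close>

lemma contains_subgraph_isomorphic:
  assumes "isomorphic n G H" "contains_subgraph n G k F"
  shows "contains_subgraph n H k F"
proof -
  obtain f where f: "bij_betw f {..<n} {..<n}" "\<And>u v. u < n \<Longrightarrow> v < n \<Longrightarrow> G u v \<longleftrightarrow> H (f u) (f v)"
    using assms(1) unfolding isomorphic_def by blast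
  obtain g where g: "inj_on g {..<k}" "g ` {..<k} \<subseteq> {..<n}" "\<And>i j. i < k \<Longrightarrow> j < k \<Longrightarrow> F i j \<Longrightarrow> G (g i) (g j)"
    using assms(2) unfolding contains_subgraph_def by blast
  have "inj_on (f \<circ> g) {..<k}"
    using g f(1) by (intro comp_inj_on) (auto simp: bij_betw_def intro: inj_on_subset)
  moreover have "(f \<circ> g) ` {..<k} \<subseteq> {..<n}"
    using g(2) f(1) by (force simp: bij_betw_def)
  moreover have "H ((f \<circ> g) i) ((f \<circ> g) j)" if "i < k" "j < k" "F i j" for i j
    using g(2,3) f(2)[of "g i" "g j"] that by (simp add: image_subset_iff)
  ultimately show ?thesis unfolding contains_subgraph_def by blast
qed

definition path_graph :: "nat \<Rightarrow> nat \<Rightarrow> nat \<Rightarrow> bool" where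
  "path_graph k i j \<longleftrightarrow> i < k \<and> j < k \<and> (j = Suc i \<or> i = Suc j)"

lemma div_mod_less_double:
  assumes "(w::nat) < 2 * q"
  shows "w div q = (if w < q then 0 else 1)" "w mod q = (if w < q then w else w - q)"
  using assms by (auto simp: div_nat_eqI le_mod_geq)

lemma starlike_tree_1: "l \<ge> 2 \<Longrightarrow> starlike_tree 1 l = path_graph l"
proof -
  assume l: "l \<ge> 2"
  have "starlike_arc 1 l u v \<longleftrightarrow> u < l \<and> v = Suc u \<and> v < l" for u v
  proof (cases "u < l \<and> v < l")
    case True
    have "(w - 1) mod (l - 1) = w - 1" "(w - 1) div (l - 1) = 0" if "w < l" for w using that l by auto
    then show ?thesis unfolding starlike_arc_def using True by auto
  qed (use l in \<open>auto simp: starlike_arc_def\<close>)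
  then show ?thesis by (intro ext) (auto simp: starlike_tree_def path_graph_def)
qed

text \<open>\<open>\<sigma>\<close> reverses the first branch together with the centre: the centre 0
  goes to position \<open>l - 1\<close>, next to the first vertex \<open>l\<close> of the second
  branch, which stays in place.\<close>

lemma starlike_tree_2:
  assumes "l \<ge> 2"
  defines "\<sigma> \<equiv> \<lambda>x. if x \<le> l - 1 then l - 1 - x else x"
  shows "starlike_tree 2 l u v \<longleftrightarrow> u < 2 * l - 1 \<and> v < 2 * l - 1 \<and> path_graph (2 * l - 1) (\<sigma> u) (\<sigma> v)"
proof -
  define q where "q = l - 1"
  have q: "l = Suc q" "q \<ge> 1" using assms(1) by (auto simp: q_def)
  have arc: "starlike_arc 2 l u v \<longleftrightarrow> u < 2 * q + 1 \<and> v < 2 * q + 1 \<and>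
     ((u = 0 \<and> (v = 1 \<or> v = Suc q)) \<or> (1 \<le> u \<and> v = Suc u \<and> u \<noteq> q))" for u v
  proof (cases "u < 2 * q + 1 \<and> v < 2 * q + 1")
    case True
    then have *: "v - 1 < 2 * q" "u - 1 < 2 * q" using q by auto
    have 1: "1 \<le> v \<and> (v - 1) mod q = 0 \<longleftrightarrow> v = 1 \<or> v = Suc q"
      unfolding div_mod_less_double(2)[OF *(1)] using q by auto
    have 2: "1 \<le> u \<and> v = u + 1 \<and> (u - 1) div q = (v - 1) div q \<longleftrightarrow> 1 \<le> u \<and> v = Suc u \<and> u \<noteq> q"
      unfolding div_mod_less_double(1)[OF *(1)] div_mod_less_double(1)[OF *(2)] using q by auto
    show ?thesis unfolding starlike_arc_def using True 1 2 by (simp add: q(1) mult_2)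
  qed (auto simp: starlike_arc_def q)
  have k: "2 * l - 1 = 2 * q + 1" "l - 1 = q" using q by auto
  show ?thesis unfolding starlike_tree_def arc path_graph_def \<sigma>_def k using q(2)
    by (cases "u \<le> q"; cases "v \<le> q") auto
qed

lemma contains_starlike_tree_12:
  assumes "t = 1 \<or> t = 2" "l \<ge> 2"
  shows "contains_subgraph n G (t * (l - 1) + 1) (starlike_tree t l) \<longleftrightarrow>
    contains_subgraph n G (t * (l - 1) + 1) (path_graph (t * (l - 1) + 1))"
proof (cases "t = 1")
  case True
  then show ?thesis using starlike_tree_1[OF assms(2)] assms(2) by simp
next
  case False
  then have t: "t = 2" using assms by simp
  have k: "2 * (l - 1) + 1 = 2 * l - 1" using assms(2) by simp
  let ?\<sigma> = "\<lambda>x. if x \<le> l - 1 then l - 1 - x else x"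
  have iso: "isomorphic (2 * l - 1) (starlike_tree 2 l) (path_graph (2 * l - 1))"
    unfolding isomorphic_def
  proof (intro exI[of _ ?\<sigma>] conjI allI impI)
    show "bij_betw ?\<sigma> {..<2 * l - 1} {..<2 * l - 1}"
      by (rule bij_betwI[where g = ?\<sigma>]) (use assms(2) in auto)
  qed (use starlike_tree_2[OF assms(2)] in auto)
  have trans: "contains_subgraph n G m F'"
    if iso': "isomorphic m F F'" "contains_subgraph n G m F" for m F F'
  proof -
    obtain h where h: "bij_betw h {..<m} {..<m}" "\<And>u v. u < m \<Longrightarrow> v < m \<Longrightarrow> F' u v \<longleftrightarrow> F (h u) (h v)"
      using isomorphic_sym[OF iso'(1)] unfolding isomorphic_def by blast
    obtain g where g: "inj_on g {..<m}" "g ` {..<m} \<subseteq> {..<n}" "\<And>i j. i < m \<Longrightarrow> j < m \<Longrightarrow> F i j \<Longrightarrow> G (g i) (g j)"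
      using iso'(2) unfolding contains_subgraph_def by blast
    have hm: "h i < m" if "i < m" for i using h(1) that bij_betwE by blast
    have "inj_on (g \<circ> h) {..<m}"
      using g(1) h(1) by (intro comp_inj_on) (auto simp: bij_betw_def)
    moreover have "(g \<circ> h) ` {..<m} \<subseteq> {..<n}" using g(2) hm by auto
    moreover have "G ((g \<circ> h) i) ((g \<circ> h) j)" if "i < m" "j < m" "F' i j" for i j
      using g(3)[of "h i" "h j"] h(2) hm that by simp
    ultimately show ?thesis unfolding contains_subgraph_def by blast
  qed
  show ?thesis unfolding t k using trans[OF iso] trans[OF isomorphic_sym[OF iso]] by blast
qed

section \<open>Paths in fans\<close>

definition comp_verts :: "nat list \<Rightarrow> nat \<Rightarrow> nat set" where
  "comp_verts ls k = (\<lambda>j. Suc (psum ls k + j)) ` {..<ls ! k}"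

lemma card_comp_verts: "card (comp_verts ls k) = ls ! k" "finite (comp_verts ls k)"
  unfolding comp_verts_def by (subst card_image) (auto simp: inj_on_def)

lemma in_comp_verts:
  assumes "0 < v" "v < Suc (sum_list ls)"
  obtains k where "k < length ls" "v \<in> comp_verts ls k"
proof -
  have "v - 1 < sum_list ls" using assms by auto
  then obtain k j where "k < length ls" "j < ls ! k" "v - 1 = psum ls k + j"
    by (rule index_exists)
  then show thesis using that[of k] assms(1) by (force simp: comp_verts_def)
qed

lemma fan_same_comp:
  assumes "fan n ls u v" "u \<noteq> 0" "v \<noteq> 0" "k < length ls" "u \<in> comp_verts ls k"
  shows "v \<in> comp_verts ls k"
proof -
  obtain j where j: "j < ls ! k" "u - 1 = psum ls k + j" using assms(5) by (auto simp: comp_verts_def)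
  have "paths_union ls (u - 1) (v - 1)" using assms by (auto simp: fan_def)
  then obtain k' i i' where k': "k' < length ls" "i < ls ! k'" "i' < ls ! k'" "u - 1 = psum ls k' + i"
    "v - 1 = psum ls k' + i'" by (rule paths_unionE)
  have "k = k'" using index_unique(1)[OF assms(4) j(1) k'(1,2)] j k' by simp
  moreover have "v = Suc (psum ls k' + i')" using k'(5) assms(3) by simp
  ultimately show ?thesis using k' by (auto simp: comp_verts_def)
qed

lemma fan_walk_same_comp:
  assumes "a < b" "\<And>i. a \<le> i \<Longrightarrow> i < b \<Longrightarrow> 0 < f i \<and> f i < Suc (sum_list ls)"
    "\<And>i. a \<le> i \<Longrightarrow> Suc i < b \<Longrightarrow> fan n ls (f i) (f (Suc i))"
  obtains k where "k < length ls" "f ` {a..<b} \<subseteq> comp_verts ls k"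
proof -
  obtain k where k: "k < length ls" "f a \<in> comp_verts ls k"
    using in_comp_verts[of "f a" ls] assms(1,2) by auto
  have "f (a + i) \<in> comp_verts ls k" if "a + i < b" for i
    using that
  proof (induction i)
    case (Suc i)
    then have "f (a + i) \<in> comp_verts ls k" by simp
    moreover have "fan n ls (f (a + i)) (f (Suc (a + i)))" using Suc.prems by (intro assms(3)) auto
    moreover have "f (a + i) \<noteq> 0" "f (Suc (a + i)) \<noteq> 0"
      using assms(2)[of "a + i"] assms(2)[of "Suc (a + i)"] Suc.prems by simp_all
    ultimately show ?case using fan_same_comp[OF _ _ _ k(1)] by simp
  qed (use k in simp)
  then have "f ` {a..<b} \<subseteq> comp_verts ls k" by (auto simp: le_iff_add)
  then show thesis using that k by blast
qed

text \<open>A path through the hub visits at most two components, so this says that the fan has no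
  path on \<open>s + 2\<close> vertices. The first clause is not implied by the second when there is
  only one component.\<close>

definition pair_bounded :: "nat \<Rightarrow> nat list \<Rightarrow> bool" where
  "pair_bounded s ls \<longleftrightarrow> (\<forall>i<length ls. ls ! i \<le> s) \<and> (\<forall>i<length ls. \<forall>j<length ls. i \<noteq> j \<longrightarrow> ls ! i + ls ! j \<le> s)"

text \<open>The hub occurs at most once on a path; what remains are at most two walks, each within
  one component, with at least \<open>s + 1\<close> vertices in all.\<close>

lemma fan_path_free:
  assumes pb: "pair_bounded s ls" and k: "k = s + 2" and n: "n = Suc (sum_list ls)"
  shows "\<not> contains_subgraph n (fan n ls) k (path_graph k)"
proof
  assume "contains_subgraph n (fan n ls) k (path_graph k)"
  then obtain f where f: "inj_on f {..<k}" "f ` {..<k} \<subseteq> {..<n}"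
    "\<And>i j. i < k \<Longrightarrow> j < k \<Longrightarrow> path_graph k i j \<Longrightarrow> fan n ls (f i) (f j)"
    unfolding contains_subgraph_def by blast
  have adj: "fan n ls (f i) (f (Suc i))" if "Suc i < k" for i
    using f(3)[of i "Suc i"] that by (simp add: path_graph_def)
  have bd: "f i < Suc (sum_list ls)" if "i < k" for i using f(2) that n by auto
  have one: "card (f ` A) \<le> s" if "finite A" "c < length ls" "f ` A \<subseteq> comp_verts ls c" for A c
  proof -
    have "card (f ` A) \<le> ls ! c" using card_mono[OF card_comp_verts(2) that(3)] card_comp_verts(1) by simp
    then show ?thesis using pb that(2) unfolding pair_bounded_def by (meson le_trans)
  qed
  have two: "card (f ` A \<union> f ` B) \<le> s"
    if "finite A" "finite B" "c < length ls" "d < length ls" "f ` A \<subseteq> comp_verts ls c" "f ` B \<subseteq> comp_verts ls d" for A B c d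
  proof (cases "c = d")
    case True
    then have "f ` (A \<union> B) \<subseteq> comp_verts ls c" using that by auto
    then show ?thesis using one[of "A \<union> B" c] that by (simp add: image_Un)
  next
    case False
    have "card (f ` A \<union> f ` B) \<le> card (f ` A) + card (f ` B)" by (rule card_Un_le)
    also have "\<dots> \<le> ls ! c + ls ! d"
      using card_mono[OF card_comp_verts(2) that(5)] card_mono[OF card_comp_verts(2) that(6)] card_comp_verts(1)
      by (intro add_mono) auto
    also have "\<dots> \<le> s" using pb False that unfolding pair_bounded_def by blast
    finally show ?thesis .
  qed
  have lower: "k \<le> card (f ` ({..<k} - {p})) + 1" for p
  proof -
    have "card (f ` ({..<k} - {p})) = card ({..<k} - {p})" by (rule card_image, rule inj_on_subset[OF f(1)]) auto
    then show ?thesis using k by (cases "p < k") (auto simp: card_Diff_singleton_if)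
  qed
  show False
  proof (cases "\<exists>p<k. f p = 0")
    case False
    then obtain c where c: "c < length ls" "f ` {0..<k} \<subseteq> comp_verts ls c"
      using fan_walk_same_comp[of 0 k f ls n] adj bd k by auto
    \<comment> \<open>Position \<open>k\<close> does not occur, so nothing is removed; this lets
      \<open>lower\<close> serve also when the path avoids the hub.\<close>
    have "card (f ` ({..<k} - {k})) \<le> s" using c by (intro one[of _ c]) (auto simp: atLeast0LessThan)
    then show False using lower[of k] k by simp
  next
    case True
    then obtain p where p: "p < k" "f p = 0" by blast
    have nz: "0 < f i" if "i < k" "i \<noteq> p" for i
      using f(1) p that by (metis inj_onD lessThan_iff neq0_conv)
    have split: "{..<k} - {p} = {0..<p} \<union> {Suc p..<k}" using p(1) by auto
    have A: "\<exists>c<length ls. f ` {a..<b} \<subseteq> comp_verts ls c" if ab: "a < b" "b \<le> k" "p \<notin> {a..<b}" for a b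
    proof -
      obtain c where "c < length ls" "f ` {a..<b} \<subseteq> comp_verts ls c"
        by (rule fan_walk_same_comp[of a b f ls n]) (use adj bd nz ab in auto)
      then show ?thesis by blast
    qed
    have "card (f ` {0..<p} \<union> f ` {Suc p..<k}) \<le> s"
    proof (cases "0 < p \<and> Suc p < k")
      case True
      then obtain c d where "c < length ls" "f ` {0..<p} \<subseteq> comp_verts ls c" "d < length ls" "f ` {Suc p..<k} \<subseteq> comp_verts ls d"
        using A[of 0 p] A[of "Suc p" k] p by auto
      then show ?thesis by (intro two) auto
    next
      case False
      then consider "p = 0" | "p > 0" "Suc p = k" using p by linarith
      then show ?thesis
      proof cases
        case 1
        then obtain c where "c < length ls" "f ` {Suc p..<k} \<subseteq> comp_verts ls c"
          using A[of "Suc p" k] k by auto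
        then show ?thesis using one[of "{Suc p..<k}" c] 1 by simp
      next
        case 2
        then obtain c where "c < length ls" "f ` {0..<p} \<subseteq> comp_verts ls c"
          using A[of 0 p] by auto
        then show ?thesis using one[of "{0..<p}" c] 2 by simp
      qed
    qed
    then have "card (f ` ({..<k} - {p})) \<le> s" unfolding split image_Un .
    then show False using lower[of p] k by simp
  qed
qed

lemma fan_contains_path:
  assumes n: "n = Suc (sum_list ls)" and i: "i < length ls" "p \<le> ls ! i"
    and j: "q = 0 \<or> j < length ls \<and> q \<le> ls ! j \<and> i \<noteq> j" and k: "k = p + q + 1"
  shows "contains_subgraph n (fan n ls) k (path_graph k)"
proof -
  define f where "f x = (if x < p then Suc (psum ls i + x) else if x = p then 0 else Suc (psum ls j + (x - p - 1)))" for x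
  have bd: "f x < n" if "x < k" for x
  proof -
    have "psum ls i + x < sum_list ls" if "x < p" using psum_add_less[OF i(1), of x] that i by simp
    moreover have "psum ls j + (x - p - 1) < sum_list ls" if "p < x"
      using psum_add_less[of j ls "x - p - 1"] that j \<open>x < k\<close> k by auto
    ultimately show ?thesis by (auto simp: f_def n)
  qed
  have "inj_on f {..<k}"
  proof (rule linorder_inj_onI')
    fix x y assume xy: "x \<in> {..<k}" "y \<in> {..<k}" "x < y"
    have "psum ls i + x \<noteq> psum ls j + (y - p - 1)" if "x < p" "p < y"
    proof -
      have "y - p - 1 < q" using xy k that by auto
      then have "y - p - 1 < ls ! j" "j < length ls" "i \<noteq> j" using j by auto
      then show ?thesis using index_unique(1)[of i ls x j "y - p - 1"] i that by auto
    qed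
    then show "f x \<noteq> f y" using xy(3) by (auto simp: f_def)
  qed
  moreover have "f ` {..<k} \<subseteq> {..<n}" using bd by auto
  moreover have step: "fan n ls (f x) (f (Suc x))" if "Suc x < k" for x
  proof -
    have "f x < n" "f (Suc x) < n" using bd that by auto
    moreover have "paths_union ls (psum ls i + x) (psum ls i + Suc x)" if "Suc x < p"
      using paths_union_iff[of i ls x i "Suc x"] i that by simp
    moreover have "paths_union ls (psum ls j + (x - p - 1)) (psum ls j + (Suc x - p - 1))" if "p < x"
      using paths_union_iff[of j ls "x - p - 1" j "Suc x - p - 1"] j k that \<open>Suc x < k\<close> by auto
    ultimately show ?thesis by (auto simp: f_def fan_def)
  qed
  moreover have "fan n ls (f (Suc x)) (f x)" if "Suc x < k" for x
    using step[OF that] graph_onD[OF graph_on_fan] by blast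
  ultimately show ?thesis unfolding contains_subgraph_def path_graph_def
    by (intro exI[of _ f]) auto
qed

lemma fan_path_free_pair_bounded:
  assumes n: "n = Suc (sum_list ls)" and k: "k = s + 2"
    and free: "\<not> contains_subgraph n (fan n ls) k (path_graph k)"
  shows "pair_bounded s ls"
  unfolding pair_bounded_def
proof (intro conjI allI impI; rule ccontr)
  fix i assume "i < length ls" "\<not> ls ! i \<le> s"
  then show False using fan_contains_path[OF n, of i "s + 1" 0 0 k] k free by auto
next
  fix i j assume ij: "i < length ls" "j < length ls" "i \<noteq> j" "\<not> ls ! i + ls ! j \<le> s"
  \<comment> \<open>As many vertices as possible from component \<open>i\<close>, at most
    \<open>s + 1\<close>; component \<open>j\<close> supplies the rest, so that the path has exactly
    \<open>k\<close> vertices.\<close>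
  define p where "p = min (ls ! i) (s + 1)"
  have "s + 1 - p \<le> ls ! j" "p \<le> ls ! i" "k = p + (s + 1 - p) + 1" using ij k by (auto simp: p_def)
  then show False using fan_contains_path[OF n, of i p "s + 1 - p" j k] ij free by auto
qed

section \<open>Starlike trees with at least four branches\<close>

lemma starlike_tree_branch:
  assumes "j < t" "Suc m < l - 1"
  shows "starlike_tree t l (Suc (j * (l - 1) + m)) (Suc (j * (l - 1) + Suc m))"
proof -
  have d: "(j * (l - 1) + r) div (l - 1) = j" if "r < l - 1" for r using that by simp
  have "(j * (l - 1) + m) div (l - 1) = j" "(j * (l - 1) + Suc m) div (l - 1) = j"
    by (rule d; use assms in linarith)+
  moreover have "j * (l - 1) + Suc m < t * (l - 1)"
    using mult_le_mono1[of "Suc j" t "l - 1"] assms by simp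
  ultimately show ?thesis unfolding starlike_tree_def starlike_arc_def by simp
qed

lemma starlike_tree_centre:
  assumes "j < t" "l \<ge> 2"
  shows "starlike_tree t l 0 (Suc (j * (l - 1)))"
proof -
  have "j * (l - 1) < t * (l - 1)" using assms by simp
  then show ?thesis unfolding starlike_tree_def starlike_arc_def by simp
qed

text \<open>A vertex other than the hub has at most three neighbours: the hub, its predecessor and
  its successor. So the centre is the hub, every branch lies in one component, and a component with
  \<open>a\<close> vertices has room for \<open>a div (l - 1)\<close> branches.\<close>

lemma fan_starlike_free:
  assumes n: "n = Suc (sum_list ls)" and t: "t \<ge> 4" and l: "l \<ge> 2"
    and less: "(\<Sum>a\<leftarrow>ls. a div (l - 1)) < t"
  shows "F_free n (fan n ls) (t * (l - 1) + 1) (starlike_tree t l)"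
  unfolding F_free_def
proof
  define q where "q = l - 1"
  have q: "q \<ge> 1" using l by (simp add: q_def)
  assume "contains_subgraph n (fan n ls) (t * (l - 1) + 1) (starlike_tree t l)"
  then obtain f where f: "inj_on f {..<t * q + 1}" "f ` {..<t * q + 1} \<subseteq> {..<n}"
    "\<And>i j. i < t * q + 1 \<Longrightarrow> j < t * q + 1 \<Longrightarrow> starlike_tree t l i j \<Longrightarrow> fan n ls (f i) (f j)"
    unfolding contains_subgraph_def q_def by blast
  have vb: "Suc (j * q + m) < t * q + 1" if "j < t" "m < q" for j m
    using mult_le_mono1[of "Suc j" t q] that by simp
  have f0: "f 0 = 0"
  proof (rule ccontr)
    assume "f 0 \<noteq> 0"
    \<comment> \<open>Four of the \<open>t\<close> neighbours of the centre already exceed the three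
      available places.\<close>
    have sub: "f ` (\<lambda>j. Suc (j * q)) ` {..<4} \<subseteq> {0, f 0 - 1, Suc (f 0)}"
    proof
      fix y assume "y \<in> f ` (\<lambda>j. Suc (j * q)) ` {..<4}"
      then obtain j where y: "j < 4" "y = f (Suc (j * q))" by auto
      then have j: "j < t" using t by simp
      have h: "fan n ls (f 0) y" unfolding y(2)
        using starlike_tree_centre[OF j l] vb[OF j, of 0] q by (intro f(3)) (auto simp: q_def)
      then have "y = 0 \<or> paths_union ls (f 0 - 1) (y - 1)"
        using \<open>f 0 \<noteq> 0\<close> by (auto simp: fan_def)
      then have "y = 0 \<or> y - 1 = Suc (f 0 - 1) \<or> f 0 - 1 = Suc (y - 1)" using paths_union_consecutive by blast
      then show "y \<in> {0, f 0 - 1, Suc (f 0)}" using \<open>f 0 \<noteq> 0\<close> by auto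
    qed
    have "inj_on f ((\<lambda>j. Suc (j * q)) ` {..<4})"
      by (rule inj_on_subset[OF f(1)]) (use vb[of _ 0] t q in auto)
    then have "card (f ` (\<lambda>j. Suc (j * q)) ` {..<4}) = card ((\<lambda>j. Suc (j * q)) ` {..<4::nat})"
      by (rule card_image)
    also have "\<dots> = 4" using q by (subst card_image) (auto simp: inj_on_def)
    finally have "4 \<le> card {0, f 0 - 1, Suc (f 0)}" using card_mono[OF _ sub] by simp
    moreover have "card {0, f 0 - 1, Suc (f 0)} \<le> 3" by (simp add: card_insert_if)
    ultimately show False by simp
  qed
  have pos: "0 < f i" if "0 < i" "i < t * q + 1" for i
    using f(1) f0 that by (metis inj_onD lessThan_iff neq0_conv order.strict_trans)
  have "\<exists>c<length ls. f ` {Suc (j * q)..<Suc (j * q) + q} \<subseteq> comp_verts ls c" if "j < t" for j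
  proof -
    have "0 < f i \<and> f i < Suc (sum_list ls)" if "Suc (j * q) \<le> i" "i < Suc (j * q) + q" for i
    proof -
      have "i < t * q + 1" using vb[OF \<open>j < t\<close>, of "i - Suc (j * q)"] that by auto
      then show ?thesis using pos[of i] f(2) n that by (auto simp: image_subset_iff)
    qed
    moreover have "fan n ls (f i) (f (Suc i))" if "Suc (j * q) \<le> i" "Suc i < Suc (j * q) + q" for i
    proof -
      define m where "m = i - Suc (j * q)"
      have m: "i = Suc (j * q + m)" "Suc m < q" using that by (auto simp: m_def)
      show ?thesis unfolding m(1)
        using starlike_tree_branch[of j t m l] vb[OF \<open>j < t\<close>, of m] vb[OF \<open>j < t\<close>, of "Suc m"] m(2) \<open>j < t\<close>
        by (intro f(3)) (auto simp: q_def)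
    qed
    ultimately obtain c where "c < length ls" "f ` {Suc (j * q)..<Suc (j * q) + q} \<subseteq> comp_verts ls c"
      using fan_walk_same_comp[of "Suc (j * q)" "Suc (j * q) + q" f ls n] q by auto
    then show ?thesis by blast
  qed
  then obtain c where c: "\<And>j. j < t \<Longrightarrow> c j < length ls"
    "\<And>j. j < t \<Longrightarrow> f ` {Suc (j * q)..<Suc (j * q) + q} \<subseteq> comp_verts ls (c j)" by metis
  have cnt: "card {j. j < t \<and> c j = k} \<le> ls ! k div q" for k
  proof -
    let ?J = "{j. j < t \<and> c j = k}"
    \<comment> \<open>The tree vertices on all branches assigned to component \<open>k\<close>:
      \<open>card ?J * q\<close> of them, within \<open>ls ! k\<close> places.\<close>
    let ?U = "(\<lambda>(j, m). Suc (j * q + m)) ` (?J \<times> {..<q})"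
    have inj: "inj_on (\<lambda>(j, m). Suc (j * q + m)) (?J \<times> {..<q})"
    proof (rule inj_onI)
      fix x y assume xy: "x \<in> ?J \<times> {..<q}" "y \<in> ?J \<times> {..<q}"
        "(case x of (j, m) \<Rightarrow> Suc (j * q + m)) = (case y of (j, m) \<Rightarrow> Suc (j * q + m))"
      obtain j m j' m' where e: "x = (j, m)" "y = (j', m')" by (metis surj_pair)
      then have m: "m < q" "m' < q" "j * q + m = j' * q + m'" using xy by auto
      have "(j * q + m) div q = (j' * q + m') div q" "(j * q + m) mod q = (j' * q + m') mod q"
        by (simp_all only: m(3))
      then show "x = y" using m(1,2) e by simp
    qed
    have Usub: "?U \<subseteq> {..<t * q + 1}" using vb by auto
    have "card (f ` ?U) = card ?U" by (rule card_image) (use inj_on_subset[OF f(1) Usub] in blast)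
    also have "\<dots> = card ?J * q" by (subst card_image[OF inj]) simp
    finally have 1: "card (f ` ?U) = card ?J * q" .
    have "f ` ?U \<subseteq> comp_verts ls k"
    proof
      fix y assume "y \<in> f ` ?U"
      then obtain j m where jm: "m < q" "j < t" "c j = k" "y = f (Suc (j * q + m))" by auto
      then show "y \<in> comp_verts ls k" using c(2)[of j] by (auto simp: image_subset_iff)
    qed
    from card_mono[OF card_comp_verts(2) this] have "card ?J * q \<le> ls ! k"
      unfolding 1 card_comp_verts(1) .
    then show ?thesis using q by (simp add: less_eq_div_iff_mult_less_eq)
  qed
  have "t = card (\<Union>k<length ls. {j. j < t \<and> c j = k})"
  proof -
    have "(\<Union>k<length ls. {j. j < t \<and> c j = k}) = {..<t}" using c(1) by auto
    then show ?thesis by simp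
  qed
  also have "\<dots> \<le> (\<Sum>k<length ls. card {j. j < t \<and> c j = k})" by (rule card_UN_le) simp
  also have "\<dots> \<le> (\<Sum>k<length ls. ls ! k div q)" by (intro sum_mono cnt)
  also have "\<dots> = (\<Sum>a\<leftarrow>ls. a div q)" by (simp add: sum_list_sum_nth atLeast0LessThan)
  finally show False using less by (simp add: q_def)
qed

text \<open>With the hub as centre, a component with \<open>a\<close> vertices is cut into
  \<open>a div (l - 1)\<close> blocks of \<open>l - 1\<close> consecutive vertices, each of which
  carries one branch.\<close>

lemma fan_starlike_free_div_bound:
  assumes n: "n = Suc (sum_list ls)" and l: "l \<ge> 2"
    and free: "F_free n (fan n ls) (t * (l - 1) + 1) (starlike_tree t l)"
  shows "(\<Sum>a\<leftarrow>ls. a div (l - 1)) < t"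
proof (rule ccontr)
  define q where "q = l - 1"
  have q: "q \<ge> 1" using l by (simp add: q_def)
  define ds where "ds = map (\<lambda>a. a div q) ls"
  assume "\<not> ?thesis"
  then have t: "t \<le> sum_list ds" by (simp add: ds_def q_def)
  have "\<exists>k s. k < length ls \<and> s < ls ! k div q \<and> j = psum ds k + s" if "j < t" for j
  proof -
    have "j < sum_list ds" using that t by simp
    then obtain k s where "k < length ds" "s < ds ! k" "j = psum ds k + s" by (rule index_exists)
    then show ?thesis by (intro exI[of _ k] exI[of _ s]) (simp add: ds_def)
  qed
  \<comment> \<open>Branch \<open>j\<close> goes to block \<open>S j\<close> of component
    \<open>K j\<close>; the blocks of all components are numbered consecutively, with offsets
    \<open>psum ds\<close>.\<close>
  then obtain K S where KS: "\<And>j. j < t \<Longrightarrow> K j < length ls" "\<And>j. j < t \<Longrightarrow> S j < ls ! K j div q"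
    "\<And>j. j < t \<Longrightarrow> j = psum ds (K j) + S j" by metis
  define f where "f x = (if x = 0 then 0 else
     Suc (psum ls (K ((x - 1) div q)) + (S ((x - 1) div q) * q + (x - 1) mod q)))" for x
  have dv: "y div q < t" if "y < t * q" for y using that q by (simp add: less_mult_imp_div_less)
  have off: "S j * q + m < ls ! K j" if "j < t" "m < q" for j m
  proof -
    have "Suc (S j) * q \<le> ls ! K j div q * q" using KS(2)[OF that(1)] by (intro mult_le_mono1) simp
    also have "\<dots> \<le> ls ! K j" by (rule div_times_less_eq_dividend)
    finally show ?thesis using that by simp
  qed
  have mq: "y mod q < q" for y using q by simp
  have bd: "f x < n" if "x < t * q + 1" for x
  proof (cases x)
    case (Suc y)
    then show ?thesis using psum_add_less[OF KS(1) off[OF _ mq], of "y div q" y] dv[of y] that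
      by (simp add: f_def n)
  qed (simp add: f_def n)
  have inj: "inj_on f {..<t * q + 1}"
  proof (rule inj_onI)
    fix x y assume xy: "x \<in> {..<t * q + 1}" "y \<in> {..<t * q + 1}" "f x = f y"
    show "x = y"
    proof (cases "x = 0 \<or> y = 0")
      case True
      then show ?thesis using xy(3) by (auto simp: f_def split: if_splits)
    next
      case False
      define a where "a = x - 1"
      define b where "b = y - 1"
      have ab: "a < t * q" "b < t * q" "x = Suc a" "y = Suc b" using False xy by (auto simp: a_def b_def)
      have e: "psum ls (K (a div q)) + (S (a div q) * q + a mod q) = psum ls (K (b div q)) + (S (b div q) * q + b mod q)"
        using xy(3) ab by (simp add: f_def)
      note u = index_unique[OF KS(1)[OF dv[OF ab(1)]] off[OF dv[OF ab(1)] mq] KS(1)[OF dv[OF ab(2)]] off[OF dv[OF ab(2)] mq] e]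
      have "(S (a div q) * q + a mod q) div q = (S (b div q) * q + b mod q) div q"
        "(S (a div q) * q + a mod q) mod q = (S (b div q) * q + b mod q) mod q" using u(2) by simp_all
      then have "S (a div q) = S (b div q)" "a mod q = b mod q" using q by simp_all
      moreover have "a div q = b div q" using KS(3)[OF dv[OF ab(1)]] KS(3)[OF dv[OF ab(2)]] u(1) calculation(1) by simp
      ultimately have "a = b" by (metis div_mult_mod_eq)
      then show ?thesis using ab by simp
    qed
  qed
  have arc: "fan n ls (f u) (f v)" if "starlike_arc t l u v" for u v
  proof -
    have uv: "u < t * q + 1" "v < t * q + 1"
      "(u = 0 \<and> 1 \<le> v) \<or> (1 \<le> u \<and> v = u + 1 \<and> (u - 1) div q = (v - 1) div q)"
      using that unfolding starlike_arc_def q_def by auto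
    from uv(3) show ?thesis
    proof
      assume "u = 0 \<and> 1 \<le> v"
      then show ?thesis using bd[OF uv(1)] bd[OF uv(2)] by (auto simp: fan_def f_def)
    next
      assume h: "1 \<le> u \<and> v = u + 1 \<and> (u - 1) div q = (v - 1) div q"
      define a where "a = u - 1"
      have a: "u = Suc a" "v = Suc (Suc a)" "a div q = Suc a div q" "Suc a < t * q" using h uv by (auto simp: a_def)
      have "Suc a mod q = Suc (a mod q)"
        using a(3) by (metis add_Suc_right add_left_cancel div_mult_mod_eq)
      moreover have "paths_union ls (psum ls (K (a div q)) + (S (a div q) * q + a mod q))
         (psum ls (K (a div q)) + (S (a div q) * q + Suc a mod q))"
        using off[OF dv mq, of a a] off[OF dv mq, of "Suc a" "Suc a"] KS(1)[OF dv, of a] a calculation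
        by (subst paths_union_iff) auto
      ultimately show ?thesis using bd[OF uv(1)] bd[OF uv(2)] a by (simp add: fan_def f_def)
    qed
  qed
  have "fan n ls (f u) (f v)" if "starlike_tree t l u v" for u v
    using that arc graph_onD[OF graph_on_fan] unfolding starlike_tree_def by blast
  then have "contains_subgraph n (fan n ls) (t * q + 1) (starlike_tree t l)"
    unfolding contains_subgraph_def using inj bd by (intro exI[of _ f]) auto
  then show False using free unfolding F_free_def q_def by simp
qed

section \<open>Reduction to fans\<close>

text \<open>Vertices outside the neighbourhood of \<open>u\<close> become leaves at
  \<open>u\<close>, while the edges inside the neighbourhood are kept; if \<open>u\<close> is
  adjacent to all other vertices, the graph is \<open>G\<close> itself.\<close>

definition hub_graph :: "nat \<Rightarrow> (nat \<Rightarrow> nat \<Rightarrow> bool) \<Rightarrow> nat \<Rightarrow> nat \<Rightarrow> nat \<Rightarrow> bool" where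
  "hub_graph n G u x y \<longleftrightarrow> x < n \<and> y < n \<and> x \<noteq> y \<and> (x = u \<or> y = u \<or> (G u x \<and> G u y \<and> G x y))"

lemma graph_on_hub_graph: "graph_on n G \<Longrightarrow> graph_on n (hub_graph n G u)"
  unfolding graph_on_def hub_graph_def by blast

lemma fan_isomorphic_hub_graph:
  assumes g: "graph_on n G" and u: "u < n"
    and d: "distinct (concat pss)" "set (concat pss) = {..<n} - {u}"
    and p: "\<And>ps. ps \<in> set pss \<Longrightarrow> successively (\<lambda>v w. G u v \<and> G u w \<and> G v w) ps"
    and e: "\<And>v w. G u v \<Longrightarrow> G u w \<Longrightarrow> G v w \<Longrightarrow> \<exists>ps\<in>set pss. \<exists>i. Suc i < length ps \<and>
        (ps ! i = v \<and> ps ! Suc i = w \<or> ps ! i = w \<and> ps ! Suc i = v)"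
  shows "n = Suc (sum_list (map length pss)) \<and> isomorphic n (fan n (map length pss)) (hub_graph n G u)"
proof
  let ?ls = "map length pss" and ?c = "concat pss"
  have len: "length ?c = sum_list ?ls" by (simp add: length_concat)
  have "length ?c = card ({..<n} - {u})" using d distinct_card by metis
  then show n: "n = Suc (sum_list ?ls)" using u len by simp
  define f where "f x = (if x = 0 then u else ?c ! (x - 1))" for x
  have c_in: "?c ! i < n" "?c ! i \<noteq> u" if "i < sum_list ?ls" for i
    using nth_mem[of i ?c] that d(2) len by auto
  have inj: "inj_on f {..<n}"
  proof (rule inj_onI)
    fix x y assume xy: "x \<in> {..<n}" "y \<in> {..<n}" "f x = f y"
    have lt: "z - 1 < sum_list ?ls" if "z \<in> {..<n}" "z \<noteq> 0" for z using that n by auto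
    show "x = y"
    proof (cases "x = 0 \<or> y = 0")
      case True
      then show ?thesis using xy c_in lt by (auto simp: f_def split: if_splits)
    next
      case False
      then have "x - 1 = y - 1" using xy lt[OF xy(1)] lt[OF xy(2)] d(1) len by (simp add: f_def nth_eq_iff_index_eq)
      then show ?thesis using False by arith
    qed
  qed
  have "f ` {..<n} \<subseteq> {..<n}" using c_in u n by (auto simp: f_def)
  then have bij: "bij_betw f {..<n} {..<n}"
    using inj by (simp add: bij_betw_def endo_inj_surj)
  have iff: "paths_union ?ls x y \<longleftrightarrow> G u (?c ! x) \<and> G u (?c ! y) \<and> G (?c ! x) (?c ! y)"
    if xy: "x < sum_list ?ls" "y < sum_list ?ls" for x y
  proof -
    obtain k i where ki: "k < length ?ls" "i < ?ls ! k" "x = psum ?ls k + i" using xy(1) by (rule index_exists)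
    obtain k' j where kj: "k' < length ?ls" "j < ?ls ! k'" "y = psum ?ls k' + j" using xy(2) by (rule index_exists)
    have cx: "?c ! x = pss ! k ! i" using concat_nth[of k pss i] ki by simp
    have cy: "?c ! y = pss ! k' ! j" using concat_nth[of k' pss j] kj by simp
    show ?thesis
    proof
      assume "paths_union ?ls x y"
      then have kk: "k = k'" "j = Suc i \<or> i = Suc j" using paths_union_iff[OF ki(1,2) kj(1,2)] ki kj by auto
      have s: "successively (\<lambda>v w. G u v \<and> G u w \<and> G v w) (pss ! k)" using p[of "pss ! k"] ki by simp
      show "G u (?c ! x) \<and> G u (?c ! y) \<and> G (?c ! x) (?c ! y)"
        unfolding cx cy using successively_nth[OF s, of i] successively_nth[OF s, of j] kk ki kj graph_onD[OF g] by auto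
    next
      assume h: "G u (?c ! x) \<and> G u (?c ! y) \<and> G (?c ! x) (?c ! y)"
      obtain ps m where pm: "ps \<in> set pss" "Suc m < length ps"
        "ps ! m = ?c ! x \<and> ps ! Suc m = ?c ! y \<or> ps ! m = ?c ! y \<and> ps ! Suc m = ?c ! x" using e h by blast
      obtain a where a: "a < length pss" "ps = pss ! a" using pm(1) by (metis in_set_conv_nth)
      have m: "psum ?ls a + m < sum_list ?ls" "psum ?ls a + Suc m < sum_list ?ls"
        using psum_add_less[of a ?ls m] psum_add_less[of a ?ls "Suc m"] a pm(2) by auto
      have "ps ! m = ?c ! (psum ?ls a + m)" "ps ! Suc m = ?c ! (psum ?ls a + Suc m)"
        using concat_nth[of a pss m] concat_nth[of a pss "Suc m"] a pm(2) by auto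
      then have "psum ?ls a + m = x \<and> psum ?ls a + Suc m = y \<or> psum ?ls a + m = y \<and> psum ?ls a + Suc m = x"
        using pm(3) d(1) m xy len by (metis nth_eq_iff_index_eq)
      then show "paths_union ?ls x y"
        using paths_union_iff[of a ?ls m a "Suc m"] paths_union_iff[of a ?ls "Suc m" a m] a pm(2) by auto
    qed
  qed
  have "fan n ?ls x y \<longleftrightarrow> hub_graph n G u (f x) (f y)" if xy: "x < n" "y < n" for x y
  proof (cases "x = 0 \<or> y = 0")
    case True
    have fz: "f z < n \<and> (z \<noteq> 0 \<longrightarrow> f z \<noteq> u)" if "z < n" for z
    proof (cases "z = 0")
      case False
      then have "z - 1 < sum_list ?ls" using that n by arith
      then show ?thesis using c_in False by (simp add: f_def)
    qed (simp add: f_def u)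
    have f0: "f 0 = u" by (simp add: f_def)
    show ?thesis using True fz[OF xy(1)] fz[OF xy(2)] f0 xy unfolding fan_def hub_graph_def by metis
  next
    case False
    then have lt: "x - 1 < sum_list ?ls" "y - 1 < sum_list ?ls" using xy n by arith+
    show ?thesis using False iff[OF lt] c_in[OF lt(1)] c_in[OF lt(2)] xy graph_onD[OF g]
      by (auto simp: fan_def hub_graph_def f_def)
  qed
  then show "isomorphic n (fan n ?ls) (hub_graph n G u)" using bij unfolding isomorphic_def by blast
qed

text \<open>The edges within the neighbourhood of \<open>u\<close> are viewed on all vertices but
  \<open>u\<close>, so the new leaves are components with one vertex. Degrees are at most 2, as
  neighbours within it are common neighbours with \<open>u\<close>.\<close>

lemma hub_graph_isomorphic_fan:
  assumes g: "graph_on n G" and op: "outerplanar n G" and u: "u < n"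
  obtains ls where "sorted_wrt (\<ge>) ls" "0 \<notin> set ls" "n = Suc (sum_list ls)" "isomorphic n (fan n ls) (hub_graph n G u)"
proof -
  note G = graph_onD[OF g]
  let ?H = "\<lambda>v w. G u v \<and> G u w \<and> G v w"
  let ?V = "{..<n} - {u}"
  have th: "theta_free G" using outerplanar_theta_free[OF g op] .
  have "\<exists>pss. distinct (concat pss) \<and> set (concat pss) = ?V \<and> [] \<notin> set pss \<and>
     (\<forall>ps\<in>set pss. successively ?H ps) \<and>
     (\<forall>v\<in>?V. \<forall>w\<in>?V. ?H v w \<longrightarrow> (\<exists>ps\<in>set pss. \<exists>i. Suc i < length ps \<and>
        (ps ! i = v \<and> ps ! Suc i = w \<or> ps ! i = w \<and> ps ! Suc i = v)))"
  proof (rule linear_forest_decomposition)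
    show "finite ?V" by simp
    show "?H w v" if "?H v w" for v w using that G by blast
    show "\<not> ?H v v" for v using G by blast
    show "card {w \<in> ?V. ?H v w} \<le> 2" if "v \<in> ?V" for v
    proof -
      have "finite {w. G u w \<and> G v w}" by (rule finite_subset[of _ "{..<n}"]) (use G in auto)
      then have "card {w \<in> ?V. ?H v w} \<le> card {w. G u w \<and> G v w}" by (rule card_mono) auto
      also have "\<dots> \<le> 2" using that by (intro theta_free_common_neighbours[OF g th]) auto
      finally show ?thesis .
    qed
    fix cs assume cs: "distinct cs" "3 \<le> length cs" "set cs \<subseteq> ?V" "successively ?H cs"
    show "\<not> ?H (last cs) (hd cs)"
    proof
      assume h: "?H (last cs) (hd cs)"
      have s: "successively G cs" using cs(4) by (rule successively_mono) auto
      have "G u v" if "v \<in> set cs" for v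
      proof -
        obtain i where i: "i < length cs" "v = cs ! i" using \<open>v \<in> set cs\<close> by (metis in_set_conv_nth)
        show ?thesis
        proof (cases "Suc i < length cs")
          case True
          then show ?thesis using successively_nth[OF cs(4) True] i by simp
        next
          case False
          then have "Suc (i - 1) = i" "Suc (i - 1) < length cs" using i cs(2) by auto
          then show ?thesis using successively_nth[OF cs(4), of "i - 1"] i by simp
        qed
      qed
      then show False using outerplanar_neighbourhood_acyclic[OF g op cs(1,2) _ s] h by blast
    qed
  qed
  then obtain pss where pss: "distinct (concat pss)" "set (concat pss) = ?V" "[] \<notin> set pss"
     "\<And>ps. ps \<in> set pss \<Longrightarrow> successively ?H ps"
     "\<And>v w. v \<in> ?V \<Longrightarrow> w \<in> ?V \<Longrightarrow> ?H v w \<Longrightarrow> (\<exists>ps\<in>set pss. \<exists>i. Suc i < length ps \<and>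
        (ps ! i = v \<and> ps ! Suc i = w \<or> ps ! i = w \<and> ps ! Suc i = v))" by blast
  \<comment> \<open>Components in order of decreasing length, which fixes the direction of later
    exchanges.\<close>
  define qss where "qss = rev (sort_key length pss)"
  have sq: "set qss = set pss" by (simp add: qss_def)
  have "mset qss = mset pss" by (simp add: qss_def)
  then have "mset (concat qss) = mset (concat pss)"
    unfolding mset_concat by (metis mset_map sum_mset_sum_list)
  then have dq: "distinct (concat qss)" "set (concat qss) = ?V"
    using pss(1,2) mset_eq_imp_distinct_iff mset_eq_setD by blast+
  have "n = Suc (sum_list (map length qss)) \<and> isomorphic n (fan n (map length qss)) (hub_graph n G u)"
  proof (rule fan_isomorphic_hub_graph[OF g u dq])
    show "successively ?H ps" if "ps \<in> set qss" for ps using pss(4) that sq by simp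
    fix v w assume "G u v" "G u w" "G v w"
    moreover have "v \<in> ?V" "w \<in> ?V" using calculation G by auto
    ultimately show "\<exists>ps\<in>set qss. \<exists>i. Suc i < length ps \<and>
        (ps ! i = v \<and> ps ! Suc i = w \<or> ps ! i = w \<and> ps ! Suc i = v)" using pss(5) sq by simp
  qed
  moreover have "sorted_wrt (\<ge>) (map length qss)"
    using sorted_sort_key[of length pss] by (simp add: qss_def rev_map[symmetric] sorted_wrt_rev)
  moreover have "0 \<notin> set (map length qss)" using pss(3) sq by auto
  ultimately show thesis using that by blast
qed

lemma hub_graph_contains_subgraph:
  assumes g: "graph_on n G" and u: "u < n" and k: "2 * k \<le> card {v. G u v}"
    and c: "contains_subgraph n (hub_graph n G u) k F"
  shows "contains_subgraph n G k F"
proof -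
  note G = graph_onD[OF g]
  obtain f where f: "inj_on f {..<k}" "f ` {..<k} \<subseteq> {..<n}"
    "\<And>i j. i < k \<Longrightarrow> j < k \<Longrightarrow> F i j \<Longrightarrow> hub_graph n G u (f i) (f j)"
    using c unfolding contains_subgraph_def by blast
  let ?N = "{v. G u v}"
  have finN: "finite ?N" by (rule finite_subset[of _ "{..<n}"]) (use G in auto)
  let ?I = "{i. i < k \<and> f i \<noteq> u \<and> \<not> G u (f i)}"
  have "card ?I \<le> k" using card_mono[of "{..<k}" ?I] by auto
  also have "k \<le> card ?N - card (f ` {..<k})"
    using k card_image[OF f(1)] by simp
  also have "\<dots> \<le> card (?N - f ` {..<k})" by (rule diff_card_le_card_Diff) simp
  finally obtain h where h: "h ` ?I \<subseteq> ?N - f ` {..<k}" "inj_on h ?I"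
    using card_le_inj[of ?I "?N - f ` {..<k}"] finN by auto
  define f' where "f' i = (if i \<in> ?I then h i else f i)" for i
  have "inj_on f' {..<k}"
  proof (rule inj_onI)
    fix i j assume ij: "i \<in> {..<k}" "j \<in> {..<k}" "f' i = f' j"
    have "h a \<noteq> f b" if "a \<in> ?I" "b < k" for a b using h(1) that by blast
    then show "i = j" using ij f(1) h(2) unfolding f'_def inj_on_def
      by (smt (verit) lessThan_iff)
  qed
  moreover have "f' ` {..<k} \<subseteq> {..<n}"
  proof
    fix y assume "y \<in> f' ` {..<k}"
    then obtain i where i: "i < k" "y = f' i" by auto
    show "y \<in> {..<n}"
    proof (cases "i \<in> ?I")
      case True
      then have "G u y" using h(1) i by (auto simp: f'_def image_subset_iff)
      then show ?thesis using G by blast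
    next
      case False
      then have "y = f i" unfolding i(2) f'_def by (rule if_not_P)
      then show ?thesis using f(2) i by auto
    qed
  qed
  moreover have "G (f' i) (f' j)" if ij: "i < k" "j < k" "F i j" for i j
  proof -
    have cf: "hub_graph n G u (f i) (f j)" using f(3) ij by blast
    have hN: "G u (h a)" "G (h a) u" if "a \<in> ?I" for a using h(1) that G by (auto simp: image_subset_iff)
    consider "i \<in> ?I" | "j \<in> ?I" | "i \<notin> ?I" "j \<notin> ?I" by blast
    then show ?thesis
    proof cases
      case 1
      then have "f j = u" using cf by (auto simp: hub_graph_def)
      then have "f' i = h i" "f' j = u" using 1 unfolding f'_def by auto
      then show ?thesis using hN[OF 1] by simp
    next
      case 2
      then have "f i = u" using cf by (auto simp: hub_graph_def)
      then have "f' j = h j" "f' i = u" using 2 unfolding f'_def by auto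
      then show ?thesis using hN[OF 2] by simp
    next
      case 3
      then have "f' i = f i" "f' j = f j" unfolding f'_def by (simp_all only: if_False)
      moreover have "f i = u \<or> G u (f i)" "f j = u \<or> G u (f j)" using 3 ij by auto
      ultimately show ?thesis using cf G by (auto simp: hub_graph_def)
    qed
  qed
  ultimately show ?thesis unfolding contains_subgraph_def by blast
qed

section \<open>Entries of the Perron vector outside the hub\<close>

lemma mv_adj_matrix:
  assumes "graph_on n G"
  shows "mv n (adj_matrix G) y i = (\<Sum>j\<in>{j. G i j}. y j)"
proof -
  have "(\<Sum>j<n. adj_matrix G i j * y j) = (\<Sum>j\<in>{j. G i j}. y j)"
    using graph_onD[OF assms] by (intro sum.mono_neutral_cong_right) (auto simp: adj_matrix_def)
  then show ?thesis by (simp add: mv_def)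
qed

text \<open>3563 is the integer part of the square root of 12700000 - 1. The last assumption is the
  lower bound \<open>sqrt (n - 1)\<close> for the radius.\<close>

locale perron_outerplanar =
  fixes n :: nat and G :: "nat \<Rightarrow> nat \<Rightarrow> bool" and y :: "nat \<Rightarrow> real" and s :: real and u :: nat
  assumes g: "graph_on n G" and th: "theta_free G" and u: "u < n"
    and y0: "\<And>i. 0 \<le> y i" and y1: "\<And>i. i < n \<Longrightarrow> y i \<le> 1" and yu: "y u = 1"
    and eig: "\<And>i. i < n \<Longrightarrow> (\<Sum>j\<in>{j. G i j}. y j) = s * y i"
    and s: "s \<ge> 3563" and n: "real n \<le> s\<^sup>2 + 1"
begin

lemmas G = graph_onD[OF g]

abbreviation N :: "nat \<Rightarrow> nat set" where "N v \<equiv> {w. G v w}"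

definition B :: "nat set" where "B = {v. v < n \<and> v \<noteq> u \<and> \<not> G u v}"

lemma N_subset: "N v \<subseteq> {..<n}" using G by auto

lemma finite_N: "finite (N v)" by (rule finite_subset[OF N_subset]) simp

lemma finite_B: "finite B" by (simp add: B_def)

lemma common: "v \<noteq> w \<Longrightarrow> card (N v \<inter> N w) \<le> 2"
  using theta_free_common_neighbours[OF g th, of v w] by (simp add: Collect_conj_eq)

lemma card_degree: "(\<Sum>v\<in>S. real (card {w \<in> S. G v w})) \<le> 6 * real (card S)" if "finite S"
proof -
  have "real (\<Sum>v\<in>S. card {w \<in> S. G v w}) \<le> real (6 * card S)"
    using theta_free_degree_sum[OF g th that] by (simp only: of_nat_le_iff)
  then show ?thesis by simp
qed

text \<open>Sum of all eigenvalue equations, with entries at most 1 on the right and degree sum at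
  most \<open>6 * n\<close>.\<close>

lemma total: "s * (\<Sum>i<n. y i) \<le> 6 * real n"
proof -
  have "s * (\<Sum>i<n. y i) = (\<Sum>i<n. \<Sum>j\<in>N i. y j)"
    by (simp add: sum_distrib_left eig)
  also have "\<dots> \<le> (\<Sum>i<n. \<Sum>j\<in>N i. 1)"
    using N_subset by (intro sum_mono y1) auto
  also have "\<dots> = (\<Sum>i<n. real (card {w \<in> {..<n}. G i w}))"
  proof -
    have "{w \<in> {..<n}. G i w} = N i" for i using N_subset by auto
    then show ?thesis by simp
  qed
  also have "\<dots> \<le> 6 * real n" using card_degree[of "{..<n}"] by simp
  finally show ?thesis .
qed

lemma total': "(\<Sum>i<n. y i) \<le> 6 * s + 1 / 100"
proof -
  have "s * (\<Sum>i<n. y i) \<le> 6 * real n" by (rule total)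
  also have "\<dots> \<le> 6 * (s\<^sup>2 + 1)" using n by simp
  \<comment> \<open>The excess \<open>6 / s\<close> is below \<open>1 / 100\<close>.\<close>
  also have "\<dots> \<le> s * (6 * s + 1 / 100)" using s by (simp add: power2_eq_square algebra_simps)
  finally show ?thesis using s by simp
qed

text \<open>The equation applied twice sums \<open>y\<close> over the ends of the 2-walks from
  \<open>v\<close>. Those returning to \<open>v\<close> number \<open>card (N v)\<close>; any other
  end is reached through at most two common neighbours.\<close>

lemma two_walks: "v < n \<Longrightarrow> s\<^sup>2 * y v \<le> real (card (N v)) * y v + 2 * (\<Sum>i<n. y i)"
proof -
  assume v: "v < n"
  have "s\<^sup>2 * y v = s * (\<Sum>w\<in>N v. y w)" using eig[OF v] by (simp add: power2_eq_square)
  also have "\<dots> = (\<Sum>w\<in>N v. \<Sum>z\<in>N w. y z)"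
    unfolding sum_distrib_left by (intro sum.cong refl eig[symmetric]) (use G in blast)
  also have "\<dots> = (\<Sum>w\<in>N v. \<Sum>z<n. if G w z then y z else 0)"
    using N_subset by (intro sum.cong refl sum.mono_neutral_cong_left) auto
  also have "\<dots> = (\<Sum>z<n. \<Sum>w\<in>N v. if G w z then y z else 0)" by (rule sum.swap)
  also have "\<dots> = (\<Sum>z<n. real (card (N v \<inter> N z)) * y z)"
  proof (intro sum.cong refl)
    fix z
    have "(\<Sum>w\<in>N v. if G w z then y z else 0) = (\<Sum>w\<in>N v \<inter> N z. y z)"
      using finite_N G by (intro sum.mono_neutral_cong_right) auto
    then show "(\<Sum>w\<in>N v. if G w z then y z else 0) = real (card (N v \<inter> N z)) * y z" by simp
  qed
  also have "\<dots> = real (card (N v)) * y v + (\<Sum>z\<in>{..<n} - {v}. real (card (N v \<inter> N z)) * y z)"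
    using v by (subst sum.remove[of _ v]) auto
  also have "(\<Sum>z\<in>{..<n} - {v}. real (card (N v \<inter> N z)) * y z) \<le> (\<Sum>z\<in>{..<n} - {v}. 2 * y z)"
  proof (intro sum_mono mult_right_mono)
    fix z assume "z \<in> {..<n} - {v}"
    then have "card (N v \<inter> N z) \<le> 2" by (intro common) auto
    then show "real (card (N v \<inter> N z)) \<le> 2" by linarith
  qed (rule y0)
  also have "\<dots> \<le> (\<Sum>z<n. 2 * y z)" using y0 by (intro sum_mono2) auto
  finally show ?thesis by (simp add: sum_distrib_left)
qed

lemma degree_u: "real (card (N u)) \<ge> s\<^sup>2 - 12 * s - 1 / 50"
  using two_walks[OF u] total' yu by simp

text \<open>The vertices are \<open>u\<close>, its neighbours and \<open>B\<close>, so
  \<open>n \<le> s^2 + 1\<close> against \<open>degree_u\<close> leaves this many for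
  \<open>B\<close>.\<close>

lemma card_B: "real (card B) \<le> 12 * s + 1 / 50"
proof -
  have "{..<n} = insert u (N u \<union> B)" using u N_subset[of u] by (auto simp: B_def)
  then have "n = card (insert u (N u \<union> B))" by (metis card_lessThan)
  also have "\<dots> = Suc (card (N u) + card B)"
    using finite_N finite_B G by (subst card_insert_disjoint) (auto simp: B_def card_Un_disjoint disjoint_iff)
  finally show ?thesis using degree_u n by linarith
qed

lemma nbr_split: "v < n \<Longrightarrow> v \<noteq> u \<Longrightarrow> N v \<subseteq> insert u ((N v \<inter> N u) \<union> {w \<in> B. G v w})"
  using N_subset by (auto simp: B_def)

text \<open>The neighbours of \<open>v\<close> are possibly \<open>u\<close>, at most two neighbours
  of \<open>u\<close>, and vertices of \<open>B\<close>; so the degree is at most about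
  \<open>12 * s\<close>, and \<open>two_walks\<close> bounds \<open>y v\<close> by about
  \<open>12 / s\<close>. The step to 12.1 absorbs the lower-order terms.\<close>

lemma entry_bound: "v < n \<Longrightarrow> v \<noteq> u \<Longrightarrow> y v \<le> 121 / 10 / s"
proof -
  assume v: "v < n" "v \<noteq> u"
  have "card (N v) \<le> card (insert u ((N v \<inter> N u) \<union> B))"
    using nbr_split[OF v] finite_N finite_B by (intro card_mono) auto
  also have "\<dots> \<le> 1 + (card (N v \<inter> N u) + card B)"
    using card_insert_le_m1[of "Suc (card ((N v \<inter> N u) \<union> B))" "(N v \<inter> N u) \<union> B" u] card_Un_le[of "N v \<inter> N u" B]
    by linarith
  also have "\<dots> \<le> 3 + card B" using common[OF v(2)] by simp
  finally have "real (card (N v)) \<le> 12 * s + 302 / 100" using card_B by linarith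
  then have "real (card (N v)) * y v \<le> (12 * s + 302 / 100) * y v" using y0 by (intro mult_right_mono) auto
  then have 1: "(s\<^sup>2 - 12 * s - 302 / 100) * y v \<le> 12 * s + 1 / 50"
    using two_walks[OF v(1)] total' by (simp add: algebra_simps)
  have q: "3563 * s \<le> s\<^sup>2" unfolding power2_eq_square using s by (intro mult_right_mono) auto
  have "(12 * s + 1 / 50) * s = 12 * s\<^sup>2 + s / 50" by (simp add: power2_eq_square algebra_simps)
  also have "\<dots> \<le> 121 / 10 * (s\<^sup>2 - 12 * s - 302 / 100)" using q s by (simp add: algebra_simps)
  finally have 2: "(12 * s + 1 / 50) * s \<le> 121 / 10 * (s\<^sup>2 - 12 * s - 302 / 100)" .
  have 3: "0 < s\<^sup>2 - 12 * s - 302 / 100" using q s by linarith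
  have "(s\<^sup>2 - 12 * s - 302 / 100) * (y v * s) \<le> (12 * s + 1 / 50) * s"
    using mult_right_mono[OF 1, of s] s by (simp add: mult_ac)
  also note 2
  finally have "(s\<^sup>2 - 12 * s - 302 / 100) * (y v * s) \<le> (s\<^sup>2 - 12 * s - 302 / 100) * (121 / 10)" by (simp add: mult_ac)
  then have "y v * s \<le> 121 / 10" using 3 by (simp only: mult_le_cancel_left_pos)
  then show ?thesis using s by (simp add: pos_le_divide_eq)
qed

lemma B_not_adj: "v \<in> B \<Longrightarrow> v < n \<and> v \<noteq> u \<and> u \<notin> N v"
  using G by (auto simp: B_def)

text \<open>The entries are bounded on average rather than one by one: a vertex of \<open>B\<close>
  has at most two neighbours outside \<open>B\<close>, and the degrees within \<open>B\<close> sum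
  to at most \<open>6 * card B\<close>, so the average degree is at most 8.\<close>

lemma sum_B: "(\<Sum>v\<in>B. y v) \<le> 1162 / s"
proof -
  let ?M = "121 / 10 / s"
  have deg: "real (card (N v)) \<le> 2 + real (card {w \<in> B. G v w})" if "v \<in> B" for v
  proof -
    have "card (N v) \<le> card ((N v \<inter> N u) \<union> {w \<in> B. G v w})"
      using nbr_split[of v] B_not_adj[OF that] finite_N finite_B by (intro card_mono) auto
    also have "\<dots> \<le> card (N v \<inter> N u) + card {w \<in> B. G v w}" by (rule card_Un_le)
    also have "\<dots> \<le> 2 + card {w \<in> B. G v w}" using common[of v u] B_not_adj[OF that] by simp
    finally show ?thesis by simp
  qed
  have "s * (\<Sum>v\<in>B. y v) = (\<Sum>v\<in>B. \<Sum>w\<in>N v. y w)"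
    unfolding sum_distrib_left using B_not_adj by (intro sum.cong refl eig[symmetric]) auto
  also have "\<dots> \<le> (\<Sum>v\<in>B. \<Sum>w\<in>N v. ?M)"
    using B_not_adj N_subset by (intro sum_mono entry_bound) auto
  also have "\<dots> = (\<Sum>v\<in>B. real (card (N v))) * ?M" by (simp only: sum_constant sum_distrib_right)
  also have "\<dots> \<le> 8 * (12 * s + 1 / 50) * ?M"
  proof (rule mult_right_mono)
    have "(\<Sum>v\<in>B. real (card (N v))) \<le> (\<Sum>v\<in>B. 2 + real (card {w \<in> B. G v w}))"
      by (intro sum_mono deg)
    also have "\<dots> \<le> 8 * real (card B)" using card_degree[OF finite_B] by (simp add: sum.distrib)
    also have "\<dots> \<le> 8 * (12 * s + 1 / 50)" using card_B by (intro mult_left_mono) auto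
    finally show "(\<Sum>v\<in>B. real (card (N v))) \<le> 8 * (12 * s + 1 / 50)" .
  qed (use s in simp)
  \<comment> \<open>The leading term is 8 * 12 * 12.1 = 1161.6.\<close>
  also have "\<dots> \<le> 1162" using s by (simp add: field_simps)
  finally show ?thesis using s by (simp add: pos_le_divide_eq mult.commute)
qed

text \<open>At most two neighbours of \<open>w\<close> lie outside \<open>B\<close>, each with entry
  at most \<open>12.1 / s\<close>, and those in \<open>B\<close> contribute at most
  \<open>1162 / s\<close>; the total is about \<open>1186 / s\<close>.\<close>

lemma B_small: "w \<in> B \<Longrightarrow> s * y w < 1"
proof -
  assume w: "w \<in> B"
  have "s * y w = (\<Sum>v\<in>N w. y v)" using eig[of w] B_not_adj[OF w] by simp
  also have "\<dots> \<le> (\<Sum>v\<in>(N w \<inter> N u) \<union> {v \<in> B. G w v}. y v)"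
    using nbr_split[of w] B_not_adj[OF w] finite_N finite_B y0 by (intro sum_mono2) auto
  also have "\<dots> = (\<Sum>v\<in>N w \<inter> N u. y v) + (\<Sum>v\<in>{v \<in> B. G w v}. y v)"
    using finite_N finite_B by (intro sum.union_disjoint) (auto simp: B_def)
  also have "(\<Sum>v\<in>N w \<inter> N u. y v) \<le> (\<Sum>v\<in>N w \<inter> N u. 121 / 10 / s)"
    using G by (intro sum_mono entry_bound) auto
  also have "\<dots> \<le> 2 * (121 / 10 / s)"
  proof -
    have "real (card (N w \<inter> N u)) \<le> 2" using common[of w u] B_not_adj[OF w] by simp
    then have "real (card (N w \<inter> N u)) * (121 / 10 / s) \<le> 2 * (121 / 10 / s)"
      using s by (intro mult_right_mono) auto
    then show ?thesis by simp
  qed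
  also have "(\<Sum>v\<in>{v \<in> B. G w v}. y v) \<le> (\<Sum>v\<in>B. y v)" using finite_B y0 by (intro sum_mono2) auto
  also have "\<dots> \<le> 1162 / s" by (rule sum_B)
  finally have "s * y w \<le> 2 * (121 / 10 / s) + 1162 / s" by simp
  also have "\<dots> < 1" using s by (simp add: field_simps)
  finally show ?thesis .
qed

text \<open>Measured with the old vector \<open>y\<close>, a vertex of \<open>B\<close> trades edges
  of total weight \<open>s * y b < 1\<close> for a single edge of weight
  \<open>y u = 1\<close>.\<close>

lemma hub_graph_radius:
  assumes "B \<noteq> {}"
  shows "s < spectral_radius n (hub_graph n G u)"
proof (rule ccontr)
  assume "\<not> ?thesis"
  then have le: "spectral_radius n (hub_graph n G u) \<le> s" by simp
  have n0: "n > 0" using u by simp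
  let ?A = "adj_matrix G" and ?C = "adj_matrix (hub_graph n G u)"
  note gc = graph_on_hub_graph[OF g, of u]
  define D where "D i j = (?C i j - ?A i j) * (y i * y j)" for i j
  have symD: "D i j = D j i" for i j
    using G graph_onD[OF gc] by (auto simp: D_def adj_matrix_def)
  \<comment> \<open>The rows and columns of \<open>B\<close> bound the whole sum from below: entries
    with both indices in \<open>B\<close> are counted twice, but there edges are only lost; entries
    with no index in \<open>B\<close> do not change.\<close>
  have pw: "(if i \<in> B then D i j else 0) + (if j \<in> B then D i j else 0) \<le> D i j" if "i < n" "j < n" for i j
  proof -
    consider "i \<in> B" "j \<in> B" | "i \<notin> B" "j \<notin> B" | "(i \<in> B) \<noteq> (j \<in> B)" by blast
    then show ?thesis
    proof cases
      case 1
      then have "?C i j - ?A i j \<le> 0" by (auto simp: adj_matrix_def hub_graph_def B_def)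
      then have "D i j \<le> 0" unfolding D_def using y0 by (intro mult_nonpos_nonneg) auto
      then show ?thesis using 1 by simp
    next
      case 2
      then have "hub_graph n G u i j \<longleftrightarrow> G i j" using that G by (auto simp: hub_graph_def B_def)
      then show ?thesis using 2 by (simp add: D_def adj_matrix_def)
    qed auto
  qed
  have mvC: "mv n ?C y b = 1" if "b \<in> B" for b
  proof -
    have "{j. hub_graph n G u b j} = {u}" using that u G by (auto simp: hub_graph_def B_def)
    then show ?thesis using mv_adj_matrix[OF gc, of y b] yu by simp
  qed
  have mvA: "mv n ?A y b = s * y b" if "b < n" for b using mv_adj_matrix[OF g, of y b] eig[OF that] by simp
  have row: "(\<Sum>j<n. D b j) = y b * (mv n ?C y b - mv n ?A y b)" for b
    by (simp add: D_def mv_def sum_distrib_left sum_subtractf algebra_simps)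
  have R: "(\<Sum>i<n. \<Sum>j<n. if i \<in> B then D i j else 0) = (\<Sum>b\<in>B. y b * (1 - s * y b))"
  proof -
    have "(\<Sum>i<n. \<Sum>j<n. if i \<in> B then D i j else 0) = (\<Sum>i<n. if i \<in> B then (\<Sum>j<n. D i j) else 0)"
      by (intro sum.cong refl) auto
    also have "\<dots> = (\<Sum>b\<in>B. \<Sum>j<n. D b j)"
      by (intro sum.mono_neutral_cong_right) (auto simp: B_def)
    also have "\<dots> = (\<Sum>b\<in>B. y b * (1 - s * y b))"
      using mvC mvA B_not_adj by (intro sum.cong refl) (simp add: row)
    finally show ?thesis .
  qed
  have R': "(\<Sum>i<n. \<Sum>j<n. if j \<in> B then D i j else 0) = (\<Sum>b\<in>B. y b * (1 - s * y b))"
    unfolding R[symmetric] by (subst sum.swap) (simp add: symD cong: if_cong)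
  have "0 \<le> (\<Sum>b\<in>B. y b * (1 - s * y b))"
    using B_small y0 by (intro sum_nonneg mult_nonneg_nonneg) (auto simp: less_imp_le)
  then have "0 \<le> (\<Sum>i<n. \<Sum>j<n. (if i \<in> B then D i j else 0) + (if j \<in> B then D i j else 0))"
    by (simp add: sum.distrib R R')
  also have "\<dots> \<le> (\<Sum>i<n. \<Sum>j<n. D i j)" by (intro sum_mono pw) auto
  also have "\<dots> = ip n y (mv n ?C y) - ip n y (mv n ?A y)"
    unfolding row ip_def by (simp add: sum_subtractf algebra_simps)
  also have "ip n y (mv n ?A y) = s * ip n y y"
    using mvA by (simp add: ip_scale[symmetric] cong: ip_cong)
  finally have ge: "s * ip n y y \<le> ip n y (mv n ?C y)" by simp
  have pos: "ip n y y > 0" using ip_nonneg[of n y] ip_eq_0_iff[of n y] u yu by force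
  have le': "ip n y (mv n ?C y) \<le> spectral_radius n (hub_graph n G u) * ip n y y"
    by (rule spectral_radius_ge[OF n0 gc])
  have le'': "spectral_radius n (hub_graph n G u) * ip n y y \<le> s * ip n y y" using le pos by simp
  have eq: "spectral_radius n (hub_graph n G u) = s" using ge le' le pos
    by (meson mult_le_cancel_right_pos order_antisym order_trans)
  \<comment> \<open>Entries of \<open>y\<close> on \<open>B\<close> may be 0, so the gain need not
    be strict. But equality makes \<open>y\<close> an eigenvector of the hub graph, and at the leaf
    \<open>b\<close> this reads \<open>1 = s * y b\<close>.\<close>
  obtain b where b: "b \<in> B" using assms by blast
  have "mv n ?C y b = s * y b"
    using spectral_radius_attained[OF n0 gc, of y b] ge le' eq B_not_adj[OF b] by simp
  then show False using mvC[OF b] B_small[OF b] by simp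
qed

end

section \<open>Extremal graphs are fans\<close>

lemma outerplanar_large_radius_hub:
  assumes g: "graph_on n G" and op: "outerplanar n G" and n: "n \<ge> 12700000"
    and s: "spectral_radius n G \<ge> sqrt (real (n - 1))"
  obtains u where "u < n" "n \<le> 2 * card {v. G u v}"
    "spectral_radius n G < spectral_radius n (hub_graph n G u) \<or> hub_graph n G u = G"
proof -
  let ?s = "spectral_radius n G"
  have n0: "n > 0" using n by simp
  have s2: "real n \<le> ?s\<^sup>2 + 1"
    using power_mono[OF s, of 2] n by (simp add: of_nat_diff)
  have s3: "?s \<ge> 3563"
  proof -
    have "sqrt (real (n - 1)) \<ge> 3563" using n by (intro real_le_rsqrt) (simp add: of_nat_diff)
    then show ?thesis using s by linarith
  qed
  obtain x where x: "\<And>i. 0 \<le> x i" "ip n x x = 1" "\<And>i. i < n \<Longrightarrow> mv n (adj_matrix G) x i = ?s * x i"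
    using spectral_radius_perron[OF n0 g] by metis
  obtain u where u: "u < n" "\<And>i. i < n \<Longrightarrow> x i \<le> x u"
  proof -
    have fin: "finite (x ` {..<n})" "x ` {..<n} \<noteq> {}" using n0 by auto
    obtain v where v: "v < n" "Max (x ` {..<n}) = x v" using Max_in[OF fin] by (elim imageE) simp
    show thesis
    proof (rule that[OF v(1)])
      show "x i \<le> x v" if "i < n" for i using Max_ge[OF fin(1), of "x i"] that v(2) by simp
    qed
  qed
  have xu: "x u > 0"
  proof (rule ccontr)
    assume "\<not> 0 < x u"
    then have "\<forall>i<n. x i = 0" using u x(1) by (meson antisym le_less_trans not_le order_trans)
    then show False using x(2) ip_eq_0_iff[of n x] by simp
  qed
  define y where "y i = x i / x u" for i
  interpret perron_outerplanar n G y ?s u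
  proof
    show "theta_free G" by (rule outerplanar_theta_free[OF g op])
    show "0 \<le> y i" for i using x(1) xu by (simp add: y_def)
    show "y i \<le> 1" if "i < n" for i using u(2)[OF that] xu by (simp add: y_def)
    show "y u = 1" using xu by (simp add: y_def)
    show "(\<Sum>j\<in>{j. G i j}. y j) = ?s * y i" if "i < n" for i
      using x(3)[OF that] mv_adj_matrix[OF g, of x i] by (simp add: y_def sum_divide_distrib[symmetric])
  qed (use g u s2 s3 in auto)
  have "3563 * ?s \<le> ?s\<^sup>2" unfolding power2_eq_square using s3 by (intro mult_right_mono) auto
  then have "real n \<le> 2 * real (card (N u))" using degree_u s2 s3 by linarith
  then have "n \<le> 2 * card (N u)" by linarith
  moreover have "hub_graph n G u = G" if "B = {}"
  proof (intro ext iffI)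
    have "G u v" if "v < n" "v \<noteq> u" for v using \<open>B = {}\<close> that by (auto simp: B_def)
    then show "G a b" if "hub_graph n G u a b" for a b using that graph_onD[OF g] unfolding hub_graph_def by metis
    show "hub_graph n G u a b" if "G a b" for a b
      using that graph_onD[OF g that] \<open>\<And>v. v < n \<Longrightarrow> v \<noteq> u \<Longrightarrow> G u v\<close> unfolding hub_graph_def by blast
  qed
  ultimately show thesis using that u(1) hub_graph_radius by blast
qed

text \<open>The test vector is the Perron vector of the star at the hub.\<close>

lemma fan_radius_ge_sqrt:
  assumes n: "n = Suc (sum_list ls)" "n \<ge> 2"
  shows "sqrt (real (n - 1)) \<le> spectral_radius n (fan n ls)"
proof -
  let ?N = "sum_list ls"
  define c where "c = sqrt (real ?N)"
  have c: "c > 0" "c * c = real ?N" using n by (auto simp: c_def)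
  define y where "y i = (if i = 0 then c else 1)" for i :: nat
  let ?A = "adj_matrix (fan n ls)"
  have "ip n y y = 2 * real ?N" unfolding ip_def n(1) sum.lessThan_Suc_shift by (simp add: y_def c)
  moreover have "ip n y (mv n ?A y) \<ge> c * real ?N + real ?N * c"
  proof -
    have "mv n ?A y 0 = real ?N" unfolding n(1) mv_fan_hub by (simp add: y_def)
    moreover have "c \<le> mv n ?A y (Suc i)" if "i < ?N" for i
    proof -
      have "c = ?A (Suc i) 0 * y 0" using that n(1) by (simp add: adj_matrix_def fan_def y_def)
      also have "\<dots> \<le> mv n ?A y (Suc i)" unfolding mv_def
        using n c(1) by (intro member_le_sum) (auto simp: adj_matrix_def y_def)
      finally show ?thesis .
    qed
    then have "(\<Sum>i<?N. c) \<le> (\<Sum>i<?N. mv n ?A y (Suc i))" by (intro sum_mono) auto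
    moreover have "ip n y (mv n ?A y) = c * mv n ?A y 0 + (\<Sum>i<?N. mv n ?A y (Suc i))"
      unfolding ip_def n(1) sum.lessThan_Suc_shift by (simp add: y_def)
    ultimately show ?thesis by (simp add: mult.commute)
  qed
  ultimately have "c * (2 * real ?N) \<le> spectral_radius n (fan n ls) * (2 * real ?N)"
    using spectral_radius_ge[OF _ graph_on_fan, of n y ls] n(1) by (simp add: mult.commute)
  then have "c \<le> spectral_radius n (fan n ls)" by (rule mult_right_le_imp_le) (use n in simp)
  then show ?thesis by (simp add: c_def n(1))
qed

text \<open>The admissible fan \<open>ls0\<close> makes the maximal radius at least
  \<open>sqrt (n - 1)\<close>. The hub graph is isomorphic to an \<open>F\<close>-free fan, so by
  maximality its radius is not larger, and it must be \<open>G\<close> itself.\<close>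

lemma extremal_isomorphic_fan:
  assumes n: "n \<ge> 12700000" "4 * k \<le> n" and G: "OP_admissible n k F G"
    and max: "\<And>G'. OP_admissible n k F G' \<Longrightarrow> spectral_radius n G' \<le> spectral_radius n G"
    and ls0: "n = Suc (sum_list ls0)" "OP_admissible n k F (fan n ls0)"
  obtains ls where "sorted_wrt (\<ge>) ls" "0 \<notin> set ls" "n = Suc (sum_list ls)" "isomorphic n G (fan n ls)"
proof -
  have g: "graph_on n G" "outerplanar n G" "F_free n G k F" using G by (auto simp: OP_admissible_def)
  have "sqrt (real (n - 1)) \<le> spectral_radius n G"
    using fan_radius_ge_sqrt[OF ls0(1)] max[OF ls0(2)] n by linarith
  then obtain u where u: "u < n" "n \<le> 2 * card {v. G u v}"
    "spectral_radius n G < spectral_radius n (hub_graph n G u) \<or> hub_graph n G u = G"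
    using outerplanar_large_radius_hub[OF g(1,2) n(1)] by blast
  obtain ls where ls: "sorted_wrt (\<ge>) ls" "0 \<notin> set ls" "n = Suc (sum_list ls)" "isomorphic n (fan n ls) (hub_graph n G u)"
    using hub_graph_isomorphic_fan[OF g(1,2) u(1)] by blast
  have "2 * k \<le> card {v. G u v}" using u(2) n(2) by linarith
  then have "F_free n (fan n ls) k F"
    using g(3) hub_graph_contains_subgraph[OF g(1) u(1)] contains_subgraph_isomorphic[OF ls(4)]
    unfolding F_free_def by blast
  then have "OP_admissible n k F (fan n ls)"
    unfolding OP_admissible_def using graph_on_fan outerplanar_fan by blast
  from max[OF this] have "\<not> spectral_radius n G < spectral_radius n (hub_graph n G u)"
    using spectral_radius_isomorphic[OF ls(4)] by simp
  then have "hub_graph n G u = G" using u(3) by blast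
  then show thesis using that ls isomorphic_sym by metis
qed

section \<open>Optimal path lengths\<close>

lemma sum_list_map_update:
  fixes f :: "'a \<Rightarrow> 'b::comm_monoid_add"
  assumes "i < length xs"
  shows "sum_list (map f (xs[i := x])) + f (xs ! i) = sum_list (map f xs) + f x"
  using assms
proof (induction xs arbitrary: i)
  case (Cons y ys)
  show ?case
  proof (cases i)
    case 0
    then show ?thesis by (simp add: ac_simps)
  next
    case (Suc k)
    then have "sum_list (map f (ys[k := x])) + f (ys ! k) = sum_list (map f ys) + f x" using Cons by simp
    then show ?thesis using Suc by (simp add: add.assoc)
  qed
qed simp

text \<open>Free of subtraction, so that it serves natural numbers and real defects alike.\<close>

lemma exchange_sum:
  fixes f :: "nat \<Rightarrow> 'b::comm_monoid_add"
  assumes "i < length xs" "j < length xs" "i \<noteq> j"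
  shows "sum_list (map f (xs[i := x, j := y])) + (f (xs ! i) + f (xs ! j)) = sum_list (map f xs) + (f x + f y)"
proof -
  let ?S = "sum_list (map f (xs[i := x, j := y]))" and ?T = "sum_list (map f (xs[i := x]))"
  have 1: "?S + f (xs ! j) = ?T + f y"
    using sum_list_map_update[of j "xs[i := x]" f y] assms by simp
  have 2: "?T + f (xs ! i) = sum_list (map f xs) + f x"
    by (rule sum_list_map_update[OF assms(1)])
  have "?S + (f (xs ! i) + f (xs ! j)) = (?S + f (xs ! j)) + f (xs ! i)" by (simp only: ac_simps)
  also have "\<dots> = (?T + f (xs ! i)) + f y" unfolding 1 by (simp only: ac_simps)
  also have "\<dots> = sum_list (map f xs) + (f x + f y)" unfolding 2 by (simp only: ac_simps)
  finally show ?thesis .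
qed

section \<open>Exchange arguments\<close>

text \<open>Competitors may be unsorted and may contain 0, so the result of an exchange is a
  competitor as it stands; an empty path has defect 0.\<close>

definition optimal :: "real \<Rightarrow> (nat list \<Rightarrow> bool) \<Rightarrow> nat list \<Rightarrow> bool" where
  "optimal r P ls \<longleftrightarrow> (\<forall>ls'. sum_list ls' = sum_list ls \<longrightarrow> P ls' \<longrightarrow>
     (\<Sum>a\<leftarrow>ls. path_defect r a) \<le> (\<Sum>a\<leftarrow>ls'. path_defect r a))"

lemma optimal_exchange:
  assumes r: "0 < r" "r < 1" and opt: "optimal r P ls"
    and ij: "i < length ls" "j < length ls" "i \<noteq> j" "ls ! j \<le> ls ! i" "1 \<le> c" "c \<le> ls ! j"
  shows "\<not> P (ls[i := ls ! i + c, j := ls ! j - c])"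
proof
  let ?ls = "ls[i := ls ! i + c, j := ls ! j - c]"
  assume P: "P ?ls"
  have "sum_list ?ls + (ls ! i + ls ! j) = sum_list ls + ((ls ! i + c) + (ls ! j - c))"
    using exchange_sum[OF ij(1-3), of "\<lambda>x. x" "ls ! i + c" "ls ! j - c"] by simp
  then have "sum_list ?ls = sum_list ls" using ij(6) by simp
  then have "(\<Sum>a\<leftarrow>ls. path_defect r a) \<le> (\<Sum>a\<leftarrow>?ls. path_defect r a)" using opt P unfolding optimal_def by blast
  moreover have "(\<Sum>a\<leftarrow>?ls. path_defect r a) + (path_defect r (ls ! i) + path_defect r (ls ! j)) =
      (\<Sum>a\<leftarrow>ls. path_defect r a) + (path_defect r (ls ! i + c) + path_defect r (ls ! j - c))"
    by (rule exchange_sum[OF ij(1-3)])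
  moreover have "path_defect r (ls ! i + c) + path_defect r (ls ! j - c) < path_defect r (ls ! i) + path_defect r (ls ! j)"
    by (rule path_defect_exchange[OF r ij(4-6)])
  ultimately show False by linarith
qed

lemma H_OP_list_unique:
  assumes srt: "sorted_wrt (\<ge>) rest" and pos: "0 \<notin> set rest" and m: "m \<ge> 1"
    and le: "\<And>a. a \<in> set rest \<Longrightarrow> a \<le> m"
    and pair: "\<And>i j. i < j \<Longrightarrow> j < length rest \<Longrightarrow> \<not> (rest ! i < m \<and> rest ! j < m)"
    and sum: "M + sum_list rest = n - 1"
  shows "M # rest = H_OP_list n M m"
proof -
  have d: "n - 1 - M = sum_list rest" using sum by simp
  show ?thesis
  proof (cases rest rule: rev_cases)
    case Nil
    then show ?thesis using d by (simp add: H_OP_list_def)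
  next
    case (snoc bs e)
    \<comment> \<open>An entry below \<open>m\<close> before the last one would form a pair of short
      entries with the last, which is no larger.\<close>
    have "b = m" if bin: "b \<in> set bs" for b
    proof (rule ccontr)
      assume b: "b \<noteq> m"
      obtain i where i: "i < length bs" "b = bs ! i" using bin by (metis in_set_conv_nth)
      have "b < m" using le[of b] b that snoc by force
      moreover have "e \<le> b" using srt that snoc by (simp add: sorted_wrt_append)
      ultimately show False using pair[of i "length bs"] i snoc by (simp add: nth_append)
    qed
    then have bs: "bs = replicate (length bs) m" by (intro replicate_length_same[symmetric]) blast
    define q where "q = length bs"
    have rest: "rest = replicate q m @ [e]" using snoc bs by (simp add: q_def)
    have s: "sum_list rest = q * m + e" unfolding rest by (simp add: sum_list_replicate)
    have e: "1 \<le> e" "e \<le> m" using pos le[of e] snoc by auto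
    show ?thesis
    proof (cases "e = m")
      case True
      then have "m dvd n - 1 - M" "(n - 1 - M) div m = Suc q" unfolding d s using m by auto
      moreover have "replicate (Suc q) m = replicate q m @ [m]" by (simp add: replicate_append_same)
      ultimately show ?thesis unfolding H_OP_list_def using True rest by simp
    next
      case False
      then have lt: "e < m" using e by simp
      have "(n - 1 - M) mod m = e" "(n - 1 - M) div m = q" unfolding d s using lt by auto
      moreover have "n - 1 - M - q * m = e" unfolding d s by simp
      ultimately show ?thesis unfolding H_OP_list_def using rest e by (auto simp: dvd_eq_mod_eq_0)
    qed
  qed
qed

lemma H_OP_list_props:
  assumes "m \<ge> 1" "M \<le> n - 1"
  shows "sum_list (H_OP_list n M m) = n - 1" "H_OP_list n M m ! 0 = M"
    "\<And>k. 1 \<le> k \<Longrightarrow> k < length (H_OP_list n M m) \<Longrightarrow> H_OP_list n M m ! k \<le> m"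
proof -
  let ?d = "n - 1 - M"
  have 1: "?d - ?d div m * m = ?d mod m" by (simp add: minus_div_mult_eq_mod)
  have 2: "?d div m * m + ?d mod m = ?d" by (rule div_mult_mod_eq)
  show "sum_list (H_OP_list n M m) = n - 1"
    using assms 2 unfolding H_OP_list_def 1 by (auto simp: sum_list_replicate dvd_eq_mod_eq_0)
  show "H_OP_list n M m ! 0 = M" by (simp add: H_OP_list_def)
  have "?d mod m \<le> m" using assms by (simp add: less_imp_le)
  then show "H_OP_list n M m ! k \<le> m" if "1 \<le> k" "k < length (H_OP_list n M m)" for k
    using that unfolding H_OP_list_def 1 by (cases k) (auto simp: nth_append split: if_splits)
qed

text \<open>Two exchanges determine the list: a vertex moves from the second path to the first as
  long as that has fewer than \<open>M\<close>, and between two later paths that are both shorter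
  than \<open>m\<close>. By \<open>suff\<close> neither can violate \<open>P\<close>.\<close>

lemma optimal_eq_H_OP_list:
  assumes r: "0 < r" "r < 1" and opt: "optimal r P ls"
    and srt: "sorted_wrt (\<ge>) ls" and pos: "0 \<notin> set ls" and m: "1 \<le> m"
    and sum: "sum_list ls = n - 1" and big: "M < n - 1"
    and hd: "ls ! 0 \<le> M" and tl: "\<And>k. 1 \<le> k \<Longrightarrow> k < length ls \<Longrightarrow> ls ! k \<le> m"
    and suff: "\<And>ls'. length ls' = length ls \<Longrightarrow> ls' ! 0 \<le> M \<Longrightarrow>
       (\<And>k. 1 \<le> k \<Longrightarrow> k < length ls' \<Longrightarrow> ls' ! k \<le> m) \<Longrightarrow> P ls'"
  shows "ls = H_OP_list n M m"
proof -
  have len: "length ls \<ge> 2"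
  proof (rule ccontr)
    assume "\<not> ?thesis"
    then have "length ls = 0 \<or> length ls = 1" by arith
    then have "sum_list ls \<le> ls ! 0" by (auto simp: length_Suc_conv)
    then show False using sum hd big by linarith
  qed
  have nth_mono: "ls ! j \<le> ls ! i" if "i < j" "j < length ls" for i j
    using sorted_wrt_nth_less[OF srt that] .
  have nth_pos: "1 \<le> ls ! i" if "i < length ls" for i
    using pos nth_mem[OF that] by (metis One_nat_def Suc_leI neq0_conv)
  have hdM: "ls ! 0 = M"
  proof (rule ccontr)
    assume "ls ! 0 \<noteq> M"
    then have lt: "ls ! 0 < M" using hd by simp
    have "P (ls[0 := ls ! 0 + 1, 1 := ls ! 1 - 1])"
    proof (rule suff)
      fix k assume "1 \<le> k" "k < length (ls[0 := ls ! 0 + 1, 1 := ls ! 1 - 1])"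
      then show "ls[0 := ls ! 0 + 1, 1 := ls ! 1 - 1] ! k \<le> m"
        using tl[of k] len by (cases "k = 1") auto
    next
      have "0 < length ls" using len by linarith
      then show "ls[0 := ls ! 0 + 1, 1 := ls ! 1 - 1] ! 0 \<le> M" using lt by simp
    qed simp
    moreover have "\<not> P (ls[0 := ls ! 0 + 1, 1 := ls ! 1 - 1])"
      by (rule optimal_exchange[OF r opt]) (use len nth_mono[of 0 1] nth_pos[of 1] in auto)
    ultimately show False by blast
  qed
  obtain rest where rest: "ls = M # rest" using len hdM by (cases ls) auto
  have "M # rest = H_OP_list n M m"
  proof (rule H_OP_list_unique)
    show "sorted_wrt (\<ge>) rest" "0 \<notin> set rest" "m \<ge> 1" using srt pos m rest by auto
    show "a \<le> m" if ain: "a \<in> set rest" for a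
    proof -
      obtain k where "k < length rest" "a = rest ! k" using ain by (metis in_set_conv_nth)
      then show ?thesis using tl[of "Suc k"] rest by simp
    qed
    show "M + sum_list rest = n - 1" using sum rest by simp
    fix i j assume ij: "i < j" "j < length rest"
    show "\<not> (rest ! i < m \<and> rest ! j < m)"
    proof
      assume lt: "rest ! i < m \<and> rest ! j < m"
      let ?i = "Suc i" and ?j = "Suc j"
      have eq: "ls ! ?i = rest ! i" "ls ! ?j = rest ! j" using rest by auto
      have "P (ls[?i := ls ! ?i + 1, ?j := ls ! ?j - 1])"
      proof (rule suff)
        show "length (ls[?i := ls ! ?i + 1, ?j := ls ! ?j - 1]) = length ls" by simp
        show "ls[?i := ls ! ?i + 1, ?j := ls ! ?j - 1] ! 0 \<le> M" using hd by simp
        fix k assume k: "1 \<le> k" "k < length (ls[?i := ls ! ?i + 1, ?j := ls ! ?j - 1])"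
        then have "ls ! k \<le> m" using tl[of k] by simp
        then show "ls[?i := ls ! ?i + 1, ?j := ls ! ?j - 1] ! k \<le> m"
          using k lt eq by (cases "k = ?j"; cases "k = ?i") (auto simp: nth_list_update)
      qed
      moreover have "\<not> P (ls[?i := ls ! ?i + 1, ?j := ls ! ?j - 1])"
        by (rule optimal_exchange[OF r opt])
          (use ij rest nth_mono[of ?i ?j] nth_pos[of ?j] in auto)
      ultimately show False by blast
    qed
  qed
  then show ?thesis using rest by simp
qed

text \<open>\<open>P\<close> expresses \<open>F\<close>-freeness of a fan through its path lengths;
  with it the graph problem becomes the minimisation of a defect sum.\<close>

lemma extremal_fan:
  assumes n: "n \<ge> 12700000" "4 * k \<le> n" and X: "n = Suc (sum_list X)" "P X"
    and P: "\<And>ls. n = Suc (sum_list ls) \<Longrightarrow> F_free n (fan n ls) k F \<longleftrightarrow> P ls"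
    and opt: "\<And>r ls. 0 < r \<Longrightarrow> r < 1 / 1000 \<Longrightarrow> sorted_wrt (\<ge>) ls \<Longrightarrow> 0 \<notin> set ls \<Longrightarrow> n = Suc (sum_list ls) \<Longrightarrow>
       P ls \<Longrightarrow> optimal r P ls \<Longrightarrow> ls = X"
  shows "extremal_OP n k F (fan n X)"
proof -
  have adm: "OP_admissible n k F (fan n ls)" if "n = Suc (sum_list ls)" "P ls" for ls
    using P[OF that(1)] that(2) graph_on_fan outerplanar_fan unfolding OP_admissible_def by blast
  have "isomorphic n G (fan n X)"
    if G: "OP_admissible n k F G" and max: "\<And>G'. OP_admissible n k F G' \<Longrightarrow> spectral_radius n G' \<le> spectral_radius n G" for G
  proof -
    obtain ls where ls: "sorted_wrt (\<ge>) ls" "0 \<notin> set ls" "n = Suc (sum_list ls)" "isomorphic n G (fan n ls)"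
      using extremal_isomorphic_fan[OF n G max X(1) adm[OF X]] by blast
    define \<rho> where "\<rho> = spectral_radius n (fan n ls)"
    have \<rho>G: "spectral_radius n G = \<rho>" unfolding \<rho>_def using ls(4) by (rule spectral_radius_isomorphic)
    have "F_free n (fan n ls) k F"
      using G contains_subgraph_isomorphic[OF isomorphic_sym[OF ls(4)]] unfolding OP_admissible_def F_free_def by blast
    then have Pls: "P ls" using P[OF ls(3)] by simp
    have "sqrt (real (n - 1)) \<le> \<rho>" unfolding \<rho>_def by (rule fan_radius_ge_sqrt[OF ls(3)]) (use n in simp)
    moreover have "3563 \<le> sqrt (real (n - 1))" using n by (intro real_le_rsqrt) (simp add: of_nat_diff)
    ultimately have \<rho>: "\<rho> \<ge> 3563" by linarith
    obtain r where r: "0 < r" "r < 1" "\<rho> * r = 1 + r\<^sup>2" using small_root_exists[of \<rho>] \<rho> by auto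
    \<comment> \<open>\<open>r = (1 + r^2) / \<rho>\<close> is less than 2 / 3563.\<close>
    have "3563 * r \<le> \<rho> * r" using \<rho> r by (intro mult_right_mono) auto
    moreover have "r\<^sup>2 < 1" using r by (simp add: power_less_one_iff)
    ultimately have r': "r < 1 / 1000" using r(3) by simp
    have "optimal r P ls" unfolding optimal_def
    proof (intro allI impI, rule ccontr)
      fix ls' assume ls': "sum_list ls' = sum_list ls" "P ls'"
        "\<not> (\<Sum>a\<leftarrow>ls. path_defect r a) \<le> (\<Sum>a\<leftarrow>ls'. path_defect r a)"
      have "\<rho> < spectral_radius n (fan n ls')"
        by (rule fan_radius_less[OF r ls(3) \<rho>_def]) (use \<rho> ls' in auto)
      moreover have "spectral_radius n (fan n ls') \<le> \<rho>"
        using max[OF adm[of ls']] ls' ls(3) \<rho>G by simp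
      ultimately show False by simp
    qed
    then have "ls = X" by (rule opt[OF r(1) r' ls(1-3) Pls])
    then show ?thesis using ls(4) by simp
  qed
  then show ?thesis using adm[OF X] unfolding extremal_OP_def by blast
qed

section \<open>The path cases t = 1 and t = 2\<close>

lemma pair_boundedD: "pair_bounded s ls \<Longrightarrow> i < length ls \<Longrightarrow> j < length ls \<Longrightarrow> i \<noteq> j \<Longrightarrow> ls ! i + ls ! j \<le> s"
  by (simp add: pair_bounded_def)

text \<open>If the longest path exceeds half of the bound, all other paths are shorter than half, so
  there are too many of them: each path costs almost 1.\<close>

lemma optimal_pair_bounded_hd:
  assumes r: "0 < r" "r < 1 / 1000" and opt: "optimal r (pair_bounded s) ls" and pb: "pair_bounded s ls"
    and pos: "0 \<notin> set ls" and s: "s \<ge> 2"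
    and sum: "sum_list ls = n - 1" and big: "25 * (s div 2)\<^sup>2 \<le> n - 1" and big2: "s < n - 1"
    and X: "pair_bounded s (H_OP_list n ((s + 1) div 2) (s div 2))"
  shows "ls ! 0 \<le> (s + 1) div 2"
proof (rule ccontr)
  define m where "m = s div 2"
  define M where "M = (s + 1) div 2"
  have mM: "M + m = s" "m \<le> M" "M \<le> m + 1" "1 \<le> m" using s unfolding m_def M_def by presburger+
  have r1: "r < 1" using r by simp
  let ?g = "path_defect r"
  assume "\<not> ?thesis"
  then have a0: "M < ls ! 0" by (simp add: M_def)
  have "ls \<noteq> []" using sum big2 by auto
  then obtain a rest where ls: "ls = a # rest" by (cases ls) auto
  have a: "M < a" using a0 ls by simp
  have "a \<le> s" using pb ls unfolding pair_bounded_def by fastforce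
  then have "sum_list rest > 0" using sum ls big2 by simp
  then have "rest \<noteq> []" by auto
  have bnd: "a + b \<le> s" if bin: "b \<in> set rest" for b
  proof -
    obtain k where "k < length rest" "b = rest ! k" using bin by (metis in_set_conv_nth)
    then show ?thesis using pair_boundedD[OF pb, of 0 "Suc k"] ls by simp
  qed
  \<comment> \<open>Next to a first path with more than \<open>M\<close> vertices, any other path
    has at most \<open>s - (M + 1) = m - 1\<close> vertices.\<close>
  define c where "c = m - 1"
  have bc: "b \<le> c" if "b \<in> set rest" for b using bnd[OF that] a mM by (simp add: c_def)
  obtain b where b: "b \<in> set rest" using \<open>rest \<noteq> []\<close> by (cases rest) auto
  have "0 \<notin> set rest" using pos ls by simp
  then have b0: "b \<noteq> 0" using b by metis
  have c1: "1 \<le> c" using bc[OF b] b0 by linarith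
  then have mc: "m = Suc c" by (simp add: c_def)
  have a_le: "a \<le> 2 * m" using bnd[OF b] b0 mM by linarith
  \<comment> \<open>A path with at most \<open>c\<close> vertices costs at least
    \<open>?g c / c\<close> per vertex.\<close>
  have "real (sum_list rest) * ?g c \<le> real c * (\<Sum>b\<leftarrow>rest. ?g b)"
    using bc
  proof (induction rest)
    case (Cons b rest)
    then have "real b * ?g c \<le> real c * ?g b" by (intro path_defect_chord[OF r(1) r1]) auto
    then show ?case using Cons by (simp add: algebra_simps)
  qed simp
  moreover have "(\<Sum>b\<leftarrow>rest. ?g b) \<le> (\<Sum>b\<leftarrow>ls. ?g b)" using ls path_defect_nonneg[OF r(1) r1] by simp
  ultimately have lower: "real (sum_list rest) * ?g c \<le> real c * (\<Sum>b\<leftarrow>ls. ?g b)"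
    by (meson mult_left_mono of_nat_0_le_iff order_trans)
  have "M \<le> n - 1" using mM big2 by simp
  note Xp = H_OP_list_props[OF mM(4) this]
  \<comment> \<open>The competitor costs \<open>?g m / m\<close> per vertex, apart from its first
    path and its remainder, which cost less than 1 each.\<close>
  have "(\<Sum>b\<leftarrow>ls. ?g b) \<le> (\<Sum>b\<leftarrow>H_OP_list n M m. ?g b)"
    using opt Xp(1) sum X unfolding optimal_def m_def M_def by simp
  also have "\<dots> \<le> 2 + real ((n - 1 - M) div m) * ?g m"
  proof -
    define q where "q = (n - 1 - M) div m"
    define e where "e = n - 1 - M - q * m"
    have "(\<Sum>b\<leftarrow>H_OP_list n M m. ?g b) \<le> ?g M + real q * ?g m + max 0 (?g e)"
      unfolding H_OP_list_def q_def[symmetric] e_def[symmetric] by (simp add: sum_list_replicate)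
    then show ?thesis
      using path_defect_less_1[OF r(1), of M] path_defect_less_1[OF r(1), of e] by (simp add: q_def)
  qed
  finally have upper: "(\<Sum>b\<leftarrow>ls. ?g b) \<le> 2 + real ((n - 1 - M) div m) * ?g m" .
  let ?N = "real (n - 1)"
  have dm: "real m * real ((n - 1 - M) div m) \<le> ?N"
  proof -
    have "m * ((n - 1 - M) div m) \<le> n - 1" by (meson diff_le_self le_trans times_div_less_eq_dividend)
    then show ?thesis by (metis of_nat_le_iff of_nat_mult)
  qed
  have N: "real (sum_list rest) = ?N - real a" using sum ls by simp
  have "real c * (\<Sum>b\<leftarrow>ls. ?g b) \<le> real c * (2 + real ((n - 1 - M) div m) * ?g m)"
    by (rule mult_left_mono[OF upper]) simp
  from order_trans[OF lower this]
  have "real m * ((?N - real a) * ?g c) \<le> real m * (real c * (2 + real ((n - 1 - M) div m) * ?g m))"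
    unfolding N by (rule mult_left_mono) simp
  also have "\<dots> = 2 * real m * real c + real c * ((real m * real ((n - 1 - M) div m)) * ?g m)"
    by (simp add: algebra_simps)
  also have "\<dots> \<le> 2 * real m * real c + real c * (?N * ?g m)"
    using dm path_defect_nonneg[OF r(1) r1] by (intro add_left_mono mult_left_mono mult_right_mono) auto
  finally have "?N * (real m * ?g c - real c * ?g m) \<le> 2 * real m * real c + real m * (real a * ?g c)"
    by (simp add: algebra_simps)
  also have "\<dots> \<le> 2 * real m * real m + real m * (real (2 * m) * 1)"
    using a_le mc path_defect_less_1[OF r(1), of c] path_defect_nonneg[OF r(1) r1, of c]
    by (intro add_mono mult_left_mono mult_mono) auto
  also have "\<dots> = 4 * (real m)\<^sup>2" by (simp add: power2_eq_square)
  finally have 1: "?N * (real m * ?g c - real c * ?g m) \<le> 4 * (real m)\<^sup>2" .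
  \<comment> \<open>The difference of the two costs per vertex, times \<open>c * m\<close>. By
    \<open>m = c + 1\<close> it reduces to one defect minus a small increment term: at least
    \<open>1 - 2 * r\<close> minus at most \<open>r\<close>.\<close>
  have "real m * ?g c - real c * ?g m = ?g c - real c * defect_step r c"
    unfolding mc path_defect_Suc[OF r(1)] by (simp add: algebra_simps)
  moreover have "?g c \<ge> 1 - 2 * r"
  proof -
    have "?g 1 \<le> ?g c"
      using c1
    proof (induction c rule: dec_induct)
      case (step k)
      then show ?case using path_defect_Suc[OF r(1), of k] defect_step_pos[OF r(1) r1, of k] by simp
    qed simp
    moreover have "1 - 2 * r \<le> ?g 1"
    proof -
      have p: "0 < 1 + r\<^sup>2" by (simp add: add_pos_nonneg)
      have "r * r \<le> r * 1" using r by (intro mult_left_mono) auto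
      moreover have "0 \<le> r * (r * r)" using r by simp
      ultimately have "(1 - 2 * r) * (1 + r\<^sup>2) \<le> 1 - r" by (simp add: power2_eq_square algebra_simps)
      then have "1 - 2 * r \<le> (1 - r) / (1 + r\<^sup>2)" using p by (simp add: pos_le_divide_eq)
      then show ?thesis by (simp add: path_defect_def power2_eq_square)
    qed
    ultimately show ?thesis by simp
  qed
  moreover have "real c * defect_step r c \<le> r"
  proof -
    have "defect_step r c \<le> r ^ c"
    proof -
      have "1 - r\<^sup>2 \<le> (1 + r ^ (c + 1)) * (1 + r ^ (c + 2))"
      proof -
        have "1 * 1 \<le> (1 + r ^ (c + 1)) * (1 + r ^ (c + 2))" using r by (intro mult_mono) auto
        then show ?thesis using zero_le_power2[of r] by linarith
      qed
      then have "r ^ c * (1 - r\<^sup>2) \<le> r ^ c * ((1 + r ^ (c + 1)) * (1 + r ^ (c + 2)))"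
        using r by (intro mult_left_mono) auto
      moreover have "0 < (1 + r ^ (c + 1)) * (1 + r ^ (c + 2))" using r by (intro mult_pos_pos) (auto simp: add_pos_pos)
      ultimately show ?thesis unfolding defect_step_def by (simp add: pos_divide_le_eq)
    qed
    then have "real c * defect_step r c \<le> real c * r ^ c" by (intro mult_left_mono) auto
    also have "\<dots> \<le> r"
      using c1
    proof (induction c rule: dec_induct)
      case (step k)
      have "real (Suc k) * r ^ Suc k = (real (Suc k) * r) * r ^ k" by simp
      also have "\<dots> \<le> real k * r ^ k"
      proof (rule mult_right_mono)
        have "real (Suc k) * r \<le> real (Suc k) * (1 / 2)" using r by (intro mult_left_mono) auto
        also have "\<dots> \<le> real k" using step by simp
        finally show "real (Suc k) * r \<le> real k" .
      qed (use r in simp)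
      also have "\<dots> \<le> r" using step by simp
      finally show ?case .
    qed simp
    finally show ?thesis .
  qed
  ultimately have "real m * ?g c - real c * ?g m \<ge> 1 / 2" using r by linarith
  then have "?N * (1 / 2) \<le> ?N * (real m * ?g c - real c * ?g m)" by (intro mult_left_mono) auto
  \<comment> \<open>Contradicts \<open>big\<close>, since 8 < 25 and \<open>m\<close> is
    positive.\<close>
  then have 2: "?N \<le> 8 * (real m)\<^sup>2" using 1 by linarith
  have "real (25 * m\<^sup>2) \<le> ?N" using big unfolding m_def[symmetric] by (simp only: of_nat_le_iff)
  then have "25 * (real m)\<^sup>2 \<le> ?N" by simp
  moreover have "0 < (real m)\<^sup>2" using mM by simp
  ultimately show False using 2 by linarith
qed

lemma pair_boundedI:
  assumes "M + m = s" "m \<le> M" "ls ! 0 \<le> M" "\<And>k. 1 \<le> k \<Longrightarrow> k < length ls \<Longrightarrow> ls ! k \<le> m"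
  shows "pair_bounded s ls"
proof -
  have le: "ls ! k \<le> (if k = 0 then M else m)" if "k < length ls" for k
    using assms(3) assms(4)[of k] that by (cases k) auto
  show ?thesis unfolding pair_bounded_def
  proof (intro conjI allI impI)
    fix i assume "i < length ls"
    then show "ls ! i \<le> s" using le[of i] assms(1,2) by (auto split: if_splits)
    fix j assume "j < length ls" "i \<noteq> j"
    then show "ls ! i + ls ! j \<le> s" using le[of i] le[of j] \<open>i < length ls\<close> assms(1,2) by (auto split: if_splits)
  qed
qed

text \<open>Treats both cases at once: the tree is a path on \<open>s + 2\<close> vertices, with
  \<open>s = l - 2\<close> for \<open>t = 1\<close> and \<open>s = 2 * l - 3\<close> for
  \<open>t = 2\<close>.\<close>

lemma extremal_path_case:
  assumes t: "t = 1 \<or> t = 2" and l: "l \<ge> 2" and k: "t * (l - 1) + 1 = s + 2" and s: "s \<ge> 2"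
    and n: "n \<ge> 12700000" "4 * (s + 2) \<le> n" "25 * (s div 2)\<^sup>2 \<le> n - 1"
  shows "extremal_OP n (t * (l - 1) + 1) (starlike_tree t l) (fan n (H_OP_list n ((s + 1) div 2) (s div 2)))"
proof -
  define m where "m = s div 2"
  define M where "M = (s + 1) div 2"
  have mM: "M + m = s" "m \<le> M" "1 \<le> m" using s unfolding m_def M_def by presburger+
  have Mn: "M < n - 1" "M \<le> n - 1" using mM n by auto
  note Xp = H_OP_list_props[OF mM(3) Mn(2)]
  have X: "pair_bounded s (H_OP_list n M m)"
    by (rule pair_boundedI[OF mM(1,2)]) (use Xp in auto)
  have "extremal_OP n (t * (l - 1) + 1) (starlike_tree t l) (fan n (H_OP_list n M m))"
  proof (rule extremal_fan[where P = "pair_bounded s"])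
    show "n \<ge> 12700000" "4 * (t * (l - 1) + 1) \<le> n" using n k by auto
    show "n = Suc (sum_list (H_OP_list n M m))" using Xp(1) n by simp
    show "pair_bounded s (H_OP_list n M m)" by (rule X)
    show "F_free n (fan n ls) (t * (l - 1) + 1) (starlike_tree t l) \<longleftrightarrow> pair_bounded s ls"
      if "n = Suc (sum_list ls)" for ls
      using contains_starlike_tree_12[OF t l] fan_path_free[OF _ k that] fan_path_free_pair_bounded[OF that k]
      unfolding F_free_def by blast
    fix r ls assume r: "0 < r" "r < 1 / (1000 :: real)" and ls: "sorted_wrt (\<ge>) ls" "0 \<notin> set ls" "n = Suc (sum_list ls)"
      and pb: "pair_bounded s ls" and opt: "optimal r (pair_bounded s) ls"
    have r1: "r < 1" using r by simp
    have sum: "sum_list ls = n - 1" using ls(3) by simp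
    have hd: "ls ! 0 \<le> M" unfolding M_def
      by (rule optimal_pair_bounded_hd[OF r opt pb ls(2) s sum n(3)]) (use n X in \<open>auto simp: m_def M_def\<close>)
    show "ls = H_OP_list n M m"
    proof (rule optimal_eq_H_OP_list[OF r(1) r1 opt ls(1,2) mM(3) sum Mn(1) hd])
      fix k assume k: "1 \<le> k" "k < length ls"
      have "ls ! k \<le> ls ! 0" using sorted_wrt_nth_less[OF ls(1), of 0 k] k by simp
      moreover have "ls ! 0 + ls ! k \<le> s" by (rule pair_boundedD[OF pb]) (use k in linarith)+
      ultimately show "ls ! k \<le> m" unfolding m_def by linarith
    qed (rule pair_boundedI[OF mM(1,2)])
  qed
  then show ?thesis by (simp add: m_def M_def)
qed

section \<open>The star case and the numerical bounds\<close>

lemma sum_list_div_small: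
  assumes "\<And>k. 1 \<le> k \<Longrightarrow> k < length ls \<Longrightarrow> ls ! k < (q::nat)" "ls \<noteq> []"
  shows "(\<Sum>a\<leftarrow>ls. a div q) = ls ! 0 div q"
proof -
  obtain a rest where ls: "ls = a # rest" using assms(2) by (cases ls) auto
  have "b div q = 0" if bin: "b \<in> set rest" for b
  proof -
    obtain k where "k < length rest" "b = rest ! k" using bin by (metis in_set_conv_nth)
    then show ?thesis using assms(1)[of "Suc k"] ls by simp
  qed
  then have "(\<Sum>a\<leftarrow>rest. a div q) = 0" by (induction rest) auto
  then show ?thesis using ls by simp
qed

text \<open>The constraint bounds the number of blocks of \<open>q = l - 1\<close> vertices. All
  blocks can be moved to the first path, which leaves fewer than \<open>q\<close> vertices in every
  other path and allows at most \<open>t * q - 1 = M\<close> in the first.\<close>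

lemma extremal_star_case:
  assumes t: "t \<ge> 4" and l: "l \<ge> 3"
    and n: "n \<ge> 12700000" "4 * (t * (l - 1) + 1) \<le> n"
  shows "extremal_OP n (t * (l - 1) + 1) (starlike_tree t l) (fan n (H_OP_list n (t * l - t - 1) (l - 2)))"
proof -
  define q where "q = l - 1"
  define m where "m = l - 2"
  define M where "M = t * l - t - 1"
  have q: "q = Suc m" "1 \<le> m" using l by (auto simp: q_def m_def)
  have tq: "Suc M = t * q"
  proof -
    have "t * l - t = t * q" by (simp add: q_def right_diff_distrib')
    moreover have "1 \<le> t * q" using t q by simp
    ultimately show ?thesis by (simp add: M_def)
  qed
  have Mn: "M < n - 1" "M \<le> n - 1" using tq n(2) unfolding q_def[symmetric] by auto
  note Xp = H_OP_list_props[OF q(2) Mn(2)]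
  let ?P = "\<lambda>ls. (\<Sum>a\<leftarrow>ls. a div q) < t"
  have suff: "?P ls" if "ls \<noteq> []" "ls ! 0 \<le> M" "\<And>k. 1 \<le> k \<Longrightarrow> k < length ls \<Longrightarrow> ls ! k \<le> m" for ls
  proof -
    have "(\<Sum>a\<leftarrow>ls. a div q) = ls ! 0 div q"
      by (rule sum_list_div_small) (use that q in \<open>auto simp: less_Suc_eq_le\<close>)
    also have "\<dots> < t" using that(2) tq by (intro less_mult_imp_div_less) simp
    finally show ?thesis .
  qed
  have X: "?P (H_OP_list n M m)" by (rule suff) (use Xp in \<open>auto simp: H_OP_list_def\<close>)
  have "extremal_OP n (t * (l - 1) + 1) (starlike_tree t l) (fan n (H_OP_list n M m))"
  proof (rule extremal_fan[where P = ?P])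
    show "n \<ge> 12700000" "4 * (t * (l - 1) + 1) \<le> n" using n by auto
    show "n = Suc (sum_list (H_OP_list n M m))" using Xp(1) n by simp
    show "?P (H_OP_list n M m)" by (rule X)
    show "F_free n (fan n ls) (t * (l - 1) + 1) (starlike_tree t l) \<longleftrightarrow> ?P ls" if "n = Suc (sum_list ls)" for ls
      using fan_starlike_free[OF that t] fan_starlike_free_div_bound[OF that] l unfolding q_def by auto
    fix r ls assume r: "0 < r" "r < 1 / (1000 :: real)" and ls: "sorted_wrt (\<ge>) ls" "0 \<notin> set ls" "n = Suc (sum_list ls)"
      and P: "?P ls" and opt: "optimal r ?P ls"
    have r1: "r < 1" using r by simp
    have sum: "sum_list ls = n - 1" using ls(3) by simp
    have ne: "ls \<noteq> []" using sum n by auto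
    have small: "ls ! k \<le> m" if k: "1 \<le> k" "k < length ls" for k
    proof (rule ccontr)
      assume "\<not> ?thesis"
      then have qk: "q \<le> ls ! k" using q by simp
      \<comment> \<open>Only whole blocks are moved: the first path gains as many as path
        \<open>k\<close> loses, so \<open>?P\<close> is preserved.\<close>
      define c where "c = ls ! k div q * q"
      have "0 < ls ! k div q" "0 < q" using qk q by (simp_all add: div_greater_zero_iff)
      then have c: "1 \<le> c" "c \<le> ls ! k"
        unfolding c_def Suc_le_eq One_nat_def by (simp_all only: nat_0_less_mult_iff div_times_less_eq_dividend)
      have "\<not> ?P (ls[0 := ls ! 0 + c, k := ls ! k - c])"
        by (rule optimal_exchange[OF r(1) r1 opt]) (use k c sorted_wrt_nth_less[OF ls(1), of 0 k] in auto)
      moreover have "(\<Sum>a\<leftarrow>ls[0 := ls ! 0 + c, k := ls ! k - c]. a div q) + (ls ! 0 div q + ls ! k div q)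
          = (\<Sum>a\<leftarrow>ls. a div q) + ((ls ! 0 + c) div q + (ls ! k - c) div q)"
        by (rule exchange_sum) (use k in auto)
      moreover have "(ls ! 0 + c) div q = ls ! 0 div q + ls ! k div q" using \<open>0 < q\<close> by (simp add: c_def)
      moreover have "(ls ! k - c) div q = 0" using \<open>0 < q\<close> by (simp add: c_def minus_div_mult_eq_mod)
      ultimately show False using P by simp
    qed
    have "(\<Sum>a\<leftarrow>ls. a div q) = ls ! 0 div q"
      by (rule sum_list_div_small[OF _ ne]) (use small q in \<open>auto simp: less_Suc_eq_le\<close>)
    then have "ls ! 0 < t * q" using P q by (simp add: div_less_iff_less_mult)
    then have hd: "ls ! 0 \<le> M" using tq by simp
    show "ls = H_OP_list n M m"
    proof (rule optimal_eq_H_OP_list[OF r(1) r1 opt ls(1,2) q(2) sum Mn(1) hd small])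
      fix ls' :: "nat list" assume "length ls' = length ls" "ls' ! 0 \<le> M"
        "\<And>k. 1 \<le> k \<Longrightarrow> k < length ls' \<Longrightarrow> ls' ! k \<le> m"
      then show "?P ls'" using ne by (intro suff) auto
    qed
  qed
  then show ?thesis by (simp add: m_def M_def)
qed

text \<open>The exponent \<open>(t - 1) * (l - 1) + l\<close> is the number of vertices of the tree,
  and 4 < 6.5025.\<close>

lemma n0_bound_imp:
  assumes "real n \<ge> n0_bound t l" "t \<ge> 1" "l \<ge> 1"
  shows "n \<ge> 12700000" "4 * (t * (l - 1) + 1) \<le> n"
proof -
  have "real n \<ge> 12700000" using assms(1) by (simp add: n0_bound_def)
  then show "n \<ge> 12700000" by simp
  let ?k = "t * (l - 1) + 1"
  have "(t - 1) * (l - 1) + l = ?k" using assms(2,3) by (cases t; cases l) auto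
  then have "6.5025 * 2 ^ ?k \<le> real n" using assms(1) by (simp add: n0_bound_def)
  moreover have "real ?k \<le> 2 ^ ?k" by (rule less_imp_le[OF of_nat_less_two_power])
  ultimately have "real (4 * ?k) \<le> real n" by simp
  then show "4 * ?k \<le> n" by (simp only: of_nat_le_iff)
qed

lemma square_bound:
  assumes "real n \<ge> (5.08 * real m)\<^sup>2 + 1"
  shows "25 * m\<^sup>2 \<le> n - 1"
proof -
  have "real (25 * m\<^sup>2 + 1) = 25 * (real m)\<^sup>2 + 1" by simp
  also have "\<dots> \<le> 25.8064 * (real m)\<^sup>2 + 1" by (intro add_right_mono mult_right_mono) simp_all
  also have "25.8064 * (real m)\<^sup>2 = (5.08 * real m)\<^sup>2" by (simp add: power_mult_distrib power2_eq_square)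
  also note assms
  finally have "real (25 * m\<^sup>2 + 1) \<le> real n" .
  then have "25 * m\<^sup>2 + 1 \<le> n" by (simp only: of_nat_le_iff)
  then show ?thesis by simp
qed

theorem theorem1:
  fixes t l n :: nat
  shows
   "(t = 1 \<and> l \<ge> 4 \<and>
       real n \<ge> max (n0_bound t l) ((5.08 * real ((l - 2) div 2))^2 + 1) \<longrightarrow>
       extremal_OP n (t * (l - 1) + 1) (starlike_tree t l)
         (K1_join_H_OP n ((l - 2 + 1) div 2) ((l - 2) div 2))) \<and>
    (t = 2 \<and> l \<ge> 3 \<and>
       real n \<ge> max (n0_bound t l) ((5.08 * real ((2 * l - 3) div 2))^2 + 1) \<longrightarrow>
       extremal_OP n (t * (l - 1) + 1) (starlike_tree t l)
         (K1_join_H_OP n ((2 * l - 3 + 1) div 2) ((2 * l - 3) div 2))) \<and>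
    (t \<ge> 4 \<and> l \<ge> 3 \<and> real n \<ge> n0_bound t l \<longrightarrow>
       extremal_OP n (t * (l - 1) + 1) (starlike_tree t l)
         (K1_join_H_OP n (t * l - t - 1) (l - 2)))"
proof (intro conjI impI)
  assume h: "t = 1 \<and> l \<ge> 4 \<and> real n \<ge> max (n0_bound t l) ((5.08 * real ((l - 2) div 2))^2 + 1)"
  then have k: "t * (l - 1) + 1 = l - 2 + 2" by auto
  have n: "n \<ge> 12700000" "4 * (l - 2 + 2) \<le> n"
    using n0_bound_imp[of t l n] h unfolding k by auto
  show "extremal_OP n (t * (l - 1) + 1) (starlike_tree t l)
         (K1_join_H_OP n ((l - 2 + 1) div 2) ((l - 2) div 2))"
    unfolding K1_join_H_OP_eq_fan
    by (rule extremal_path_case[OF _ _ k _ n square_bound]) (use h in auto)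
next
  assume h: "t = 2 \<and> l \<ge> 3 \<and> real n \<ge> max (n0_bound t l) ((5.08 * real ((2 * l - 3) div 2))^2 + 1)"
  then have k: "t * (l - 1) + 1 = 2 * l - 3 + 2" by auto
  have n: "n \<ge> 12700000" "4 * (2 * l - 3 + 2) \<le> n"
    using n0_bound_imp[of t l n] h unfolding k by auto
  show "extremal_OP n (t * (l - 1) + 1) (starlike_tree t l)
         (K1_join_H_OP n ((2 * l - 3 + 1) div 2) ((2 * l - 3) div 2))"
    unfolding K1_join_H_OP_eq_fan
    by (rule extremal_path_case[OF _ _ k _ n square_bound]) (use h in auto)
next
  assume h: "t \<ge> 4 \<and> l \<ge> 3 \<and> real n \<ge> n0_bound t l"
  show "extremal_OP n (t * (l - 1) + 1) (starlike_tree t l)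
         (K1_join_H_OP n (t * l - t - 1) (l - 2))"
    unfolding K1_join_H_OP_eq_fan
    using h n0_bound_imp[of t l n] by (intro extremal_star_case) auto
qed

end
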